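(* Let $k\ge 6$ and let $X$ be a finite $5$-large simplicial complex obtained by performing finitely many steps of the basic construction starting with a complex $X_0$. Assume that: 1) the initial complex $X_0$ is $k$-large; 2) at every step of the basic construction the subgroup $H$ is chosen so that the minimal displacement of the $H$-action on $Th(\Sigma)^{(1)}$ is at least $k$, i.e. $d(v,hv)\ge k$ for every vertex $v$ of $Th(\Sigma)$ and every $1\ne h\in H$, where $d$ is the path metric on $Th(\Sigma)^{(1)}$. Then $X$ is $k$-large and, consequently, the right-angled Coxeter group $W$ with nerve $X$ is $k$-systolic.
   Context: Simplicial complexes. Flag: every finite set of pairwise adjacent vertices spans a simplex. Full subcomplex $A\subseteq X$: every set of vertices of $A$ contained in a simplex of $X$ is contained in a simplex of $A$. $j$-cycle ($j\ge4$): triangulation of the circle with $j$ edges. For $k\ge 4$, a flag complex is $k$-large if it has no $j$-cycle as a full subcomplex for $j<k$; a complex is locally $k$-large if all its links are $k$-large. For $k\ge6$, a flag complex is $k$-systolic if it is simply connected and locally $k$-large; a group is $k$-systolic if it acts geometrically (properly discontinuously and cocompactly) by simplicial automorphisms on a $k$-systolic complex. Right-angled Coxeter groups. A finite flag complex $X$ is the nerve of the right-angled Coxeter system $(W,S)$ with $S=X^{(0)}$, all $s^2=1$, and $(st)^2=1$ exactly when $\{s,t\}$ is an edge. A subset $T\subseteq S$ is spherical if the subgroup $W_T=\langle T\rangle$ is finite. The Davis complex $\Sigma=\Sigma(W,S)$ is the cubical complex with vertex set $W$ and cubes the cosets $wW_T$, $T$ spherical (its barycentric subdivision is the realization of the poset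 of these cosets). $K\subseteq\Sigma$ is the geometric realization of the poset of spherical subsets of $S$ ($T$ identified with $W_T$). For a cubical complex $Y$, the thickening $Th(Y)$ is the simplicial complex with the same vertices, in which a set of vertices spans a simplex iff it lies in a common cube of $Y$. One step of the basic construction. Input: a finite $5$-large complex $X$, with associated $(W,S)$ and $\Sigma$. Choose a torsion-free finite index subgroup $H<W$ such that $d(v,hv)\ge5$ for all vertices $v$ of $Th(\Sigma)$ and all $1\ne h\in H$, where $d$ is the path metric on $Th(\Sigma)^{(1)}$, and such that $Y=H\backslash\Sigma$ admits an orientation: with $p:\Sigma\to Y$ the quotient map, a function $\epsilon:\{p(wK):w\in W\}\to\{-1,1\}$ with $\epsilon(p(swK))=-\epsilon(p(wK))$ for all $w\in W$, $s\in S$. Output: the complex $X'=Th(Y)$ (a finite $5$-large complex), to which the step may be applied again. The initial complex $X_0$ is a finite $5$-large simplicial complex. *)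

theory Defs
  imports "HOL-Analysis.Analysis" "HOL-Algebra.Group_Action"
    "HOL-Algebra.Generated_Groups" "HOL-Library.Extended_Nat"
begin

section \<open>Abstract simplicial complexes\<close>

text \<open>
  A simplicial complex is the set of its nonempty simplices, a simplex being the set of its
  vertices; the vertex set of \<open>X\<close> is \<open>\<Union>X\<close>.
\<close>

definition abs_complex :: "'v set set \<Rightarrow> bool" where
  "abs_complex X \<longleftrightarrow>
     (\<forall>\<sigma>\<in>X. finite \<sigma> \<and> \<sigma> \<noteq> {}) \<and> (\<forall>\<sigma>\<in>X. \<forall>\<tau>. \<tau> \<noteq> {} \<and> \<tau> \<subseteq> \<sigma> \<longrightarrow> \<tau> \<in> X)"

definition flag :: "'v set set \<Rightarrow> bool" where
  "flag X \<longleftrightarrow> abs_complex X \<and>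
     (\<forall>\<sigma>. finite \<sigma> \<and> \<sigma> \<noteq> {} \<and> \<sigma> \<subseteq> \<Union>X \<and> (\<forall>u\<in>\<sigma>. \<forall>v\<in>\<sigma>. u \<noteq> v \<longrightarrow> {u, v} \<in> X) \<longrightarrow> \<sigma> \<in> X)"

definition full_subcomplex :: "'v set set \<Rightarrow> 'v set set \<Rightarrow> bool" where
  "full_subcomplex A X \<longleftrightarrow> abs_complex A \<and> A \<subseteq> X \<and>
     (\<forall>\<tau>. \<tau> \<noteq> {} \<and> \<tau> \<subseteq> \<Union>A \<and> (\<exists>\<sigma>\<in>X. \<tau> \<subseteq> \<sigma>) \<longrightarrow> (\<exists>\<sigma>\<in>A. \<tau> \<subseteq> \<sigma>))"

definition is_cycle :: "nat \<Rightarrow> 'v set set \<Rightarrow> bool" where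
  "is_cycle j C \<longleftrightarrow> 4 \<le> j \<and>
     (\<exists>c. inj_on c {..<j} \<and>
          C = (\<lambda>i. {c i}) ` {..<j} \<union> (\<lambda>i. {c i, c (Suc i mod j)}) ` {..<j})"

definition k_large :: "nat \<Rightarrow> 'v set set \<Rightarrow> bool" where
  "k_large k X \<longleftrightarrow> flag X \<and> (\<forall>j C. j < k \<and> is_cycle j C \<longrightarrow> \<not> full_subcomplex C X)"

definition link :: "'v set set \<Rightarrow> 'v set \<Rightarrow> 'v set set" where
  "link X \<sigma> = {\<tau> \<in> X. \<tau> \<inter> \<sigma> = {} \<and> \<tau> \<union> \<sigma> \<in> X}"

definition locally_k_large :: "nat \<Rightarrow> 'v set set \<Rightarrow> bool" where
  "locally_k_large k X \<longleftrightarrow> abs_complex X \<and> (\<forall>\<sigma>\<in>X. k_large k (link X \<sigma>))"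

definition complex_iso :: "'a set set \<Rightarrow> 'b set set \<Rightarrow> bool" where
  "complex_iso A B \<longleftrightarrow> (\<exists>f. bij_betw f (\<Union>A) (\<Union>B) \<and> (\<lambda>\<sigma>. f ` \<sigma>) ` A = B)"

subsection \<open>Path metric on the 1-skeleton\<close>

definition edge_path :: "'v set set \<Rightarrow> 'v list \<Rightarrow> bool" where
  "edge_path X p \<longleftrightarrow> p \<noteq> [] \<and> set p \<subseteq> \<Union>X \<and>
     (\<forall>i. Suc i < length p \<longrightarrow> p ! i \<noteq> p ! Suc i \<and> {p ! i, p ! Suc i} \<in> X)"

definition skeleton_dist :: "'v set set \<Rightarrow> 'v \<Rightarrow> 'v \<Rightarrow> enat" where
  "skeleton_dist X u v =
     (INF p \<in> {p. edge_path X p \<and> hd p = u \<and> last p = v}. enat (length p - 1))"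

subsection \<open>Geometric realization\<close>

text \<open>
  Points are given by their barycentric coordinates; the topology is the weak (coherent) one:
  a set is open iff its trace on every closed simplex is open. On a closed simplex the product
  topology of \<^typ>\<open>'v \<Rightarrow> real\<close> is the Euclidean one.
\<close>

definition realization_points :: "'v set set \<Rightarrow> ('v \<Rightarrow> real) set" where
  "realization_points X =
     {\<alpha>. (\<forall>v. 0 \<le> \<alpha> v) \<and> {v. \<alpha> v \<noteq> 0} \<in> X \<and> (\<Sum>v | \<alpha> v \<noteq> 0. \<alpha> v) = 1}"

definition closed_simplex :: "'v set set \<Rightarrow> 'v set \<Rightarrow> ('v \<Rightarrow> real) set" where
  "closed_simplex X \<sigma> = {\<alpha> \<in> realization_points X. {v. \<alpha> v \<noteq> 0} \<subseteq> \<sigma>}"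

definition weak_open :: "'v set set \<Rightarrow> ('v \<Rightarrow> real) set \<Rightarrow> bool" where
  "weak_open X U \<longleftrightarrow> U \<subseteq> realization_points X \<and>
     (\<forall>\<sigma>\<in>X. openin (top_of_set (closed_simplex X \<sigma>)) (U \<inter> closed_simplex X \<sigma>))"

lemma istopology_weak_open: "istopology (weak_open X)"
proof -
  have "weak_open X (S \<inter> T)" if "weak_open X S" "weak_open X T" for S T
  proof -
    have "S \<inter> T \<inter> C = (S \<inter> C) \<inter> (T \<inter> C)" for C :: "('a \<Rightarrow> real) set"
      by blast
    with that show ?thesis
      unfolding weak_open_def by (auto intro: openin_Int)
  qed
  moreover have "weak_open X (\<Union>\<K>)" if "\<forall>K\<in>\<K>. weak_open X K" for \<K>
  proof -
    have *: "\<Union>\<K> \<inter> C = \<Union>((\<lambda>K. K \<inter> C) ` \<K>)" for C :: "('a \<Rightarrow> real) set"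
      by blast
    from that show ?thesis
      unfolding weak_open_def * by (blast intro: openin_Union)
  qed
  ultimately show ?thesis
    unfolding istopology_def by blast
qed

definition realization :: "'v set set \<Rightarrow> ('v \<Rightarrow> real) topology" where
  "realization X = topology (weak_open X)"

definition realization_map :: "('v \<Rightarrow> 'w) \<Rightarrow> ('v \<Rightarrow> real) \<Rightarrow> ('w \<Rightarrow> real)" where
  "realization_map f \<alpha> = (\<lambda>w. \<Sum>v | \<alpha> v \<noteq> 0 \<and> f v = w. \<alpha> v)"

definition simply_connected_space :: "'a topology \<Rightarrow> bool" where
  "simply_connected_space T \<longleftrightarrow> topspace T \<noteq> {} \<and> path_connected_space T \<and>
     (\<forall>p. pathin T p \<and> p 1 = p 0 \<longrightarrow>
        homotopic_with (\<lambda>r. r 0 = p 0 \<and> r 1 = p 0) (top_of_set {0..1}) T p (\<lambda>_. p 0))"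

section \<open>Systolic complexes and groups\<close>

definition k_systolic :: "nat \<Rightarrow> 'v set set \<Rightarrow> bool" where
  "k_systolic k X \<longleftrightarrow>
     flag X \<and> simply_connected_space (realization X) \<and> locally_k_large k X"

definition simplicial_action :: "('g, 'm) monoid_scheme \<Rightarrow> 'v set set \<Rightarrow> ('g \<Rightarrow> 'v \<Rightarrow> 'v) \<Rightarrow> bool" where
  "simplicial_action G X \<phi> \<longleftrightarrow>
     group_action G (\<Union>X) \<phi> \<and> (\<forall>g\<in>carrier G. \<forall>\<sigma>\<in>X. \<phi> g ` \<sigma> \<in> X)"

definition properly_discontinuous :: "('g, 'm) monoid_scheme \<Rightarrow> 'v set set \<Rightarrow> ('g \<Rightarrow> 'v \<Rightarrow> 'v) \<Rightarrow> bool" where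
  "properly_discontinuous G X \<phi> \<longleftrightarrow>
     (\<forall>C. compactin (realization X) C \<longrightarrow>
        finite {g \<in> carrier G. realization_map (\<phi> g) ` C \<inter> C \<noteq> {}})"

definition cocompact :: "('g, 'm) monoid_scheme \<Rightarrow> 'v set set \<Rightarrow> ('g \<Rightarrow> 'v \<Rightarrow> 'v) \<Rightarrow> bool" where
  "cocompact G X \<phi> \<longleftrightarrow>
     (\<exists>C. compactin (realization X) C \<and>
        (\<Union>g\<in>carrier G. realization_map (\<phi> g) ` C) = topspace (realization X))"

definition geometric_action :: "('g, 'm) monoid_scheme \<Rightarrow> 'v set set \<Rightarrow> ('g \<Rightarrow> 'v \<Rightarrow> 'v) \<Rightarrow> bool" where
  "geometric_action G X \<phi> \<longleftrightarrow>
     simplicial_action G X \<phi> \<and> properly_discontinuous G X \<phi> \<and> cocompact G X \<phi>"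

text \<open>
  HOL cannot quantify over the type of vertices. Nothing is lost by taking natural numbers: a
  connected complex with a geometric action is locally finite, hence has countably many vertices.
\<close>

definition k_systolic_group :: "nat \<Rightarrow> ('g, 'm) monoid_scheme \<Rightarrow> bool" where
  "k_systolic_group k G \<longleftrightarrow>
     (\<exists>(X :: nat set set) \<phi>. k_systolic k X \<and> geometric_action G X \<phi>)"

section \<open>The right-angled Coxeter group with nerve \<open>X\<close>\<close>

text \<open>
  The group is given by its presentation as a quotient of the set of words over \<open>S = \<Union>X\<close>. Words
  need no formal inverses, since the relators \<open>ss\<close> make every generator an involution.
\<close>

definition racg_relators :: "'v set set \<Rightarrow> 'v list set" where
  "racg_relators X =
     {[s, s] | s. s \<in> \<Union>X} \<union> {[s, t, s, t] | s t. s \<noteq> t \<and> {s, t} \<in> X}"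

definition racg_step :: "'v set set \<Rightarrow> ('v list \<times> 'v list) set" where
  "racg_step X =
     {(u @ r @ v, u @ v) | u r v. u \<in> lists (\<Union>X) \<and> v \<in> lists (\<Union>X) \<and> r \<in> racg_relators X}"

definition racg_eq :: "'v set set \<Rightarrow> ('v list \<times> 'v list) set" where
  "racg_eq X = (racg_step X \<union> (racg_step X)\<inverse>)\<^sup>*"

definition racg :: "'v set set \<Rightarrow> 'v list set monoid" where
  "racg X =
     \<lparr>carrier = lists (\<Union>X) // racg_eq X,
      mult = (\<lambda>A B. racg_eq X `` {u @ v | u v. u \<in> A \<and> v \<in> B}),
      one = racg_eq X `` {[]}\<rparr>"

definition racg_gen :: "'v set set \<Rightarrow> 'v \<Rightarrow> 'v list set" where
  "racg_gen X s = racg_eq X `` {[s]}"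

definition special_subgroup :: "'v set set \<Rightarrow> 'v set \<Rightarrow> 'v list set set" where
  "special_subgroup X T = generate (racg X) (racg_gen X ` T)"

definition spherical :: "'v set set \<Rightarrow> 'v set \<Rightarrow> bool" where
  "spherical X T \<longleftrightarrow> T \<subseteq> \<Union>X \<and> finite (special_subgroup X T)"

section \<open>Davis complex and basic construction\<close>

text \<open>
  A cubical complex is represented by the vertex sets of its cubes; for the Davis complex these
  are the cosets \<open>wW\<^sub>T\<close>.
\<close>

definition davis_cubes :: "'v set set \<Rightarrow> 'v list set set set" where
  "davis_cubes X =
     {w <#\<^bsub>racg X\<^esub> special_subgroup X T | w T. w \<in> carrier (racg X) \<and> spherical X T}"

definition thickening :: "'a set set \<Rightarrow> 'a set set" where
  "thickening Y = {\<sigma>. finite \<sigma> \<and> \<sigma> \<noteq> {} \<and> (\<exists>C\<in>Y. \<sigma> \<subseteq> C)}"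

text \<open>
  The quotient map by \<open>H\<close> on (vertex sets of) cubes; the vertices of the quotient are the
  cosets \<open>Hw\<close>.
\<close>

definition quotient_cell :: "'v set set \<Rightarrow> 'v list set set \<Rightarrow> 'v list set set \<Rightarrow> 'v list set set set" where
  "quotient_cell X H C = (\<lambda>w. H #>\<^bsub>racg X\<^esub> w) ` C"

definition quotient_cubes :: "'v set set \<Rightarrow> 'v list set set \<Rightarrow> 'v list set set set set" where
  "quotient_cubes X H = quotient_cell X H ` davis_cubes X"

text \<open>
  The translate \<open>wK\<close> is a full subcomplex of the barycentric subdivision of the Davis complex;
  it is represented by its vertices, the cosets \<open>wW\<^sub>T\<close> with \<open>T\<close> spherical.
\<close>

definition chamber :: "'v set set \<Rightarrow> 'v list set \<Rightarrow> 'v list set set set" where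
  "chamber X w = {w <#\<^bsub>racg X\<^esub> special_subgroup X T | T. spherical X T}"

definition quotient_chamber :: "'v set set \<Rightarrow> 'v list set set \<Rightarrow> 'v list set \<Rightarrow> 'v list set set set set" where
  "quotient_chamber X H w = quotient_cell X H ` chamber X w"

definition orientable_quotient :: "'v set set \<Rightarrow> 'v list set set \<Rightarrow> bool" where
  "orientable_quotient X H \<longleftrightarrow>
     (\<exists>\<epsilon> :: 'v list set set set set \<Rightarrow> int.
        \<epsilon> ` (quotient_chamber X H ` carrier (racg X)) \<subseteq> {-1, 1} \<and>
        (\<forall>w\<in>carrier (racg X). \<forall>s\<in>\<Union>X.
           \<epsilon> (quotient_chamber X H (racg_gen X s \<otimes>\<^bsub>racg X\<^esub> w)) = - \<epsilon> (quotient_chamber X H w)))"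

definition torsion_free :: "('g, 'm) monoid_scheme \<Rightarrow> 'g set \<Rightarrow> bool" where
  "torsion_free G H \<longleftrightarrow> (\<forall>h\<in>H. \<forall>n::nat. 0 < n \<and> h [^]\<^bsub>G\<^esub> n = \<one>\<^bsub>G\<^esub> \<longrightarrow> h = \<one>\<^bsub>G\<^esub>)"

definition min_displacement_ge :: "nat \<Rightarrow> 'v set set \<Rightarrow> 'v list set set \<Rightarrow> bool" where
  "min_displacement_ge k X H \<longleftrightarrow>
     (\<forall>v \<in> \<Union>(thickening (davis_cubes X)). \<forall>h\<in>H. h \<noteq> \<one>\<^bsub>racg X\<^esub> \<longrightarrow>
        enat k \<le> skeleton_dist (thickening (davis_cubes X)) v (h \<otimes>\<^bsub>racg X\<^esub> v))"

text \<open>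
  \<open>X'\<close> is the output of one step with input \<open>X\<close> and chosen subgroup \<open>H\<close>. The output is only
  determined up to isomorphism, so that all complexes of an iteration may share one type of
  vertices.
\<close>

definition basic_step :: "'v set set \<Rightarrow> 'v list set set \<Rightarrow> 'w set set \<Rightarrow> bool" where
  "basic_step X H X' \<longleftrightarrow>
     finite X \<and> k_large 5 X \<and>
     subgroup H (racg X) \<and> finite (rcosets\<^bsub>racg X\<^esub> H) \<and> torsion_free (racg X) H \<and>
     min_displacement_ge 5 X H \<and> orientable_quotient X H \<and>
     complex_iso (thickening (quotient_cubes X H)) X'"

end

theory Submission
  imports Defs
begin

text \<open>
  The vertices of the thickening of the Davis complex are the group elements, and \<open>x\<close> and \<open>y\<close> are
  adjacent iff \<open>y\<close> is obtained from \<open>x\<close> by multiplication with a product of pairwise commuting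
  generators. Let the height of an element be the number of layers of its Cartier-Foata normal
  form. Deleting the last layer of an element \<open>x \<noteq> 1\<close> gives an element of smaller height that is
  adjacent to every neighbour of \<open>x\<close> of at most the same height. Two consequences follow. Pushing
  down the top vertices contracts every loop, so the thickening is simply connected. Pushing down a
  top vertex of a shortest induced cycle either lowers the cycle or exhibits it in the link of a
  vertex, and such a link is an inflated copy of the nerve, so the thickening is \<open>k\<close>-large if the
  nerve is. Cliques and cycles of length less than \<open>k\<close> in the quotient lift to the thickening,
  because the displacement of the subgroup is at least \<open>k\<close>; hence \<open>k\<close>-largeness passes from each
  complex of the iteration to the next.
\<close>

section \<open>Clique complexes and induced cycles\<close>

text \<open>Word length would not do as the height. Suppose that s, t, u and s, t, v span triangles
  while u and v do not commute. Then stu has the shorter neighbour uv, but removing all final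
  letters of stu leaves 1, which is not adjacent to uv. Counted in layers, uv lies above stu: a
  letter that fails to commute with some letter of the last layer must open a new layer. Neighbours
  of equal height have to be included because a top vertex of a cycle or of a simplex may have
  neighbours as high as itself.

  Layers are read off words by letting letters fall, and the relators act trivially on the resulting
  heaps. That a heap also detects the trivial element enters at the base of the descent: only 1 has
  height 0.

  The local condition is met by a second descent of the same kind, in which a simplex is shrunk to
  one of its vertices. In the quotient two walk lengths matter: lifting a clique produces walks of
  length 3 from a vertex to a translate of it, whence \<open>4 \<le> k\<close>, and lifting a cycle
  of length \<open>j\<close> produces a walk of length \<open>j < k\<close>.\<close>

definition clique_complex :: "'v set \<Rightarrow> ('v \<Rightarrow> 'v \<Rightarrow> bool) \<Rightarrow> 'v set set" where
  "clique_complex V R = {\<sigma>. finite \<sigma> \<and> \<sigma> \<noteq> {} \<and> \<sigma> \<subseteq> V \<and> (\<forall>x\<in>\<sigma>. \<forall>y\<in>\<sigma>. R x y)}"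

text \<open>\<open>R\<close> is meant reflexively, as equal or adjacent, so only pairs of distinct
  indices are tested. Listing them with \<open>i < m\<close> replaces the arithmetic modulo
  \<open>j\<close> of \<open>is_cycle\<close>; the closing edge joins 0 and
  \<open>j - 1\<close>.\<close>

definition induced_cycle :: "'v set \<Rightarrow> ('v \<Rightarrow> 'v \<Rightarrow> bool) \<Rightarrow> nat \<Rightarrow> (nat \<Rightarrow> 'v) \<Rightarrow> bool" where
  "induced_cycle V R j c \<longleftrightarrow> c ` {..<j} \<subseteq> V \<and> inj_on c {..<j} \<and>
     (\<forall>i m. i < m \<and> m < j \<longrightarrow> R (c i) (c m) = (m = Suc i \<or> (i = 0 \<and> Suc m = j)))"

definition no_short_cycle :: "nat \<Rightarrow> 'v set \<Rightarrow> ('v \<Rightarrow> 'v \<Rightarrow> bool) \<Rightarrow> bool" where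
  "no_short_cycle k V R \<longleftrightarrow> (\<forall>j c. 4 \<le> j \<and> j < k \<longrightarrow> \<not> induced_cycle V R j c)"

lemma Union_clique_complex:
  assumes "\<And>x. x \<in> V \<Longrightarrow> R x x"
  shows "\<Union>(clique_complex V R) = V"
proof
  show "V \<subseteq> \<Union>(clique_complex V R)"
  proof
    fix x assume "x \<in> V"
    then have "{x} \<in> clique_complex V R"
      using assms by (auto simp: clique_complex_def)
    then show "x \<in> \<Union>(clique_complex V R)"
      by blast
  qed
qed (auto simp: clique_complex_def)

lemma abs_complex_clique_complex: "abs_complex (clique_complex V R)"
  unfolding abs_complex_def clique_complex_def by (auto intro: finite_subset)

lemma pair_in_clique_complex:
  assumes "\<And>x. x \<in> V \<Longrightarrow> R x x" "\<And>x y. R x y \<Longrightarrow> R y x"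
  shows "{x, y} \<in> clique_complex V R \<longleftrightarrow> x \<in> V \<and> y \<in> V \<and> R x y"
  using assms by (auto simp: clique_complex_def)

lemma flag_clique_complex:
  assumes refl: "\<And>x. x \<in> V \<Longrightarrow> R x x" and sym: "\<And>x y. R x y \<Longrightarrow> R y x"
  shows "flag (clique_complex V R)"
  unfolding flag_def
proof (intro conjI allI impI)
  show "abs_complex (clique_complex V R)"
    by (rule abs_complex_clique_complex)
next
  fix \<sigma> assume *: "finite \<sigma> \<and> \<sigma> \<noteq> {} \<and> \<sigma> \<subseteq> \<Union>(clique_complex V R) \<and>
     (\<forall>u\<in>\<sigma>. \<forall>v\<in>\<sigma>. u \<noteq> v \<longrightarrow> {u, v} \<in> clique_complex V R)"
  then have "\<sigma> \<subseteq> V"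
    by (simp add: Union_clique_complex refl)
  moreover have "R x y" if "x \<in> \<sigma>" "y \<in> \<sigma>" for x y
    using * that \<open>\<sigma> \<subseteq> V\<close> refl by (cases "x = y") (auto simp: pair_in_clique_complex[of V R, OF refl sym])
  ultimately show "\<sigma> \<in> clique_complex V R"
    using * by (auto simp: clique_complex_def)
qed

lemma abs_complex_face: "abs_complex X \<Longrightarrow> \<sigma> \<in> X \<Longrightarrow> \<tau> \<subseteq> \<sigma> \<Longrightarrow> \<tau> \<noteq> {} \<Longrightarrow> \<tau> \<in> X"
  unfolding abs_complex_def by blast

lemma flag_face: "flag X \<Longrightarrow> \<sigma> \<in> X \<Longrightarrow> \<tau> \<subseteq> \<sigma> \<Longrightarrow> \<tau> \<noteq> {} \<Longrightarrow> \<tau> \<in> X"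
  unfolding flag_def abs_complex_def by blast

lemma flag_finite: "flag X \<Longrightarrow> \<sigma> \<in> X \<Longrightarrow> finite \<sigma>"
  and flag_nonempty: "flag X \<Longrightarrow> \<sigma> \<in> X \<Longrightarrow> \<sigma> \<noteq> {}"
  unfolding flag_def abs_complex_def by blast+

lemma flag_cliqueI:
  assumes "flag X" "finite \<sigma>" "\<sigma> \<noteq> {}" "\<sigma> \<subseteq> \<Union>X" "\<And>u v. u \<in> \<sigma> \<Longrightarrow> v \<in> \<sigma> \<Longrightarrow> u \<noteq> v \<Longrightarrow> {u, v} \<in> X"
  shows "\<sigma> \<in> X"
  using assms(2-5) assms(1)[unfolded flag_def, THEN conjunct2, rule_format, of \<sigma>] by blast

lemma flag_eq_clique_complex:
  assumes "flag X"
  shows "X = clique_complex (\<Union>X) (\<lambda>u v. {u, v} \<in> X)"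
proof (rule subset_antisym; rule subsetI)
  fix \<sigma> assume \<sigma>: "\<sigma> \<in> X"
  have "\<forall>u\<in>\<sigma>. \<forall>v\<in>\<sigma>. {u, v} \<in> X"
    using flag_face[OF assms \<sigma>] by simp
  with flag_finite[OF assms \<sigma>] flag_nonempty[OF assms \<sigma>] Union_upper[OF \<sigma>]
  show "\<sigma> \<in> clique_complex (\<Union>X) (\<lambda>u v. {u, v} \<in> X)"
    unfolding clique_complex_def mem_Collect_eq by (intro conjI)
next
  fix \<sigma> assume "\<sigma> \<in> clique_complex (\<Union>X) (\<lambda>u v. {u, v} \<in> X)"
  then show "\<sigma> \<in> X"
    unfolding clique_complex_def mem_Collect_eq by (elim conjE) (rule flag_cliqueI[OF assms], auto)
qed

text \<open>Translates between the cyclic successor of \<open>is_cycle\<close> and the ordered pairs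
  of \<open>induced_cycle\<close>. The pair of 0 and \<open>j - 1\<close> stems from
  \<open>l = j - 1\<close>, where the successor wraps around.\<close>

lemma cycle_neighbour_iff:
  assumes "i < m" "m < j" "4 \<le> j"
  shows "(\<exists>l<j. {i, m} = {l, Suc l mod j}) \<longleftrightarrow> m = Suc i \<or> (i = 0 \<and> Suc m = j)"
proof
  assume "\<exists>l<j. {i, m} = {l, Suc l mod j}"
  then obtain l where l: "l < j" "{i, m} = {l, Suc l mod j}"
    by blast
  show "m = Suc i \<or> (i = 0 \<and> Suc m = j)"
  proof (cases "Suc l = j")
    case True
    then show ?thesis using l assms by (auto simp: doubleton_eq_iff)
  next
    case False
    then have "Suc l mod j = Suc l" using l by simp
    then show ?thesis using l assms by (auto simp: doubleton_eq_iff)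
  qed
next
  assume "m = Suc i \<or> (i = 0 \<and> Suc m = j)"
  then show "\<exists>l<j. {i, m} = {l, Suc l mod j}"
  proof
    assume "m = Suc i"
    then show ?thesis using assms by (intro exI[of _ i]) auto
  next
    assume "i = 0 \<and> Suc m = j"
    then show ?thesis using assms by (intro exI[of _ m]) auto
  qed
qed

text \<open>Fullness speaks of arbitrary vertex sets, an induced cycle only of pairs. They agree
  because cycle vertices in a common simplex have pairwise neighbouring indices, and for
  \<open>j \<ge> 4\<close> at most two indices are pairwise neighbours.\<close>

lemma k_large_clique_complex:
  fixes V :: "'v set"
  assumes refl: "\<And>x. x \<in> V \<Longrightarrow> R x x" and sym: "\<And>x y. R x y \<Longrightarrow> R y x"
  shows "k_large k (clique_complex V R) \<longleftrightarrow> no_short_cycle k V R"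
proof -
  let ?X = "clique_complex V R"
  note pair = pair_in_clique_complex[of V R, OF refl sym]
  note UX = Union_clique_complex[of V R, OF refl]
  define cyc where "cyc j c = (\<lambda>i. {c i}) ` {..<j} \<union> (\<lambda>i. {c i, c (Suc i mod j)}) ` {..<j}"
    for j and c :: "nat \<Rightarrow> 'v"
  have in_cyc: "{c i, c m} \<in> cyc j c \<longleftrightarrow> m = Suc i \<or> (i = 0 \<and> Suc m = j)"
    if "inj_on c {..<j}" "4 \<le> j" "i < m" "m < j" for j c i m
  proof -
    have "{c i, c m} \<in> cyc j c \<longleftrightarrow> (\<exists>l<j. {c i, c m} = {c l, c (Suc l mod j)})"
      using that by (auto simp: cyc_def inj_on_eq_iff doubleton_eq_iff)
    also have "\<dots> \<longleftrightarrow> (\<exists>l<j. c ` {i, m} = c ` {l, Suc l mod j})"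
      by simp
    also have "\<dots> \<longleftrightarrow> (\<exists>l<j. {i, m} = {l, Suc l mod j})"
      using that by (intro ex_cong1 conj_cong HOL.refl inj_on_image_eq_iff[of _ "{..<j}"]) auto
    also have "\<dots> \<longleftrightarrow> m = Suc i \<or> (i = 0 \<and> Suc m = j)"
      using that by (intro cycle_neighbour_iff) auto
    finally show ?thesis .
  qed
  have Ucyc: "\<Union>(cyc j c) = c ` {..<j}" if "4 \<le> j" for j c
    using that by (auto simp: cyc_def)
  have abs_cyc: "abs_complex (cyc j c)" if "4 \<le> j" for j c
  proof -
    have "\<tau> \<in> cyc j c" if "\<tau> \<noteq> {}" "\<tau> \<subseteq> {c i, c (Suc i mod j)}" "i < j" for \<tau> i
    proof -
      have "\<tau> = {c i} \<or> \<tau> = {c (Suc i mod j)} \<or> \<tau> = {c i, c (Suc i mod j)}"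
        using that by auto
      moreover have "Suc i mod j < j" using \<open>4 \<le> j\<close> by simp
      ultimately show ?thesis
        using \<open>i < j\<close> by (auto simp: cyc_def)
    qed
    then show ?thesis
      unfolding abs_complex_def by (auto simp: cyc_def)
  qed
  have "full_subcomplex (cyc j c) ?X \<longleftrightarrow> induced_cycle V R j c"
    if j: "4 \<le> j" and inj: "inj_on c {..<j}" for j c
  proof
    assume F: "full_subcomplex (cyc j c) ?X"
    have sub: "cyc j c \<subseteq> ?X" using F by (simp add: full_subcomplex_def)
    have cV: "c ` {..<j} \<subseteq> V"
      using Union_mono[OF sub] Ucyc[OF j, of c] UX by simp
    have "R (c i) (c m) = (m = Suc i \<or> (i = 0 \<and> Suc m = j))" if im: "i < m" "m < j" for i m
    proof
      assume "R (c i) (c m)"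
      then have "{c i, c m} \<in> ?X"
        using cV im by (subst pair) auto
      moreover have "{c i, c m} \<noteq> {}" "{c i, c m} \<subseteq> \<Union>(cyc j c)"
        using im by (auto simp: Ucyc[OF j])
      ultimately have "\<exists>\<sigma>\<in>cyc j c. {c i, c m} \<subseteq> \<sigma>"
        using F unfolding full_subcomplex_def by (metis order_refl)
      then have "{c i, c m} \<in> cyc j c"
        using abs_cyc[OF j, of c] unfolding abs_complex_def by (metis insert_not_empty)
      then show "m = Suc i \<or> (i = 0 \<and> Suc m = j)"
        using in_cyc[OF inj j im] by simp
    next
      assume "m = Suc i \<or> (i = 0 \<and> Suc m = j)"
      then have "{c i, c m} \<in> ?X"
        using in_cyc[OF inj j im] sub by blast
      then show "R (c i) (c m)"
        by (simp add: pair)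
    qed
    then show "induced_cycle V R j c"
      using cV inj by (auto simp: induced_cycle_def)
  next
    assume I: "induced_cycle V R j c"
    then have cV: "\<And>i. i < j \<Longrightarrow> c i \<in> V"
      and adj: "\<And>i m. i < m \<Longrightarrow> m < j \<Longrightarrow> R (c i) (c m) = (m = Suc i \<or> (i = 0 \<and> Suc m = j))"
      by (auto simp: induced_cycle_def)
    have "R (c i) (c (Suc i mod j))" if "i < j" for i
    proof (cases "Suc i = j")
      case True
      then show ?thesis using adj[of 0 i] j by (auto intro: sym)
    next
      case False
      then show ?thesis using adj[of i "Suc i"] j that by auto
    qed
    then have sub: "cyc j c \<subseteq> ?X"
      using cV j refl by (auto simp: cyc_def pair) (auto simp: clique_complex_def)
    moreover have "\<exists>\<rho>\<in>cyc j c. \<tau> \<subseteq> \<rho>"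
      if \<tau>: "\<tau> \<noteq> {}" "\<tau> \<subseteq> \<Union>(cyc j c)" "\<exists>\<sigma>\<in>?X. \<tau> \<subseteq> \<sigma>" for \<tau>
    proof -
      obtain I where I: "I \<subseteq> {..<j}" "\<tau> = c ` I"
        using \<tau>(2) Ucyc[OF j, of c] by (auto simp: subset_image_iff)
      have close: "m = Suc i \<or> (i = 0 \<and> Suc m = j)" if "i \<in> I" "m \<in> I" "i < m" for i m
      proof -
        have "c i \<in> \<tau>" "c m \<in> \<tau>" using that I by auto
        then have "R (c i) (c m)" using \<tau>(3) unfolding clique_complex_def by blast
        then show ?thesis using adj[of i m] that I(1) by auto
      qed
      have finI: "finite I" "I \<noteq> {}"
        using I \<tau>(1) finite_subset by auto
      \<comment> \<open>An index strictly between the extremes would have to be the successor of the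
        one and the predecessor of the other, which leaves only 0, 1, 2 with
        \<open>j = 3\<close>.\<close>
      define i m where "i = Min I" and "m = Max I"
      have im: "i \<in> I" "m \<in> I" "\<And>l. l \<in> I \<Longrightarrow> i \<le> l \<and> l \<le> m"
        using finI by (auto simp: i_def m_def)
      have sub': "I \<subseteq> {i, m}"
      proof
        fix l assume l: "l \<in> I"
        show "l \<in> {i, m}"
        proof (rule ccontr)
          assume "l \<notin> {i, m}"
          then have "i < l" "l < m"
            using im(3)[OF l] by auto
          with close[of i l] close[of l m] close[of i m] l im j I(1) show False
            by auto
        qed
      qed
      show ?thesis
      proof (cases "i = m")
        case True
        then have "\<tau> \<subseteq> {c i}" "{c i} \<in> cyc j c"
          using I sub' im by (auto simp: cyc_def)
        then show ?thesis by blast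
      next
        case False
        then have lt: "i < m" using im(3)[OF im(1)] by simp
        have "m < j" using im I by auto
        have "{c i, c m} \<in> cyc j c"
          using in_cyc[OF inj j lt \<open>m < j\<close>] close[OF im(1,2) lt] by simp
        moreover have "\<tau> \<subseteq> {c i, c m}"
          using I sub' by auto
        ultimately show ?thesis by (intro bexI)
      qed
    qed
    ultimately show "full_subcomplex (cyc j c) ?X"
      using abs_cyc[OF j, of c] unfolding full_subcomplex_def by (intro conjI allI impI) auto
  qed
  then have full: "full_subcomplex (cyc j c) ?X \<longleftrightarrow> induced_cycle V R j c"
    if "4 \<le> j" "inj_on c {..<j}" for j c
    using that by blast
  have cyc: "is_cycle j C \<longleftrightarrow> 4 \<le> j \<and> (\<exists>c. inj_on c {..<j} \<and> C = cyc j c)" for j and C :: "'v set set"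
    by (simp add: is_cycle_def cyc_def)
  show ?thesis
  proof
    assume L: "k_large k ?X"
    show "no_short_cycle k V R"
      unfolding no_short_cycle_def
    proof (intro allI impI notI)
      fix j c assume j: "4 \<le> j \<and> j < k" and c: "induced_cycle V R j c"
      then have inj: "inj_on c {..<j}" by (simp add: induced_cycle_def)
      have "full_subcomplex (cyc j c) ?X"
        using full[OF _ inj] j c by blast
      moreover have "is_cycle j (cyc j c)"
        unfolding cyc using j inj by blast
      moreover have "\<not> full_subcomplex C ?X" if "is_cycle j C" for C
        using L j that unfolding k_large_def by blast
      ultimately show False by blast
    qed
  next
    assume N: "no_short_cycle k V R"
    show "k_large k ?X"
      unfolding k_large_def
    proof (intro conjI allI impI notI)
      show "flag ?X" by (rule flag_clique_complex[OF refl sym])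
      fix j C assume j: "j < k \<and> is_cycle j C" and C: "full_subcomplex C ?X"
      then obtain c where "4 \<le> j" "inj_on c {..<j}" "C = cyc j c" using cyc by blast
      then have "induced_cycle V R j c" using full C by simp
      moreover have "\<not> induced_cycle V R j c"
        using N j \<open>4 \<le> j\<close> unfolding no_short_cycle_def by blast
      ultimately show False by blast
    qed
  qed
qed

lemma k_large_flag:
  assumes "flag X"
  shows "k_large k X \<longleftrightarrow> no_short_cycle k (\<Union>X) (\<lambda>u v. {u, v} \<in> X)"
proof -
  have "{x, x} \<in> X" if x: "x \<in> \<Union>X" for x
  proof -
    obtain \<sigma> where "\<sigma> \<in> X" "x \<in> \<sigma>" using x by blast
    then show ?thesis using flag_face[OF assms, of \<sigma> "{x, x}"] by simp
  qed
  moreover have "{v, u} \<in> X" if "{u, v} \<in> X" for u v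
    using that by (simp only: insert_commute)
  ultimately have "k_large k (clique_complex (\<Union>X) (\<lambda>u v. {u, v} \<in> X)) \<longleftrightarrow>
      no_short_cycle k (\<Union>X) (\<lambda>u v. {u, v} \<in> X)"
    by (rule k_large_clique_complex)
  then show ?thesis
    by (rule trans[OF arg_cong[OF flag_eq_clique_complex[OF assms], of "k_large k"]])
qed

section \<open>Transport and surgery of induced cycles\<close>

lemma no_short_cycle_map:
  assumes "no_short_cycle k V' R'" "inj_on f V" "f ` V \<subseteq> V'"
    and "\<And>x y. x \<in> V \<Longrightarrow> y \<in> V \<Longrightarrow> R' (f x) (f y) = R x y"
  shows "no_short_cycle k V R"
  unfolding no_short_cycle_def
proof (intro allI impI notI)
  fix j c assume j: "4 \<le> j \<and> j < k" and c: "induced_cycle V R j c"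
  then have cV: "c i \<in> V" if "i < j" for i
    using that by (auto simp: induced_cycle_def)
  have "induced_cycle V' R' j (f \<circ> c)"
    unfolding induced_cycle_def
  proof (intro conjI allI impI)
    show "(f \<circ> c) ` {..<j} \<subseteq> V'"
      using cV assms(3) by auto
    show "inj_on (f \<circ> c) {..<j}"
      using c assms(2) by (intro comp_inj_on) (auto simp: induced_cycle_def intro: inj_on_subset)
    fix i m assume "i < m \<and> m < j"
    then show "R' ((f \<circ> c) i) ((f \<circ> c) m) = (m = Suc i \<or> i = 0 \<and> Suc m = j)"
      using c cV assms(4) by (auto simp: induced_cycle_def)
  qed
  then show False
    using assms(1) j by (auto simp: no_short_cycle_def)
qed

text \<open>Brings the vertex that is to be pushed down to index 0, the position treated by
  \<open>induced_cycle_replace\<close>.\<close>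

lemma induced_cycle_rotate:
  assumes sym: "\<And>x y. R x y \<Longrightarrow> R y x" and c: "induced_cycle V R j c" and a: "a < j"
  defines "c' \<equiv> \<lambda>i. c ((i + a) mod j)"
  shows "induced_cycle V R j c'" "c' ` {..<j} = c ` {..<j}" "c' 0 = c a"
proof -
  have m: "(i + a) mod j = (if i + a < j then i + a else i + a - j)" if "i < j" for i
    using that a by (auto simp: mod_if)
  have cV: "\<And>i. i < j \<Longrightarrow> c i \<in> V"
    and inj: "inj_on c {..<j}"
    and adj: "\<And>i m. i < m \<Longrightarrow> m < j \<Longrightarrow> R (c i) (c m) = (m = Suc i \<or> (i = 0 \<and> Suc m = j))"
    using c by (auto simp: induced_cycle_def)
  have rot: "bij_betw (\<lambda>i. (i + a) mod j) {..<j} {..<j}"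
  proof (rule bij_betw_byWitness[where f' = "\<lambda>i. (i + (j - a)) mod j"])
    show "\<forall>i\<in>{..<j}. ((i + a) mod j + (j - a)) mod j = i"
      using a m by auto
    show "\<forall>i\<in>{..<j}. ((i + (j - a)) mod j + a) mod j = i"
      using a by (simp add: mod_add_left_eq)
  qed (use a in auto)
  show img: "c' ` {..<j} = c ` {..<j}"
    using bij_betw_imp_surj_on[OF rot] unfolding c'_def by (metis image_image)
  show "c' 0 = c a"
    using a by (simp add: c'_def)
  have "inj_on (c \<circ> (\<lambda>i. (i + a) mod j)) {..<j}"
    using rot inj by (intro comp_inj_on) (auto simp: bij_betw_def)
  then have inj': "inj_on c' {..<j}"
    by (simp add: c'_def comp_def)
  have "R (c' i) (c' m) = (m = Suc i \<or> (i = 0 \<and> Suc m = j))" if im: "i < m" "m < j" for i m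
  proof -
    \<comment> \<open>The shifted indices wrap around not at all, only for the larger one, or both.
      The middle case exchanges their order and therefore uses symmetry.\<close>
    consider "m + a < j" | "i + a < j" "\<not> m + a < j" | "\<not> i + a < j" by linarith
    then show ?thesis
    proof cases
      case 1
      then show ?thesis using im m[of i] m[of m] adj[of "i + a" "m + a"] by (auto simp: c'_def)
    next
      case 2
      have "R (c' i) (c' m) = R (c (m + a - j)) (c (i + a))"
        using 2 im m[of i] m[of m] sym by (auto simp: c'_def)
      also have "\<dots> = (i + a = Suc (m + a - j) \<or> (m + a - j = 0 \<and> Suc (i + a) = j))"
        using 2 im a by (intro adj) auto
      finally show ?thesis using 2 im a by auto
    next
      case 3
      have "R (c' i) (c' m) = (m + a - j = Suc (i + a - j) \<or> (i + a - j = 0 \<and> Suc (m + a - j) = j))"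
        using 3 im m[of i] m[of m] a by (simp add: c'_def adj)
      then show ?thesis using 3 im a by auto
    qed
  qed
  then show "induced_cycle V R j c'"
    using img cV inj' unfolding induced_cycle_def by auto
qed

text \<open>Two things could go wrong. If \<open>x\<close> were already on the cycle, its adjacency
  to \<open>c 0\<close>, \<open>c 1\<close> and \<open>c (j - 1)\<close> would give a chord. If
  \<open>x\<close> had a further neighbour on the cycle, a shorter induced cycle would arise,
  against the minimality expressed by \<open>short\<close>.\<close>

lemma induced_cycle_replace:
  assumes refl: "\<And>x. x \<in> V \<Longrightarrow> R x x" and sym: "\<And>x y. R x y \<Longrightarrow> R y x"
    and c: "induced_cycle V R j c" and j: "4 \<le> j" and short: "no_short_cycle j V R"
    and x: "x \<in> V" "R x (c 0)" "R x (c 1)" "R x (c (j - 1))"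
    and l: "l < j" "\<not> R x (c l)"
  shows "induced_cycle V R j (c(0 := x))"
proof -
  have cV: "\<And>i. i < j \<Longrightarrow> c i \<in> V"
    and inj: "inj_on c {..<j}"
    and adj: "\<And>i m. i < m \<Longrightarrow> m < j \<Longrightarrow> R (c i) (c m) = (m = Suc i \<or> (i = 0 \<and> Suc m = j))"
    using c by (auto simp: induced_cycle_def)
  have xc: "c m \<noteq> x" if m: "0 < m" "m < j" for m
  proof
    assume "c m = x"
    have j1: "1 < j - 1" "j - 1 \<noteq> 2" "j - 1 < j" using j by linarith+
    have e: "\<not> R (c 1) (c (j - 1))" using adj[OF j1(1,3)] j1(2) by simp
    consider "m = 1" | "m = j - 1" | "1 < m" "m < j - 1"
      using m by linarith
    then show False
    proof cases
      case 1
      then show ?thesis using e x(4) \<open>c m = x\<close> by simp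
    next
      case 2
      then show ?thesis using e x(3) sym \<open>c m = x\<close> by blast
    next
      case 3
      then have "m < j" "Suc m \<noteq> j" "m \<noteq> 1" by linarith+
      then have "\<not> R (c 0) (c m)" using adj[of 0 m] m by simp
      then show ?thesis using x(2) \<open>c m = x\<close> sym by blast
    qed
  qed
  \<comment> \<open>A further neighbour of \<open>x\<close> on the cycle would cut off a shorter induced cycle around the gap at \<open>l\<close>.\<close>
  have far: "\<not> R x (c m)" if m: "1 < m" "m < j - 1" for m
  proof
    assume Rm: "R x (c m)"
    have l1: "1 < l" "l < j - 1"
    proof -
      have "l \<noteq> 0" "l \<noteq> 1" "l \<noteq> j - 1"
        using l x by (auto intro: ccontr)
      then show "1 < l" "l < j - 1" using l by linarith+
    qed
    define a where "a = Max {i. 1 \<le> i \<and> i < l \<and> R x (c i)}"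
    define b where "b = Min {i. l < i \<and> i \<le> j - 1 \<and> R x (c i)}"
    have "a \<in> {i. 1 \<le> i \<and> i < l \<and> R x (c i)}"
      unfolding a_def using l1 x by (intro Max_in) auto
    then have a: "1 \<le> a" "a < l" "R x (c a)" by auto
    have "b \<in> {i. l < i \<and> i \<le> j - 1 \<and> R x (c i)}"
      unfolding b_def using l1 x by (intro Min_in) auto
    then have b: "l < b" "b \<le> j - 1" "R x (c b)" by auto
    have gap: "\<not> R x (c i)" if i: "a < i" "i < b" for i
    proof
      assume Ri: "R x (c i)"
      then have "i \<noteq> l" using l by auto
      then consider "i < l" | "l < i" by linarith
      then show False
      proof cases
        case 1
        then have "i \<le> a" unfolding a_def using i a Ri by (intro Max_ge) auto
        then show ?thesis using i by simp
      next
        case 2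
        then have "b \<le> i" unfolding b_def using i b Ri by (intro Min_le) auto
        then show ?thesis using i by simp
      qed
    qed
    have "\<not> (a < m \<and> m < b)" using gap Rm by blast
    then have len: "b - a + 2 < j"
      using m a b j by linarith
    \<comment> \<open>The new cycle consists of \<open>x\<close> and the \<open>b - a + 1\<close>
      vertices of the arc from \<open>a\<close> to \<open>b\<close>. It has at least four vertices
      because \<open>a < l < b\<close>. It is shorter than the old one because \<open>m\<close> lies
      outside the gap, so \<open>a = 1\<close> and \<open>b = j - 1\<close> cannot both
      hold.\<close>
    define c' where "c' i = (if i = 0 then x else c (a + i - 1))" for i
    have "induced_cycle V R (b - a + 2) c'"
      unfolding induced_cycle_def
    proof (intro conjI allI impI)
      show "c' ` {..<b - a + 2} \<subseteq> V"
        using x(1) cV a b by (auto simp: c'_def)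
      have "inj_on (\<lambda>i. c (a + i - 1)) {0<..<b - a + 2}"
      proof (rule inj_onI)
        fix p q assume "p \<in> {0<..<b - a + 2}" "q \<in> {0<..<b - a + 2}" "c (a + p - 1) = c (a + q - 1)"
        then have "a + p - 1 = a + q - 1"
          using a b l1 by (intro inj_onD[OF inj]) auto
        then show "p = q" using a \<open>p \<in> _\<close> \<open>q \<in> _\<close> by auto
      qed
      moreover have "c (a + i - 1) \<noteq> x" if "i \<in> {0<..<b - a + 2}" for i
        using that a b l1 by (intro xc) auto
      ultimately show "inj_on c' {..<b - a + 2}"
        unfolding inj_on_def c'_def by (auto simp: Ball_def)
      fix i m assume im: "i < m \<and> m < b - a + 2"
      show "R (c' i) (c' m) = (m = Suc i \<or> i = 0 \<and> Suc m = b - a + 2)"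
      proof (cases "i = 0")
        case True
        then have "R (c' i) (c' m) = R x (c (a + m - 1))"
          using im by (simp add: c'_def)
        also have "\<dots> = (m = 1 \<or> m = b - a + 1)"
        proof (cases "m = 1 \<or> m = b - a + 1")
          case True
          then show ?thesis using a b l1 by auto
        next
          case False
          then have "a < a + m - 1" "a + m - 1 < b" using im a b \<open>i = 0\<close> by linarith+
          then show ?thesis using gap False by blast
        qed
        finally show ?thesis using True by auto
      next
        case False
        then have "R (c' i) (c' m) = R (c (a + i - 1)) (c (a + m - 1))"
          using im by (simp add: c'_def)
        also have "\<dots> = (a + m - 1 = Suc (a + i - 1) \<or> (a + i - 1 = 0 \<and> Suc (a + m - 1) = j))"
          using im a b False j by (intro adj) auto
        finally show ?thesis using False im a by auto
      qed
    qed
    moreover have "4 \<le> b - a + 2" using a b by simp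
    ultimately show False
      using short len by (auto simp: no_short_cycle_def)
  qed
  show ?thesis
    unfolding induced_cycle_def
  proof (intro conjI allI impI)
    show "(c(0 := x)) ` {..<j} \<subseteq> V"
      using cV x(1) by auto
    show "inj_on (c(0 := x)) {..<j}"
      using inj xc unfolding inj_on_def by (auto simp: Ball_def)
    fix i m assume im: "i < m \<and> m < j"
    show "R ((c(0 := x)) i) ((c(0 := x)) m) = (m = Suc i \<or> i = 0 \<and> Suc m = j)"
    proof (cases "i = 0")
      case True
      consider "m = 1" | "m = j - 1" | "1 < m" "m < j - 1"
        using im True by linarith
      then show ?thesis
        using True im x far j by cases auto
    next
      case False
      then show ?thesis using im adj by auto
    qed
  qed
qed

text \<open>
  A vertex of an induced cycle is pushed down to a vertex \<open>x\<close> of smaller height; if \<open>x\<close> is not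
  adjacent to the whole cycle, then a cycle of minimal length stays induced.
\<close>

lemma no_short_cycle_descent:
  fixes d :: "'v \<Rightarrow> nat"
  assumes refl: "\<And>x. x \<in> V \<Longrightarrow> R x x" and sym: "\<And>x y. R x y \<Longrightarrow> R y x"
    and step: "\<And>j c. 4 \<le> j \<Longrightarrow> j < k \<Longrightarrow> induced_cycle V R j c \<Longrightarrow>
      \<exists>a<j. \<exists>x\<in>V. d x < d (c a) \<and> (\<forall>m<j. R (c a) (c m) \<longrightarrow> R x (c m)) \<and> (\<exists>m<j. \<not> R x (c m))"
  shows "no_short_cycle k V R"
proof -
  have "\<not> induced_cycle V R j c" if "4 \<le> j" "j < k" for j c
    using that
  proof (induction j arbitrary: c rule: less_induct)
    case (less j)
    have short: "no_short_cycle j V R"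
      using less by (auto simp: no_short_cycle_def)
    \<comment> \<open>The inner induction is on the total height of the cycle. Summing over the
      vertex set makes this quantity visibly invariant under rotation; injectivity turns it into a
      sum over indices when one vertex is exchanged.\<close>
    show ?case
    proof (induction "\<Sum>v\<in>c ` {..<j}. d v" arbitrary: c rule: less_induct)
      case inner: less
      show ?case
      proof
        assume c: "induced_cycle V R j c"
        then obtain a x where ax: "a < j" "x \<in> V" "d x < d (c a)"
          "\<And>m. m < j \<Longrightarrow> R (c a) (c m) \<Longrightarrow> R x (c m)" "\<exists>m<j. \<not> R x (c m)"
          using step less.prems by blast
        define c' where "c' = (\<lambda>i. c ((i + a) mod j))"
        have c': "induced_cycle V R j c'" "c' ` {..<j} = c ` {..<j}" "c' 0 = c a"
          using induced_cycle_rotate[OF sym c ax(1)] by (auto simp: c'_def)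
        have near: "R x (c' m)" if "m < j" "R (c' 0) (c' m)" for m
        proof -
          have "c' m \<in> c ` {..<j}" using c'(2) that by auto
          then show ?thesis using ax(4) that c'(3) by auto
        qed
        have "c' 0 \<in> V" using c'(1) less.prems by (auto simp: induced_cycle_def)
        then have x: "R x (c' 0)" "R x (c' 1)" "R x (c' (j - 1))"
          using c'(1) less.prems refl by (auto intro!: near simp: induced_cycle_def)
        obtain l where l: "l < j" "\<not> R x (c' l)"
        proof -
          obtain m where "m < j" "\<not> R x (c m)" using ax(5) by blast
          moreover have "c m \<in> c' ` {..<j}" using c'(2) \<open>m < j\<close> by auto
          ultimately show ?thesis using that by auto
        qed
        have c'': "induced_cycle V R j (c'(0 := x))"
          by (rule induced_cycle_replace[OF refl sym c'(1) _ short ax(2) x l]) (use less.prems in auto)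
        have j0: "{..<j} = insert 0 {0<..<j}" using less.prems by auto
        have s: "(\<Sum>v\<in>f ` {..<j}. d v) = d (f 0) + (\<Sum>i\<in>{0<..<j}. d (f i))"
          if "induced_cycle V R j f" for f
        proof -
          have "(\<Sum>v\<in>f ` {..<j}. d v) = (\<Sum>i<j. d (f i))"
            using that by (subst sum.reindex) (auto simp: induced_cycle_def)
          then show ?thesis unfolding j0 by simp
        qed
        have "(\<Sum>v\<in>c'(0 := x) ` {..<j}. d v) < (\<Sum>v\<in>c' ` {..<j}. d v)"
        proof -
          have "(\<Sum>i\<in>{0<..<j}. d ((c'(0 := x)) i)) = (\<Sum>i\<in>{0<..<j}. d (c' i))"
            by (intro sum.cong) auto
          then show ?thesis
            unfolding s[OF c''] s[OF c'(1)] using ax(3) c'(3) by simp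
        qed
        then show False
          using inner[of "c'(0 := x)"] c'' c'(2) by simp
      qed
    qed
  qed
  then show ?thesis by (auto simp: no_short_cycle_def)
qed

text \<open>On a vertex of maximal height domination applies to both of its neighbours. That height
  is positive since the cycle has more than one vertex. A pushed vertex adjacent to the whole cycle
  would place the cycle in a closed neighbourhood, which \<open>loc\<close> excludes.\<close>

lemma no_short_cycle_dominated:
  fixes d :: "'v \<Rightarrow> nat" and \<rho> :: "'v \<Rightarrow> 'v"
  assumes refl: "\<And>x. x \<in> V \<Longrightarrow> R x x" and sym: "\<And>x y. R x y \<Longrightarrow> R y x"
    and \<rho>: "\<And>w. w \<in> V \<Longrightarrow> 0 < d w \<Longrightarrow> \<rho> w \<in> V \<and> d (\<rho> w) < d w"
    and dom: "\<And>w v. w \<in> V \<Longrightarrow> v \<in> V \<Longrightarrow> 0 < d w \<Longrightarrow> R w v \<Longrightarrow> d v \<le> d w \<Longrightarrow> R (\<rho> w) v"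
    and zero: "\<And>v w. v \<in> V \<Longrightarrow> w \<in> V \<Longrightarrow> d v = 0 \<Longrightarrow> d w = 0 \<Longrightarrow> v = w"
    and loc: "\<And>x. x \<in> V \<Longrightarrow> no_short_cycle k {v \<in> V. R x v} R"
  shows "no_short_cycle k V R"
proof (rule no_short_cycle_descent[where d = d])
  fix j c assume j: "4 \<le> j" "j < k" and c: "induced_cycle V R j c"
  have cV: "\<And>i. i < j \<Longrightarrow> c i \<in> V" and inj: "inj_on c {..<j}"
    using c by (auto simp: induced_cycle_def)
  define M where "M = Max (d ` c ` {..<j})"
  have "M \<in> d ` c ` {..<j}"
    unfolding M_def using j by (intro Max_in) (auto simp: lessThan_empty_iff)
  then obtain a where a: "a < j" "d (c a) = M" by auto
  have le: "d (c m) \<le> M" if "m < j" for m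
    unfolding M_def using that by (intro Max_ge) auto
  have pos: "0 < d (c a)"
  proof (rule ccontr)
    assume "\<not> 0 < d (c a)"
    then have "d (c 0) = 0" "d (c 1) = 0" using le[of 0] le[of 1] a j by auto
    then have "c 0 = c 1" using zero cV[of 0] cV[of 1] j by auto
    then show False using inj_onD[OF inj, of 0 1] j by auto
  qed
  define x where "x = \<rho> (c a)"
  have x: "x \<in> V" "d x < d (c a)"
    using \<rho>[OF cV[OF a(1)] pos] by (auto simp: x_def)
  have "\<forall>m<j. R (c a) (c m) \<longrightarrow> R x (c m)"
    using dom[OF cV[OF a(1)] cV pos] le a by (auto simp: x_def)
  moreover have "\<exists>m<j. \<not> R x (c m)"
  proof (rule ccontr)
    assume "\<not> (\<exists>m<j. \<not> R x (c m))"
    then have "induced_cycle {v \<in> V. R x v} R j c"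
      using c by (auto simp: induced_cycle_def)
    then show False using loc[OF x(1)] j by (auto simp: no_short_cycle_def)
  qed
  ultimately show "\<exists>a<j. \<exists>x\<in>V. d x < d (c a) \<and> (\<forall>m<j. R (c a) (c m) \<longrightarrow> R x (c m)) \<and> (\<exists>m<j. \<not> R x (c m))"
    using a(1) x by blast
qed (use refl sym in auto)

text \<open>This is the closed neighbourhood of a vertex of the thickening, the empty simplex being
  the vertex itself. The descent replaces a simplex of the cycle by one of its vertices: passing to
  a subset preserves adjacency, and a cycle made of singletons is a cycle of
  \<open>X\<close>.\<close>

lemma no_short_cycle_simplices:
  assumes X: "flag X" and short: "no_short_cycle k (\<Union>X) (\<lambda>u v. {u, v} \<in> X)"
  shows "no_short_cycle k (insert {} X) (\<lambda>T U. T \<union> U \<in> insert {} X)"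
proof (rule no_short_cycle_descent[where d = card])
  let ?V = "insert {} X" and ?R = "\<lambda>T U. T \<union> U \<in> insert {} X"
  have sub: "\<sigma> \<in> X \<Longrightarrow> \<tau> \<subseteq> \<sigma> \<Longrightarrow> \<tau> \<in> ?V" for \<sigma> \<tau>
    using flag_face[OF X] by auto
  note fin = flag_finite[OF X]
  fix j c assume j: "4 \<le> j" "j < k" and c: "induced_cycle ?V ?R j c"
  have cV: "\<And>i. i < j \<Longrightarrow> c i \<in> ?V"
    and inj: "inj_on c {..<j}"
    and adj: "\<And>i m. i < m \<Longrightarrow> m < j \<Longrightarrow> ?R (c i) (c m) = (m = Suc i \<or> (i = 0 \<and> Suc m = j))"
    using c by (auto simp: induced_cycle_def)
  \<comment> \<open>The witness is at distance two along the cycle, \<open>a + 2\<close> or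
    \<open>a - 2\<close>; it is not a neighbour since \<open>j \<ge> 4\<close>.\<close>
  have far: "\<exists>m<j. \<not> ?R (c a) (c m)" if "a < j" for a
  proof -
    consider "a + 2 < j" | "2 \<le> a" "a + 2 < j + 2" "\<not> a + 2 < j" using \<open>a < j\<close> j by linarith
    then show ?thesis
    proof cases
      case 1
      then have "a = 0 \<longrightarrow> Suc (a + 2) \<noteq> j" using j by auto
      then show ?thesis using adj[of a "a + 2"] 1 by auto
    next
      case 2
      then have "\<not> ?R (c (a - 2)) (c a)" using adj[of "a - 2" a] that j by auto
      then show ?thesis using 2 by (intro exI[of _ "a - 2"]) (auto simp: Un_commute)
    qed
  qed
  \<comment> \<open>The empty simplex is adjacent to every simplex, so it cannot lie on the
    cycle.\<close>
  have cX: "c i \<in> X" if "i < j" for i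
  proof -
    obtain m where "m < j" "\<not> ?R (c i) (c m)" using far[OF \<open>i < j\<close>] by blast
    then show ?thesis using cV[of i] cV[of m] that by auto
  qed
  have "\<exists>a<j. 1 < card (c a)"
  proof (rule ccontr)
    assume "\<not> (\<exists>a<j. 1 < card (c a))"
    then have "\<exists>v. c i = {v}" if "i < j" for i
    proof -
      have "c i \<noteq> {}" "finite (c i)"
        using cX[OF that] fin flag_nonempty[OF X] by auto
      moreover have "\<not> 1 < card (c i)" using \<open>\<not> (\<exists>a<j. _)\<close> that by blast
      ultimately have "card (c i) \<noteq> 0" "card (c i) \<le> 1" by auto
      then have "card (c i) = 1" by linarith
      then show ?thesis by (simp add: card_1_singleton_iff)
    qed
    then obtain f where f: "\<And>i. i < j \<Longrightarrow> c i = {f i}" by metis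
    have "induced_cycle (\<Union>X) (\<lambda>u v. {u, v} \<in> X) j f"
      unfolding induced_cycle_def
    proof (intro conjI allI impI)
      show "f ` {..<j} \<subseteq> \<Union>X" using cX f by force
      show "inj_on f {..<j}" using inj f by (auto simp: inj_on_def)
      fix i m assume "i < m \<and> m < j"
      then show "({f i, f m} \<in> X) = (m = Suc i \<or> i = 0 \<and> Suc m = j)"
        using adj[of i m] f[of i] f[of m] by (auto simp: insert_commute)
    qed
    then show False using short j by (auto simp: no_short_cycle_def)
  qed
  then obtain a where a: "a < j" "1 < card (c a)" by blast
  obtain m where m: "m < j" "\<not> ?R (c a) (c m)" using far[OF a(1)] by blast
  \<comment> \<open>Flagness: if every vertex of \<open>c a\<close> spanned a simplex with
    \<open>c m\<close>, then \<open>c a \<union> c m\<close> would be a clique and hence a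
    simplex.\<close>
  have "\<exists>s\<in>c a. \<not> ?R {s} (c m)"
  proof (rule ccontr)
    assume "\<not> (\<exists>s\<in>c a. \<not> ?R {s} (c m))"
    then have all: "insert s (c m) \<in> X" if "s \<in> c a" for s using that by auto
    have "{u, v} \<in> X" if "u \<in> c a \<union> c m" "v \<in> c a \<union> c m" for u v
    proof -
      have "{u, v} \<subseteq> c a \<or> {u, v} \<subseteq> c m \<or> (\<exists>s\<in>c a. {u, v} \<subseteq> insert s (c m))"
        using that by auto
      then show ?thesis using flag_face[OF X _ _ insert_not_empty] all cX[OF a(1)] cX[OF m(1)] by metis
    qed
    moreover have "finite (c a \<union> c m)" "c a \<union> c m \<subseteq> \<Union>X" "c a \<union> c m \<noteq> {}"
      by (intro finite_UnI fin cX a(1) m(1))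
        (intro Un_least Union_upper cX a(1) m(1), use flag_nonempty[OF X cX[OF m(1)]] in blast)
    ultimately have "c a \<union> c m \<in> X"
      by - (rule flag_cliqueI[OF X])
    then show False using m by simp
  qed
  then obtain s where s: "s \<in> c a" "\<not> ?R {s} (c m)" by blast
  have "{s} \<in> ?V" using sub[OF cX[OF a(1)], of "{s}"] s by simp
  moreover have "\<forall>i<j. ?R (c a) (c i) \<longrightarrow> ?R {s} (c i)"
    using sub[of "c a \<union> c _" "{s} \<union> c _"] s(1) by auto
  moreover have "card {s} < card (c a)" using a(2) by simp
  moreover have "\<exists>m<j. \<not> ?R {s} (c m)" using m(1) s(2) by blast
  ultimately show "\<exists>a<j. \<exists>x\<in>?V. card x < card (c a) \<and> (\<forall>m<j. ?R (c a) (c m) \<longrightarrow> ?R x (c m)) \<and>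
      (\<exists>m<j. \<not> ?R x (c m))"
    using a(1) by blast
qed (auto simp: Un_commute)

text \<open>In a flag complex the link of a simplex is the full subcomplex on its vertices, so an
  induced cycle of the link is induced in \<open>X\<close>. This turns largeness of the thickening
  into the local condition required of a systolic complex.\<close>

lemma k_large_link:
  assumes "k_large k X" "\<sigma> \<in> X"
  shows "k_large k (link X \<sigma>)"
proof -
  have X: "flag X" and short: "no_short_cycle k (\<Union>X) (\<lambda>u v. {u, v} \<in> X)"
    using assms k_large_flag by (auto simp: k_large_def)
  note sub = flag_face[OF X] and fin = flag_finite[OF X] and ne = flag_nonempty[OF X]
  have link_iff: "\<tau> \<in> link X \<sigma> \<longleftrightarrow> \<tau> \<in> X \<and> (\<forall>v\<in>\<tau>. {v} \<in> link X \<sigma>)" for \<tau>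
  proof
    assume \<tau>: "\<tau> \<in> link X \<sigma>"
    have "{v} \<in> link X \<sigma>" if "v \<in> \<tau>" for v
      using \<tau> that sub[of "\<tau> \<union> \<sigma>" "{v} \<union> \<sigma>"] sub[of \<tau> "{v}"] unfolding link_def by auto
    then show "\<tau> \<in> X \<and> (\<forall>v\<in>\<tau>. {v} \<in> link X \<sigma>)" using \<tau> by (auto simp: link_def)
  next
    assume \<tau>: "\<tau> \<in> X \<and> (\<forall>v\<in>\<tau>. {v} \<in> link X \<sigma>)"
    have "{u, v} \<in> X" if uv: "u \<in> \<tau> \<union> \<sigma>" "v \<in> \<tau> \<union> \<sigma>" for u v
    proof -
      have "{u, v} \<subseteq> \<tau> \<or> {u, v} \<subseteq> \<sigma> \<or> (\<exists>s\<in>\<tau>. {u, v} \<subseteq> {s} \<union> \<sigma>)" using uv by auto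
      moreover have "{s} \<union> \<sigma> \<in> X" if "s \<in> \<tau>" for s using \<tau> that by (auto simp: link_def)
      ultimately show ?thesis
        using sub[OF _ _ insert_not_empty] \<tau> assms(2) by metis
    qed
    moreover have "finite (\<tau> \<union> \<sigma>)" "\<tau> \<union> \<sigma> \<noteq> {}" "\<tau> \<union> \<sigma> \<subseteq> \<Union>X"
      by (intro finite_UnI fin conjunct1[OF \<tau>] assms(2))
        (use ne[OF assms(2)] in blast, intro Un_least Union_upper conjunct1[OF \<tau>] assms(2))
    ultimately have "\<tau> \<union> \<sigma> \<in> X"
      by - (rule flag_cliqueI[OF X])
    then show "\<tau> \<in> link X \<sigma>" using \<tau> by (auto simp: link_def)
  qed
  have vert: "v \<in> \<Union>(link X \<sigma>) \<longleftrightarrow> {v} \<in> link X \<sigma>" for v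
    using link_iff by blast
  have "abs_complex (link X \<sigma>)"
    unfolding abs_complex_def
  proof (intro conjI ballI allI impI)
    fix \<tau> \<upsilon> assume \<tau>: "\<tau> \<in> link X \<sigma>" and \<upsilon>: "\<upsilon> \<noteq> {} \<and> \<upsilon> \<subseteq> \<tau>"
    have "\<tau> \<in> X" "\<forall>v\<in>\<tau>. {v} \<in> link X \<sigma>" using \<tau> link_iff[of \<tau>] by auto
    then show "\<upsilon> \<in> link X \<sigma>" using \<upsilon> link_iff[of \<upsilon>] sub[of \<tau> \<upsilon>] by auto
  next
    fix \<tau> assume "\<tau> \<in> link X \<sigma>"
    then show "finite \<tau>" "\<tau> \<noteq> {}" using fin ne by (auto simp: link_def)
  qed
  moreover have "\<tau> \<in> link X \<sigma>"
    if "finite \<tau> \<and> \<tau> \<noteq> {} \<and> \<tau> \<subseteq> \<Union>(link X \<sigma>) \<and> (\<forall>u\<in>\<tau>. \<forall>v\<in>\<tau>. u \<noteq> v \<longrightarrow> {u, v} \<in> link X \<sigma>)" for \<tau>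
  proof -
    have \<tau>: "finite \<tau>" "\<tau> \<noteq> {}" "\<tau> \<subseteq> \<Union>(link X \<sigma>)"
      and e: "\<And>u v. u \<in> \<tau> \<Longrightarrow> v \<in> \<tau> \<Longrightarrow> u \<noteq> v \<Longrightarrow> {u, v} \<in> link X \<sigma>"
      using that by simp_all
    have "\<forall>v\<in>\<tau>. {v} \<in> link X \<sigma>"
      using subsetD[OF \<tau>(3)] vert by (intro ballI) (rule iffD1[OF vert])
    moreover have "\<tau> \<in> X"
    proof -
      have l: "link X \<sigma> \<subseteq> X" by (auto simp: link_def)
      show ?thesis
        by (rule flag_cliqueI[OF X \<tau>(1,2) subset_trans[OF \<tau>(3) Union_mono[OF l]]])
          (rule subsetD[OF l e])
    qed
    ultimately show ?thesis using link_iff[of \<tau>] by simp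
  qed
  ultimately have flag: "flag (link X \<sigma>)"
    unfolding flag_def by (intro conjI allI impI)
  have "no_short_cycle k (\<Union>(link X \<sigma>)) (\<lambda>u v. {u, v} \<in> link X \<sigma>)"
  proof (rule no_short_cycle_map[OF short, of id])
    show "id ` \<Union>(link X \<sigma>) \<subseteq> \<Union>X" by (auto simp: link_def)
    fix u v assume "u \<in> \<Union>(link X \<sigma>)" "v \<in> \<Union>(link X \<sigma>)"
    then show "({id u, id v} \<in> X) = ({u, v} \<in> link X \<sigma>)"
      using vert link_iff[of "{u, v}"] by auto
  qed auto
  then show ?thesis using k_large_flag[OF flag] by simp
qed

section \<open>Invariance under isomorphism\<close>

lemma complex_iso_abs_complex:
  assumes f: "bij_betw f (\<Union>A) (\<Union>B)" "(\<lambda>\<sigma>. f ` \<sigma>) ` A = B" and A: "abs_complex A"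
  shows "abs_complex B"
  unfolding abs_complex_def
proof (intro conjI ballI allI impI)
  fix \<sigma> assume "\<sigma> \<in> B"
  then show "finite \<sigma>" "\<sigma> \<noteq> {}" using A f(2) unfolding abs_complex_def by auto
next
  fix \<sigma> \<tau> assume \<sigma>: "\<sigma> \<in> B" and \<tau>: "\<tau> \<noteq> {} \<and> \<tau> \<subseteq> \<sigma>"
  obtain \<sigma>' where \<sigma>': "\<sigma>' \<in> A" "\<sigma> = f ` \<sigma>'" using \<sigma> f(2) by auto
  obtain \<tau>' where \<tau>': "\<tau>' \<subseteq> \<sigma>'" "\<tau> = f ` \<tau>'" using \<tau> \<sigma>' by (auto simp: subset_image_iff)
  then have "\<tau>' \<in> A" using abs_complex_face[OF A \<sigma>'(1), of \<tau>'] \<tau> by blast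
  then show "\<tau> \<in> B" using f(2) \<tau>' by auto
qed

lemma complex_iso_image_iff:
  assumes f: "bij_betw f (\<Union>A) (\<Union>B)" "(\<lambda>\<sigma>. f ` \<sigma>) ` A = B" and \<sigma>: "\<sigma> \<subseteq> \<Union>A"
  shows "f ` \<sigma> \<in> B \<longleftrightarrow> \<sigma> \<in> A"
proof
  assume "f ` \<sigma> \<in> B"
  then obtain \<tau> where "\<tau> \<in> A" "f ` \<sigma> = f ` \<tau>" using f(2) by auto
  then have "\<sigma> = \<tau>"
    using f(1) \<sigma> inj_on_image_eq_iff[of f "\<Union>A" \<sigma> \<tau>] by (auto simp: bij_betw_def)
  then show "\<sigma> \<in> A" using \<open>\<tau> \<in> A\<close> by simp
qed (use f(2) in auto)

lemma k_large_complex_iso: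
  assumes iso: "complex_iso A B" and A: "k_large k A"
  shows "k_large k B"
proof -
  obtain f where f: "bij_betw f (\<Union>A) (\<Union>B)" "(\<lambda>\<sigma>. f ` \<sigma>) ` A = B"
    using iso by (auto simp: complex_iso_def)
  note iff = complex_iso_image_iff[OF f]
  have flagA: "flag A" and short: "no_short_cycle k (\<Union>A) (\<lambda>u v. {u, v} \<in> A)"
    using A k_large_flag by (auto simp: k_large_def)
  have flagB: "flag B"
    unfolding flag_def
  proof (intro conjI allI impI)
    show "abs_complex B"
      using complex_iso_abs_complex[OF f] flagA by (simp add: flag_def)
    fix \<sigma> assume \<sigma>: "finite \<sigma> \<and> \<sigma> \<noteq> {} \<and> \<sigma> \<subseteq> \<Union>B \<and> (\<forall>u\<in>\<sigma>. \<forall>v\<in>\<sigma>. u \<noteq> v \<longrightarrow> {u, v} \<in> B)"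
    then have "\<sigma> \<subseteq> f ` \<Union>A" using f(1) by (simp add: bij_betw_def)
    then obtain \<tau> where \<tau>: "\<tau> \<subseteq> \<Union>A" "\<sigma> = f ` \<tau>"
      unfolding subset_image_iff by blast
    have inj: "inj_on f \<tau>" using f(1) \<tau> by (auto simp: bij_betw_def intro: inj_on_subset)
    have "finite \<tau>" using \<sigma> \<tau> inj by (auto simp: finite_image_iff)
    moreover have "{u, v} \<in> A" if "u \<in> \<tau>" "v \<in> \<tau>" "u \<noteq> v" for u v
    proof -
      have "f u \<noteq> f v" using inj that by (auto simp: inj_on_def)
      then have "f ` {u, v} \<in> B" using \<sigma> \<tau> that by auto
      then show ?thesis using iff[of "{u, v}"] that \<tau> by auto
    qed
    ultimately have "\<tau> \<in> A" using \<sigma> \<tau> by - (rule flag_cliqueI[OF flagA], auto)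
    then show "\<sigma> \<in> B" using f(2) \<tau> by auto
  qed
  let ?g = "inv_into (\<Union>A) f"
  have "no_short_cycle k (\<Union>B) (\<lambda>u v. {u, v} \<in> B)"
  proof (rule no_short_cycle_map[OF short, of ?g])
    show "inj_on ?g (\<Union>B)" "?g ` \<Union>B \<subseteq> \<Union>A"
      using bij_betw_inv_into[OF f(1)] by (auto simp: bij_betw_def)
    fix u v assume uv: "u \<in> \<Union>B" "v \<in> \<Union>B"
    then have "f (?g u) = u" "f (?g v) = v" "?g u \<in> \<Union>A" "?g v \<in> \<Union>A"
      using f(1) by (auto simp: bij_betw_def f_inv_into_f inv_into_into simp del: Union_iff)
    then show "({?g u, ?g v} \<in> A) = ({u, v} \<in> B)"
      using iff[of "{?g u, ?g v}"] by auto
  qed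
  then show ?thesis using k_large_flag[OF flagB] by simp
qed

section \<open>The word problem in right-angled Coxeter groups\<close>

lemma Union_pair_memD: "{s, t} \<in> X \<Longrightarrow> s \<in> \<Union>X \<and> t \<in> \<Union>X"
  by blast

lemma rev_in_lists_iff [simp]: "rev u \<in> lists A \<longleftrightarrow> u \<in> lists A"
  by (simp add: in_lists_conv_set)

lemma racg_relator_lists: "r \<in> racg_relators X \<Longrightarrow> r \<in> lists (\<Union>X)"
  unfolding racg_relators_def using Union_pair_memD[of _ _ X] by auto

lemma racg_step_lists:
  assumes "(u, v) \<in> racg_step X"
  shows "u \<in> lists (\<Union>X)" "v \<in> lists (\<Union>X)"
  using assms racg_relator_lists unfolding racg_step_def by fastforce+

lemma racg_step_context:
  assumes "(u, v) \<in> racg_step X" "a \<in> lists (\<Union>X)" "b \<in> lists (\<Union>X)"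
  shows "(a @ u @ b, a @ v @ b) \<in> racg_step X"
proof -
  obtain p r q where 1: "u = p @ r @ q" "v = p @ q" "p \<in> lists (\<Union>X)" "q \<in> lists (\<Union>X)" "r \<in> racg_relators X"
    using assms(1) unfolding racg_step_def by blast
  have "a @ u @ b = (a @ p) @ r @ (q @ b)" "a @ v @ b = (a @ p) @ (q @ b)" "a @ p \<in> lists (\<Union>X)" "q @ b \<in> lists (\<Union>X)"
    using 1 assms(2,3) by simp_all
  then show ?thesis
    unfolding racg_step_def using 1(5) by blast
qed

lemma racg_eq_refl [simp]: "(u, u) \<in> racg_eq X"
  by (simp add: racg_eq_def)

lemma racg_eq_sym: "(u, v) \<in> racg_eq X \<Longrightarrow> (v, u) \<in> racg_eq X"
proof -
  have "sym (racg_eq X)"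
    unfolding racg_eq_def by (intro sym_rtrancl sym_Un_converse)
  then show "(u, v) \<in> racg_eq X \<Longrightarrow> (v, u) \<in> racg_eq X"
    by (rule symD)
qed

lemma racg_eq_trans [trans]: "(u, v) \<in> racg_eq X \<Longrightarrow> (v, w) \<in> racg_eq X \<Longrightarrow> (u, w) \<in> racg_eq X"
  unfolding racg_eq_def by (rule rtrancl_trans)

lemma racg_eq_lists:
  assumes "(u, v) \<in> racg_eq X" "u \<in> lists (\<Union>X)"
  shows "v \<in> lists (\<Union>X)"
  using assms unfolding racg_eq_def
  by (induction rule: rtrancl_induct) (auto dest: racg_step_lists)

lemma racg_eq_context:
  assumes "(u, v) \<in> racg_eq X" "a \<in> lists (\<Union>X)" "b \<in> lists (\<Union>X)"
  shows "(a @ u @ b, a @ v @ b) \<in> racg_eq X"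
  using assms(1) unfolding racg_eq_def
proof (induction rule: rtrancl_induct)
  case (step v w)
  have "(a @ v @ b, a @ w @ b) \<in> racg_step X \<union> (racg_step X)\<inverse>"
    using step.hyps(2) racg_step_context[OF _ assms(2,3)] by blast
  with step.IH show ?case by (rule rtrancl_into_rtrancl)
qed simp

lemma racg_eq_append:
  assumes "(u, u') \<in> racg_eq X" "(v, v') \<in> racg_eq X" "u \<in> lists (\<Union>X)" "v \<in> lists (\<Union>X)"
  shows "(u @ v, u' @ v') \<in> racg_eq X"
proof -
  have "u' \<in> lists (\<Union>X)" using racg_eq_lists assms by blast
  have "(u @ v, u' @ v) \<in> racg_eq X"
    using racg_eq_context[OF assms(1), of "[]" v] assms(4) by simp
  also have "(u' @ v, u' @ v') \<in> racg_eq X"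
    using racg_eq_context[OF assms(2), of u' "[]"] \<open>u' \<in> _\<close> by simp
  finally show ?thesis .
qed

text \<open>The source of every lower bound on the group: it is applied to parities of letters, to
  heaps, and to an action on the integers.\<close>

lemma racg_eq_invariant:
  assumes eq: "(u, v) \<in> racg_eq X"
    and F: "\<And>p r q. p \<in> lists (\<Union>X) \<Longrightarrow> q \<in> lists (\<Union>X) \<Longrightarrow> r \<in> racg_relators X \<Longrightarrow> F (p @ r @ q) = F (p @ q)"
  shows "F u = F v"
proof -
  have "F u = F v" if "(u, v) \<in> racg_step X" for u v
    using that F unfolding racg_step_def by blast
  then have step: "F u = F v" if "(u, v) \<in> racg_step X \<union> (racg_step X)\<inverse>" for u v
    using that by (elim UnE) auto
  show ?thesis
    using eq unfolding racg_eq_def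
    by (induction rule: rtrancl_induct) (use step in auto)
qed

lemma racg_eq_relator: "r \<in> racg_relators X \<Longrightarrow> p \<in> lists (\<Union>X) \<Longrightarrow> q \<in> lists (\<Union>X) \<Longrightarrow> (p @ r @ q, p @ q) \<in> racg_eq X"
  unfolding racg_eq_def racg_step_def by (rule r_into_rtrancl) blast

lemma racg_eq_square: "s \<in> \<Union>X \<Longrightarrow> ([s, s], []) \<in> racg_eq X"
  using racg_eq_relator[of "[s, s]" X "[]" "[]"] by (simp add: racg_relators_def)

lemma racg_eq_commute:
  assumes "s \<noteq> t" "{s, t} \<in> X"
  shows "([s, t], [t, s]) \<in> racg_eq X"
proof -
  have S: "s \<in> \<Union>X" "t \<in> \<Union>X" using Union_pair_memD[OF assms(2)] by auto
  have "{t, s} \<in> X" using assms(2) by (simp only: insert_commute)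
  then have "[t, s, t, s] \<in> racg_relators X"
    using assms(1) unfolding racg_relators_def by blast
  \<comment> \<open>Insert the relator \<open>tsts\<close> behind \<open>st\<close>, then cancel
    \<open>tt\<close> and \<open>ss\<close> in \<open>sttsts\<close>.\<close>
  from racg_eq_relator[OF this, of "[s, t]" "[]"] S
  have "([s, t], [s, t, t, s, t, s]) \<in> racg_eq X"
    by - (rule racg_eq_sym, simp del: Union_iff)
  also have "([s, t, t, s, t, s], [s, s, t, s]) \<in> racg_eq X"
    using racg_eq_context[OF racg_eq_square[OF S(2)], of "[s]" "[s, t, s]"] S by (simp del: Union_iff)
  also have "([s, s, t, s], [t, s]) \<in> racg_eq X"
    using racg_eq_context[OF racg_eq_square[OF S(1)], of "[]" "[t, s]"] S by (simp del: Union_iff)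
  finally show ?thesis .
qed

lemma racg_eq_rev_append: "u \<in> lists (\<Union>X) \<Longrightarrow> (rev u @ u, []) \<in> racg_eq X"
proof (induction u)
  case (Cons s u)
  then have S: "s \<in> \<Union>X" "u \<in> lists (\<Union>X)" "rev u \<in> lists (\<Union>X)" by (simp_all del: Union_iff)
  have "(rev u @ [s, s] @ u, rev u @ [] @ u) \<in> racg_eq X"
    by (rule racg_eq_context[OF racg_eq_square[OF S(1)] S(3,2)])
  also have "(rev u @ [] @ u, []) \<in> racg_eq X" using Cons.IH S by simp
  finally show ?case by simp
qed simp

section \<open>The group of classes of words\<close>

definition racg_class :: "'v set set \<Rightarrow> 'v list \<Rightarrow> 'v list set" where
  "racg_class X u = racg_eq X `` {u}"

lemma racg_class_eq_iff: "racg_class X u = racg_class X v \<longleftrightarrow> (u, v) \<in> racg_eq X"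
proof
  assume "racg_class X u = racg_class X v"
  moreover have "v \<in> racg_class X v" by (simp add: racg_class_def)
  ultimately have "v \<in> racg_class X u" by simp
  then show "(u, v) \<in> racg_eq X" by (simp add: racg_class_def)
next
  assume "(u, v) \<in> racg_eq X"
  then show "racg_class X u = racg_class X v"
    unfolding racg_class_def using racg_eq_sym racg_eq_trans by fast
qed

lemma carrier_racg: "carrier (racg X) = racg_class X ` lists (\<Union>X)"
  unfolding racg_def racg_class_def by (auto simp: quotient_def simp del: Union_iff)

lemma racg_class_in_carrier [simp]: "u \<in> lists (\<Union>X) \<Longrightarrow> racg_class X u \<in> carrier (racg X)"
  unfolding carrier_racg by (rule imageI)

lemma racg_carrierE:
  assumes "x \<in> carrier (racg X)"
  obtains u where "u \<in> lists (\<Union>X)" "x = racg_class X u"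
  using assms unfolding carrier_racg by blast

lemma one_racg: "\<one>\<^bsub>racg X\<^esub> = racg_class X []"
  by (simp add: racg_def racg_class_def)

lemma mult_racg_class:
  assumes "u \<in> lists (\<Union>X)" "v \<in> lists (\<Union>X)"
  shows "racg_class X u \<otimes>\<^bsub>racg X\<^esub> racg_class X v = racg_class X (u @ v)"
proof -
  have "racg_class X u \<otimes>\<^bsub>racg X\<^esub> racg_class X v =
      racg_eq X `` {a @ b | a b. (u, a) \<in> racg_eq X \<and> (v, b) \<in> racg_eq X}"
    by (simp add: racg_def racg_class_def)
  also have "\<dots> = racg_eq X `` {u @ v}"
  proof (intro subset_antisym subsetI)
    fix w assume "w \<in> racg_eq X `` {a @ b | a b. (u, a) \<in> racg_eq X \<and> (v, b) \<in> racg_eq X}"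
    then obtain a b where "(u, a) \<in> racg_eq X" "(v, b) \<in> racg_eq X" "(a @ b, w) \<in> racg_eq X"
      by blast
    then show "w \<in> racg_eq X `` {u @ v}"
      using racg_eq_trans[OF racg_eq_append[OF _ _ assms]] by blast
  next
    fix w assume "w \<in> racg_eq X `` {u @ v}"
    then have "(u @ v, w) \<in> racg_eq X" by simp
    moreover have "u @ v \<in> {a @ b | a b. (u, a) \<in> racg_eq X \<and> (v, b) \<in> racg_eq X}"
      by (rule CollectI, rule exI[of _ u], rule exI[of _ v], simp)
    ultimately show "w \<in> racg_eq X `` {a @ b | a b. (u, a) \<in> racg_eq X \<and> (v, b) \<in> racg_eq X}"
      by (rule ImageI)
  qed
  finally show ?thesis by (simp add: racg_class_def)
qed

lemma group_racg: "group (racg X)"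
proof (rule groupI)
  fix x y assume "x \<in> carrier (racg X)" "y \<in> carrier (racg X)"
  then show "x \<otimes>\<^bsub>racg X\<^esub> y \<in> carrier (racg X)"
    by (elim racg_carrierE) (simp add: mult_racg_class)
next
  show "\<one>\<^bsub>racg X\<^esub> \<in> carrier (racg X)" by (simp add: one_racg)
next
  fix x y z assume "x \<in> carrier (racg X)" "y \<in> carrier (racg X)" "z \<in> carrier (racg X)"
  then show "x \<otimes>\<^bsub>racg X\<^esub> y \<otimes>\<^bsub>racg X\<^esub> z = x \<otimes>\<^bsub>racg X\<^esub> (y \<otimes>\<^bsub>racg X\<^esub> z)"
    by (elim racg_carrierE) (simp add: mult_racg_class)
next
  fix x assume "x \<in> carrier (racg X)"
  then show "\<one>\<^bsub>racg X\<^esub> \<otimes>\<^bsub>racg X\<^esub> x = x"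
    by (elim racg_carrierE) (simp add: mult_racg_class one_racg)
next
  fix x assume "x \<in> carrier (racg X)"
  then obtain u where u: "u \<in> lists (\<Union>X)" "x = racg_class X u" by (rule racg_carrierE)
  then have "racg_class X (rev u) \<otimes>\<^bsub>racg X\<^esub> x = \<one>\<^bsub>racg X\<^esub>"
    using racg_eq_rev_append[OF u(1)] by (simp add: mult_racg_class one_racg racg_class_eq_iff)
  then show "\<exists>y\<in>carrier (racg X). y \<otimes>\<^bsub>racg X\<^esub> x = \<one>\<^bsub>racg X\<^esub>"
    using u by (intro bexI[of _ "racg_class X (rev u)"]) simp_all
qed

lemma racg_gen_eq_class: "racg_gen X s = racg_class X [s]"
  by (simp add: racg_gen_def racg_class_def)

section \<open>Abelianization and words in commuting letters\<close>

definition odd_letters :: "'v list \<Rightarrow> 'v set" where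
  "odd_letters u = {s. odd (count_list u s)}"

text \<open>The abelianization is a vector space over the field with two elements, with the
  generators as basis; its elements are written here as sets of generators.\<close>

lemma odd_letters_append: "odd_letters (u @ v) = sym_diff (odd_letters u) (odd_letters v)"
  by (auto simp: odd_letters_def)

lemma odd_letters_subset: "odd_letters u \<subseteq> set u"
proof
  fix s assume "s \<in> odd_letters u"
  then have "count_list u s \<noteq> 0" unfolding odd_letters_def by (auto intro: ccontr)
  then show "s \<in> set u" by (simp add: count_list_0_iff)
qed

lemma odd_letters_distinct: "distinct u \<Longrightarrow> odd_letters u = set u"
  by (induction u) (auto simp: odd_letters_def)

lemma odd_letters_rev: "odd_letters (rev u) = odd_letters u"
  by (simp add: odd_letters_def)

lemma odd_letters_racg_eq:
  assumes "(u, v) \<in> racg_eq X"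
  shows "odd_letters u = odd_letters v"
proof (rule racg_eq_invariant[OF assms])
  fix p r q assume "r \<in> racg_relators X"
  then have "odd_letters r = {}"
    by (auto simp: racg_relators_def odd_letters_def)
  then show "odd_letters (p @ r @ q) = odd_letters (p @ q)"
    by (simp add: odd_letters_append)
qed

definition clique_word :: "'v set set \<Rightarrow> 'v list \<Rightarrow> bool" where
  "clique_word X u \<longleftrightarrow> u \<in> lists (\<Union>X) \<and> (\<forall>s\<in>set u. \<forall>t\<in>set u. s \<noteq> t \<longrightarrow> {s, t} \<in> X)"

lemma clique_word_lists: "clique_word X u \<Longrightarrow> u \<in> lists (\<Union>X)"
  by (simp add: clique_word_def)

lemma clique_word_subset: "clique_word X u \<Longrightarrow> set v \<subseteq> set u \<Longrightarrow> clique_word X v"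
  unfolding clique_word_def by (simp add: lists_eq_set subset_iff)

lemma clique_word_Cons_commute:
  "clique_word X (s # u) \<Longrightarrow> (s # u, u @ [s]) \<in> racg_eq X"
proof (induction u)
  case (Cons t u)
  note S = clique_word_lists[OF Cons.prems]
  have cw: "clique_word X (s # u)" by (rule clique_word_subset[OF Cons.prems]) auto
  have 1: "(t # s # u, t # u @ [s]) \<in> racg_eq X"
    using racg_eq_context[OF Cons.IH[OF cw], of "[t]" "[]"] S by (simp del: Union_iff)
  show ?case
  proof (cases "s = t")
    case True
    then show ?thesis using 1 by simp
  next
    case False
    then have st: "{s, t} \<in> X" using Cons.prems by (simp add: clique_word_def)
    have "(s # t # u, t # s # u) \<in> racg_eq X"
      using racg_eq_context[OF racg_eq_commute[OF False st], of "[]" u] S by (simp del: Union_iff)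
    also note 1
    finally show ?thesis by simp
  qed
qed simp

text \<open>By parity the first letter occurs a second time. It can be carried there past the
  letters in between, with which it commutes, and the two copies cancel.\<close>

lemma clique_word_trivial:
  "clique_word X u \<Longrightarrow> odd_letters u = {} \<Longrightarrow> (u, []) \<in> racg_eq X"
proof (induction u rule: length_induct)
  case (1 u)
  show ?case
  proof (cases u)
    case (Cons s v)
    have "s \<notin> odd_letters u" using 1 by simp
    then have "odd (count_list v s)" using Cons by (simp add: odd_letters_def)
    then have "count_list v s \<noteq> 0" by (auto intro: ccontr)
    then have "s \<in> set v" by (simp add: count_list_0_iff)
    then obtain a b where ab: "v = a @ s # b" by (meson split_list)
    have cw: "clique_word X (s # a)" "clique_word X (a @ b)"
      by (rule clique_word_subset[OF 1(2)], use Cons ab in auto)+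
    have S: "s \<in> \<Union>X" "a \<in> lists (\<Union>X)" "b \<in> lists (\<Union>X)"
      using clique_word_lists[OF 1(2)] Cons ab by (simp_all del: Union_iff)
    have u: "u = [s] @ a @ [s] @ b" using Cons ab by simp
    have "(([s] @ a) @ ([s] @ b), (a @ [s]) @ ([s] @ b)) \<in> racg_eq X"
      using racg_eq_context[OF clique_word_Cons_commute[OF cw(1)], of "[]" "[s] @ b"] S by (simp del: Union_iff)
    also have "((a @ [s]) @ ([s] @ b), a @ b) \<in> racg_eq X"
      using racg_eq_context[OF racg_eq_square[OF S(1)] S(2,3)] by simp
    also have "(a @ b, []) \<in> racg_eq X"
    proof -
      have "odd_letters (a @ b) = odd_letters u"
        unfolding u odd_letters_append by auto
      then show ?thesis using 1 cw(2) u by simp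
    qed
    finally show ?thesis using u by simp
  qed simp
qed

text \<open>Among words over a simplex, parities of letters determine the element:
  \<open>u @ rev v\<close> has only even letters and is therefore trivial.\<close>

lemma clique_word_racg_eq:
  assumes u: "clique_word X u" and v: "set v \<subseteq> set u" and odd: "odd_letters u = odd_letters v"
  shows "(u, v) \<in> racg_eq X"
proof -
  have cv: "clique_word X v" by (rule clique_word_subset[OF u v])
  note L = clique_word_lists[OF u] clique_word_lists[OF cv]
  have "clique_word X (u @ rev v)"
    by (rule clique_word_subset[OF u]) (use v in auto)
  moreover have "odd_letters (u @ rev v) = {}"
    using odd by (simp add: odd_letters_append odd_letters_rev)
  ultimately have 1: "(u @ rev v, []) \<in> racg_eq X" by (rule clique_word_trivial)
  have "(u, u @ rev v @ v) \<in> racg_eq X"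
    using racg_eq_context[OF racg_eq_rev_append[OF L(2)] L(1), where b = "[]"] by - (rule racg_eq_sym, simp)
  also have "(u @ rev v @ v, v) \<in> racg_eq X"
    using racg_eq_context[OF 1, of "[]" v] L by simp
  finally show ?thesis .
qed

subsection \<open>Heaps\<close>

text \<open>
  An element of the group is encoded by its Cartier-Foata normal form, a heap of pieces
  \<open>(s, i)\<close>: the letter \<open>s\<close> occurs in the \<open>i\<close>-th layer, \<open>i \<ge> 1\<close>. Right multiplication by \<open>s\<close>
  lets \<open>s\<close> fall down until it meets a piece it does not commute with; there it is cancelled
  if that piece is \<open>s\<close> itself.
\<close>

definition blocks :: "'v set set \<Rightarrow> 'v \<Rightarrow> 'v \<Rightarrow> bool" where
  "blocks X s t \<longleftrightarrow> s = t \<or> {s, t} \<notin> X"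

text \<open>The layer of the first piece that a falling \<open>s\<close> meets. The value 0 is the
  ground, which contains no piece, so on the ground \<open>heap_push\<close> always adds a piece in
  layer 1.\<close>

definition heap_top :: "'v set set \<Rightarrow> 'v \<Rightarrow> ('v \<times> nat) set \<Rightarrow> nat" where
  "heap_top X s P = Max (insert 0 (snd ` {p \<in> P. blocks X s (fst p)}))"

definition heap_push :: "'v set set \<Rightarrow> ('v \<times> nat) set \<Rightarrow> 'v \<Rightarrow> ('v \<times> nat) set" where
  "heap_push X P s =
     (if (s, heap_top X s P) \<in> P then P - {(s, heap_top X s P)} else insert (s, Suc (heap_top X s P)) P)"

text \<open>Encodes normal forms of reduced words. Pieces of one layer commute, and a piece above
  the first layer rests on a blocking piece directly below. Demanding a different letter for this
  support keeps a letter from resting merely on a copy of itself, where it should have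
  cancelled.\<close>

definition is_heap :: "'v set set \<Rightarrow> ('v \<times> nat) set \<Rightarrow> bool" where
  "is_heap X P \<longleftrightarrow> finite P \<and> (\<forall>(s, i)\<in>P. s \<in> \<Union>X \<and> 0 < i) \<and>
     (\<forall>s t i. (s, i) \<in> P \<and> (t, i) \<in> P \<and> blocks X s t \<longrightarrow> s = t) \<and>
     (\<forall>s i. (s, Suc (Suc i)) \<in> P \<longrightarrow> (\<exists>t. (t, Suc i) \<in> P \<and> blocks X s t \<and> t \<noteq> s))"

definition word_heap :: "'v set set \<Rightarrow> 'v list \<Rightarrow> ('v \<times> nat) set" where
  "word_heap X u = foldl (heap_push X) {} u"

lemma blocks_sym: "blocks X s t = blocks X t s"
  by (auto simp: blocks_def insert_commute)

lemma is_heapD: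
  assumes "is_heap X P"
  shows "finite P" "(s, i) \<in> P \<Longrightarrow> s \<in> \<Union>X" "(s, i) \<in> P \<Longrightarrow> 0 < i"
    "(s, i) \<in> P \<Longrightarrow> (t, i) \<in> P \<Longrightarrow> blocks X s t \<Longrightarrow> s = t"
    "(s, Suc (Suc j)) \<in> P \<Longrightarrow> \<exists>t. (t, Suc j) \<in> P \<and> blocks X s t \<and> t \<noteq> s"
  using assms unfolding is_heap_def by blast+

lemma heap_top_ge:
  assumes "finite P" "(t, i) \<in> P" "blocks X s t"
  shows "i \<le> heap_top X s P"
proof -
  have "i \<in> insert 0 (snd ` {p \<in> P. blocks X s (fst p)})" using assms by force
  then show ?thesis unfolding heap_top_def using assms(1) by (intro Max_ge) auto
qed

lemma heap_top_cases:
  assumes "finite P"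
  shows "heap_top X s P = 0 \<or> (\<exists>t. (t, heap_top X s P) \<in> P \<and> blocks X s t)"
proof -
  have "heap_top X s P \<in> insert 0 (snd ` {p \<in> P. blocks X s (fst p)})"
    unfolding heap_top_def using assms by (intro Max_in) auto
  then show ?thesis by force
qed

lemma heap_top_eqI:
  assumes "finite P" "(t, m) \<in> P" "blocks X s t"
    and "\<And>t' i. (t', i) \<in> P \<Longrightarrow> blocks X s t' \<Longrightarrow> i \<le> m"
  shows "heap_top X s P = m"
  using heap_top_ge[OF assms(1-3)] heap_top_cases[OF assms(1), of X s] assms(4) by force

lemma heap_top_cong:
  assumes "\<And>t i. blocks X s t \<Longrightarrow> (t, i) \<in> P \<longleftrightarrow> (t, i) \<in> Q"
  shows "heap_top X s P = heap_top X s Q"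
proof -
  have "{p \<in> P. blocks X s (fst p)} = {p \<in> Q. blocks X s (fst p)}"
    using assms by auto
  then show ?thesis by (simp add: heap_top_def)
qed

lemma heap_push_other:
  assumes "r \<noteq> s"
  shows "(r, i) \<in> heap_push X P s \<longleftrightarrow> (r, i) \<in> P"
  using assms by (auto simp: heap_push_def)

text \<open>A cancelled piece supports nothing, since a piece resting on it would block
  \<open>s\<close> from a layer above \<open>heap_top\<close>. A new piece above the first layer
  rests on a blocking piece, and this is no copy of \<open>s\<close> because \<open>s\<close> would
  then have cancelled.\<close>

lemma heap_push_preserves_heap:
  assumes P: "is_heap X P" and s: "s \<in> \<Union>X"
  shows "is_heap X (heap_push X P s)"
proof (cases "(s, heap_top X s P) \<in> P")
  case True
  let ?m = "heap_top X s P"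
  have Q: "heap_push X P s = P - {(s, ?m)}" using True by (simp add: heap_push_def)
  show ?thesis
    unfolding is_heap_def Q
  proof (intro conjI allI impI)
    show "finite (P - {(s, ?m)})" using is_heapD(1)[OF P] by simp
    show "\<forall>(r, i)\<in>P - {(s, ?m)}. r \<in> \<Union>X \<and> 0 < i"
      using is_heapD(2,3)[OF P] by (auto simp del: Union_iff)
    fix r t i assume "(r, i) \<in> P - {(s, ?m)} \<and> (t, i) \<in> P - {(s, ?m)} \<and> blocks X r t"
    then show "r = t" using is_heapD(4)[OF P] by blast
  next
    fix r i assume r: "(r, Suc (Suc i)) \<in> P - {(s, ?m)}"
    then obtain t where t: "(t, Suc i) \<in> P" "blocks X r t" "t \<noteq> r"
      using is_heapD(5)[OF P] by blast
    have "(t, Suc i) \<noteq> (s, ?m)"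
    proof
      assume e: "(t, Suc i) = (s, ?m)"
      then have "Suc (Suc i) \<le> ?m"
        using heap_top_ge[OF is_heapD(1)[OF P], of r "Suc (Suc i)" X s] r t blocks_sym[of X r t] by auto
      then show False using e by simp
    qed
    then show "\<exists>t. (t, Suc i) \<in> P - {(s, ?m)} \<and> blocks X r t \<and> t \<noteq> r" using t by blast
  qed
next
  case False
  let ?m = "heap_top X s P"
  have Q: "heap_push X P s = insert (s, Suc ?m) P" using False by (simp add: heap_push_def)
  have indep: "\<not> blocks X s t" if "(t, Suc ?m) \<in> P" for t
    using heap_top_ge[OF is_heapD(1)[OF P] that, where s = s and X = X] by auto
  show ?thesis
    unfolding is_heap_def Q
  proof (intro conjI allI impI)
    show "finite (insert (s, Suc ?m) P)" using is_heapD(1)[OF P] by simp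
    show "\<forall>(r, i)\<in>insert (s, Suc ?m) P. r \<in> \<Union>X \<and> 0 < i"
      using is_heapD(2,3)[OF P] s by (auto simp del: Union_iff)
    fix r t i assume "(r, i) \<in> insert (s, Suc ?m) P \<and> (t, i) \<in> insert (s, Suc ?m) P \<and> blocks X r t"
    then show "r = t" using is_heapD(4)[OF P, of r i t] indep blocks_sym[of X r t] by auto
  next
    fix r i assume r: "(r, Suc (Suc i)) \<in> insert (s, Suc ?m) P"
    show "\<exists>t. (t, Suc i) \<in> insert (s, Suc ?m) P \<and> blocks X r t \<and> t \<noteq> r"
    proof (cases "(r, Suc (Suc i)) \<in> P")
      case True
      then show ?thesis using is_heapD(5)[OF P] by blast
    next
      case False
      then have "r = s" "?m = Suc i" using r by auto
      then obtain t where "(t, Suc i) \<in> P" "blocks X s t"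
        using heap_top_cases[OF is_heapD(1)[OF P], of X s] by auto
      moreover have "t \<noteq> s" using \<open>(s, ?m) \<notin> P\<close> \<open>?m = Suc i\<close> \<open>(t, Suc i) \<in> P\<close> by auto
      ultimately show ?thesis using \<open>r = s\<close> by blast
    qed
  qed
qed

text \<open>After a cancellation in layer \<open>m + 1\<close>, a second \<open>s\<close> has to
  come to rest in exactly that layer. The support in layer \<open>m\<close>, or the ground if
  \<open>m = 0\<close>, stops it there; being a different letter, the support also keeps
  \<open>s\<close> out of layer \<open>m\<close>, so that no further cancellation occurs.\<close>

lemma heap_push_involution:
  assumes P: "is_heap X P"
  shows "heap_push X (heap_push X P s) s = P"
proof (cases "(s, heap_top X s P) \<in> P")
  case True
  let ?m = "heap_top X s P" and ?Q = "P - {(s, heap_top X s P)}"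
  have Q: "heap_push X P s = ?Q" using True by (simp add: heap_push_def)
  have fin: "finite ?Q" using is_heapD(1)[OF P] by simp
  have lt: "i < ?m" if "(t, i) \<in> ?Q" "blocks X s t" for t i
  proof -
    have "i \<noteq> ?m"
      using is_heapD(4)[OF P True, of t] that by auto
    moreover have "i \<le> ?m" using heap_top_ge[OF is_heapD(1)[OF P], of t i] that by blast
    ultimately show ?thesis by simp
  qed
  obtain m where m: "?m = Suc m" using is_heapD(3)[OF P True] by (cases ?m) auto
  have top: "heap_top X s ?Q = m"
  proof (cases m)
    case 0
    show ?thesis
      using heap_top_cases[OF fin, of X s] lt m 0 by auto
  next
    case (Suc i)
    then obtain t where "(t, m) \<in> P" "blocks X s t" "t \<noteq> s"
      using is_heapD(5)[OF P, of s i] True m by auto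
    then show ?thesis
      using lt m by (intro heap_top_eqI[OF fin, of t]) force+
  qed
  have "(s, m) \<notin> P"
  proof
    assume "(s, m) \<in> P"
    then obtain i where "m = Suc i" using is_heapD(3)[OF P, of s m] by (cases m) auto
    then obtain t where "(t, m) \<in> P" "blocks X s t" "t \<noteq> s"
      using is_heapD(5)[OF P, of s i] True m by auto
    then show False using is_heapD(4)[OF P \<open>(s, m) \<in> P\<close>] by blast
  qed
  then have "heap_push X ?Q s = insert (s, Suc m) ?Q"
    unfolding heap_push_def top by simp
  also have "\<dots> = P" using True m by auto
  finally show ?thesis using Q by simp
next
  case False
  let ?m = "heap_top X s P" and ?Q = "insert (s, Suc (heap_top X s P)) P"
  have Q: "heap_push X P s = ?Q" using False by (simp add: heap_push_def)
  have fin: "finite ?Q" using is_heapD(1)[OF P] by simp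
  have self: "blocks X s s" by (simp add: blocks_def)
  have top: "heap_top X s ?Q = Suc ?m"
  proof (rule heap_top_eqI[OF fin _ self])
    show "(s, Suc ?m) \<in> ?Q" by simp
    fix t i assume "(t, i) \<in> ?Q" "blocks X s t"
    then show "i \<le> Suc ?m" using heap_top_ge[OF is_heapD(1)[OF P], of t i X s] by auto
  qed
  have "(s, Suc ?m) \<notin> P" using heap_top_ge[OF is_heapD(1)[OF P] _ self, of "Suc ?m"] by auto
  then show ?thesis unfolding Q heap_push_def[of X ?Q] top by simp
qed

text \<open>A push of \<open>s\<close> changes only pieces with letter \<open>s\<close>, and these
  are invisible to an independent letter.\<close>

lemma heap_push_commute:
  assumes "\<not> blocks X s t"
  shows "heap_push X (heap_push X P s) t = heap_push X (heap_push X P t) s"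
proof -
  have t: "heap_top X t (heap_push X P s) = heap_top X t P"
    by (rule heap_top_cong, rule heap_push_other) (use assms blocks_sym[of X t s] in blast)
  have s: "heap_top X s (heap_push X P t) = heap_top X s P"
    by (rule heap_top_cong, rule heap_push_other) (use assms in blast)
  have "s \<noteq> t" using assms by (auto simp: blocks_def)
  then show ?thesis
    unfolding heap_push_def[of X "heap_push X P s"] heap_push_def[of X "heap_push X P t"] s t
    by (auto simp: heap_push_def)
qed

lemma is_heap_foldl:
  "is_heap X P \<Longrightarrow> u \<in> lists (\<Union>X) \<Longrightarrow> is_heap X (foldl (heap_push X) P u)"
proof (induction u arbitrary: P)
  case (Cons s u)
  then show ?case using heap_push_preserves_heap[of X P s] by (simp del: Union_iff)
qed simp

lemma is_heap_empty: "is_heap X {}"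
  by (simp add: is_heap_def)

lemma is_heap_word_heap: "u \<in> lists (\<Union>X) \<Longrightarrow> is_heap X (word_heap X u)"
  unfolding word_heap_def by (intro is_heap_foldl is_heap_empty)

lemma heap_relator:
  assumes P: "is_heap X P" and r: "r \<in> racg_relators X"
  shows "foldl (heap_push X) P r = P"
proof -
  consider s where "s \<in> \<Union>X" "r = [s, s]" | s t where "s \<noteq> t" "{s, t} \<in> X" "r = [s, t, s, t]"
    using r unfolding racg_relators_def by blast
  then show ?thesis
  proof cases
    case 1
    then show ?thesis using heap_push_involution[OF P] by simp
  next
    case 2
    have st: "s \<in> \<Union>X" "t \<in> \<Union>X" using Union_pair_memD[OF 2(2)] by auto
    have "\<not> blocks X s t" using 2 by (simp add: blocks_def)
    note c = heap_push_commute[OF this]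
    have "foldl (heap_push X) P r = heap_push X (heap_push X (heap_push X (heap_push X P s) s) t) t"
      using 2(3) c by simp
    also have "\<dots> = P"
      using heap_push_involution[OF P] by simp
    finally show ?thesis .
  qed
qed

lemma word_heap_racg_eq:
  assumes "(u, v) \<in> racg_eq X"
  shows "word_heap X u = word_heap X v"
proof (rule racg_eq_invariant[OF assms])
  fix p r q assume pr: "p \<in> lists (\<Union>X)" "r \<in> racg_relators X"
  show "word_heap X (p @ r @ q) = word_heap X (p @ q)"
    using heap_relator[OF is_heap_word_heap[OF pr(1)] pr(2)] unfolding word_heap_def by simp
qed

section \<open>Words without cancellation and the trivial element\<close>

inductive reduced_word :: "'v set set \<Rightarrow> 'v list \<Rightarrow> ('v \<times> nat) set \<Rightarrow> bool" for X where
  reduced_Nil: "reduced_word X [] {}"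
| reduced_snoc: "reduced_word X u P \<Longrightarrow> s \<in> \<Union>X \<Longrightarrow> (s, heap_top X s P) \<notin> P \<Longrightarrow>
    reduced_word X (u @ [s]) (insert (s, Suc (heap_top X s P)) P)"

lemma reduced_word_heap:
  "reduced_word X u P \<Longrightarrow> u \<in> lists (\<Union>X) \<and> is_heap X P"
proof (induction rule: reduced_word.induct)
  case (reduced_snoc u P s)
  then show ?case
    using heap_push_preserves_heap[of X P s] by (simp add: heap_push_def del: Union_iff)
qed (simp add: is_heap_empty)

text \<open>If the topmost piece blocking \<open>s\<close> is an \<open>s\<close>, then all letters
  pushed after it are independent of \<open>s\<close>, so this \<open>s\<close> can be carried to
  the end of the word.\<close>

lemma reduced_word_pop:
  "reduced_word X u P \<Longrightarrow> (s, heap_top X s P) \<in> P \<Longrightarrow>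
    \<exists>v. reduced_word X v (P - {(s, heap_top X s P)}) \<and> (u, v @ [s]) \<in> racg_eq X"
proof (induction rule: reduced_word.induct)
  case (reduced_snoc u P r)
  let ?k = "Suc (heap_top X r P)"
  let ?Q = "insert (r, ?k) P"
  have heap: "is_heap X P" and u: "u \<in> lists (\<Union>X)"
    using reduced_word_heap[OF reduced_snoc.hyps(1)] by auto
  have fin: "finite P" "finite ?Q" using is_heapD(1)[OF heap] by auto
  have self: "blocks X t t" for t by (simp add: blocks_def)
  have rP: "(r, ?k) \<notin> P" using heap_top_ge[OF fin(1) _ self, of r ?k] by auto
  show ?case
  proof (cases "r = s")
    case True
    have "heap_top X s ?Q = ?k"
    proof (rule heap_top_eqI[OF fin(2) _ self])
      show "(s, ?k) \<in> ?Q" using True by simp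
      fix t i assume "(t, i) \<in> ?Q" "blocks X s t"
      then show "i \<le> ?k" using heap_top_ge[OF fin(1), of t i X s] True by auto
    qed
    then have "?Q - {(s, heap_top X s ?Q)} = P" using True rP by auto
    then show ?thesis using True reduced_snoc.hyps(1) by (intro exI[of _ u]) simp
  next
    case False
    let ?m = "heap_top X s ?Q"
    have sP: "(s, ?m) \<in> P" using reduced_snoc.prems False by auto
    \<comment> \<open>If \<open>r\<close> blocked \<open>s\<close>, its new piece would lie above
      the piece of \<open>s\<close> in layer \<open>?m\<close>, although \<open>?m\<close> bounds
      all pieces blocking \<open>s\<close>.\<close>
    have indep: "\<not> blocks X s r"
    proof
      assume b: "blocks X s r"
      have "?k \<le> ?m" using b by (intro heap_top_ge[OF fin(2), of r]) auto
      moreover have "?m \<le> heap_top X r P"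
        using sP b blocks_sym[of X s r] by (intro heap_top_ge[OF fin(1), of s]) auto
      ultimately show False by simp
    qed
    have m: "heap_top X s P = ?m"
      using indep by (intro heap_top_cong) auto
    obtain v where v: "reduced_word X v (P - {(s, ?m)})" "(u, v @ [s]) \<in> racg_eq X"
      using reduced_snoc.IH sP unfolding m by blast
    have v': "v \<in> lists (\<Union>X)" using reduced_word_heap[OF v(1)] by simp
    have sX: "s \<in> \<Union>X" by (rule is_heapD(2)[OF heap sP])
    have top: "heap_top X r (P - {(s, ?m)}) = heap_top X r P"
      using indep blocks_sym[of X s r] by (intro heap_top_cong) auto
    have "(r, heap_top X r (P - {(s, ?m)})) \<notin> P - {(s, ?m)}"
      unfolding top using reduced_snoc.hyps(3) by auto
    from reduced_word.reduced_snoc[OF v(1) reduced_snoc.hyps(2) this]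
    have "reduced_word X (v @ [r]) (insert (r, ?k) (P - {(s, ?m)}))"
      unfolding top .
    moreover have "insert (r, ?k) (P - {(s, ?m)}) = ?Q - {(s, ?m)}" using False by auto
    moreover have "(u @ [r], (v @ [r]) @ [s]) \<in> racg_eq X"
    proof -
      have "(u @ [r], (v @ [s]) @ [r]) \<in> racg_eq X"
        using racg_eq_context[OF v(2), of "[]" "[r]"] reduced_snoc.hyps(2) by (simp del: Union_iff)
      also have "((v @ [s]) @ [r], (v @ [r]) @ [s]) \<in> racg_eq X"
        using racg_eq_context[OF racg_eq_commute[of s r X] v', where b = "[]"] indep
        by (simp add: blocks_def)
      finally show ?thesis .
    qed
    ultimately show ?thesis by auto
  qed
qed simp

text \<open>Cancellation of pieces is mirrored on words: the topmost \<open>s\<close> is moved to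
  the end and erased together with the new \<open>s\<close>. Every other push appends a
  letter.\<close>

lemma reduced_word_exists:
  "u \<in> lists (\<Union>X) \<Longrightarrow> \<exists>v. reduced_word X v (word_heap X u) \<and> (u, v) \<in> racg_eq X"
proof (induction u rule: rev_induct)
  case Nil
  show ?case by (rule exI[of _ "[]"]) (simp add: word_heap_def reduced_Nil)
next
  case (snoc s u)
  then have s: "s \<in> \<Union>X" and u: "u \<in> lists (\<Union>X)" by (simp_all del: Union_iff)
  obtain v where v: "reduced_word X v (word_heap X u)" "(u, v) \<in> racg_eq X"
    using snoc.IH[OF u] by blast
  have us: "(u @ [s], v @ [s]) \<in> racg_eq X"
    using racg_eq_context[OF v(2), of "[]" "[s]"] s by (simp del: Union_iff)
  let ?P = "word_heap X u"
  have push: "word_heap X (u @ [s]) = heap_push X ?P s" by (simp add: word_heap_def)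
  show ?case
  proof (cases "(s, heap_top X s ?P) \<in> ?P")
    case True
    obtain w where w: "reduced_word X w (?P - {(s, heap_top X s ?P)})" "(v, w @ [s]) \<in> racg_eq X"
      using reduced_word_pop[OF v(1) True] by blast
    have wl: "w \<in> lists (\<Union>X)" using reduced_word_heap[OF w(1)] by simp
    note us
    also have "(v @ [s], (w @ [s]) @ [s]) \<in> racg_eq X"
      using racg_eq_context[OF w(2), of "[]" "[s]"] s by (simp del: Union_iff)
    also have "((w @ [s]) @ [s], w) \<in> racg_eq X"
      using racg_eq_context[OF racg_eq_square[OF s] wl, where b = "[]"] by simp
    finally show ?thesis using w(1) True push by (auto simp: heap_push_def)
  next
    case False
    then show ?thesis
      using us reduced_snoc[OF v(1) s False] push by (auto simp: heap_push_def)
  qed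
qed

text \<open>The converse of invariance that is needed: a word built without cancellation has the
  empty heap only if it is empty.\<close>

lemma word_heap_empty:
  assumes "u \<in> lists (\<Union>X)" "word_heap X u = {}"
  shows "(u, []) \<in> racg_eq X"
proof -
  obtain v where v: "reduced_word X v {}" "(u, v) \<in> racg_eq X"
    using reduced_word_exists[OF assms(1)] assms(2) by auto
  have "v = []" using v(1) by (cases rule: reduced_word.cases) auto
  then show ?thesis using v(2) by simp
qed

section \<open>The thickening of the Davis complex\<close>

locale nerve =
  fixes X :: "'v set set"
  assumes finite_nerve: "finite X" and flag_nerve: "flag X"
begin

interpretation group "racg X" by (rule group_racg)

text \<open>The empty simplex is included so that these sets are exactly the spherical subsets, as
  \<open>spherical_iff_face\<close> shows.\<close>

definition faces :: "'v set set" where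
  "faces = insert {} X"

lemma finite_vertices: "finite (\<Union>X)"
  using finite_nerve flag_finite[OF flag_nerve] by blast

lemma face_subset: "T \<in> faces \<Longrightarrow> U \<subseteq> T \<Longrightarrow> U \<in> faces"
  unfolding faces_def using flag_face[OF flag_nerve, of T U] by blast

lemma face_vertices: "T \<in> faces \<Longrightarrow> T \<subseteq> \<Union>X"
  unfolding faces_def by blast

lemma finite_face: "T \<in> faces \<Longrightarrow> finite T"
  using face_vertices finite_vertices finite_subset by metis

lemma face_edge: "T \<in> faces \<Longrightarrow> s \<in> T \<Longrightarrow> t \<in> T \<Longrightarrow> {s, t} \<in> X"
  using face_subset[of T "{s, t}"] unfolding faces_def by simp

lemma faceI:
  assumes "T \<subseteq> \<Union>X" "\<And>s t. s \<in> T \<Longrightarrow> t \<in> T \<Longrightarrow> s \<noteq> t \<Longrightarrow> {s, t} \<in> X"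
  shows "T \<in> faces"
proof (cases "T = {}")
  case False
  have "T \<in> X"
    by (rule flag_cliqueI[OF flag_nerve finite_subset[OF assms(1) finite_vertices] False assms(1)])
      (rule assms(2))
  then show ?thesis by (simp add: faces_def)
qed (simp add: faces_def)

section \<open>Group elements given by simplices\<close>

definition face_word :: "'v set \<Rightarrow> 'v list" where
  "face_word T = (SOME u. distinct u \<and> set u = T)"

lemma face_word:
  assumes "T \<in> faces"
  shows "distinct (face_word T)" "set (face_word T) = T"
proof -
  have "\<exists>u. distinct u \<and> set u = T"
    using finite_distinct_list[OF finite_face[OF assms]] by blast
  from someI_ex[OF this] show "distinct (face_word T)" "set (face_word T) = T"
    unfolding face_word_def by blast+
qed

lemma clique_word_face:
  assumes "set u \<in> faces"
  shows "clique_word X u"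
  unfolding clique_word_def lists_eq_set
  using face_vertices[OF assms] face_edge[OF assms] by (simp del: Union_iff)

definition cube_element :: "'v set \<Rightarrow> 'v list set" where
  "cube_element T = racg_class X (face_word T)"

text \<open>Makes the order chosen by \<open>face_word\<close> immaterial. Repeated letters are
  permitted so that concatenated words can be evaluated directly.\<close>

lemma cube_element_eq_class:
  assumes "set u \<in> faces" "odd_letters u = T"
  shows "cube_element T = racg_class X u"
proof -
  have T: "T \<subseteq> set u" using assms(2) odd_letters_subset by metis
  have Tf: "T \<in> faces" by (rule face_subset[OF assms(1) T])
  have "(u, face_word T) \<in> racg_eq X"
    by (rule clique_word_racg_eq[OF clique_word_face[OF assms(1)]])
      (use T assms(2) face_word[OF Tf] odd_letters_distinct[of "face_word T"] in simp_all)
  then show ?thesis unfolding cube_element_def racg_class_eq_iff by (rule racg_eq_sym)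
qed

lemma face_word_lists: "T \<in> faces \<Longrightarrow> face_word T \<in> lists (\<Union>X)"
  using face_word(2) face_vertices unfolding lists_eq_set by blast

lemma cube_element_closed [simp]: "T \<in> faces \<Longrightarrow> cube_element T \<in> carrier (racg X)"
  unfolding cube_element_def by (rule racg_class_in_carrier[OF face_word_lists])

lemma cube_element_empty: "cube_element {} = \<one>\<^bsub>racg X\<^esub>"
  using cube_element_eq_class[of "[]" "{}"] by (simp add: one_racg odd_letters_def faces_def)

lemma cube_element_gen: "s \<in> \<Union>X \<Longrightarrow> cube_element {s} = racg_gen X s"
  unfolding racg_gen_eq_class
  by (rule cube_element_eq_class) (use faceI[of "{s}"] odd_letters_distinct[of "[s]"] in simp_all)

lemma odd_letters_face_word: "T \<in> faces \<Longrightarrow> odd_letters (face_word T) = T"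
  using face_word odd_letters_distinct by metis

lemma cube_element_mult:
  assumes "T \<union> U \<in> faces"
  shows "cube_element T \<otimes>\<^bsub>racg X\<^esub> cube_element U = cube_element (sym_diff T U)"
proof -
  have TU: "T \<in> faces" "U \<in> faces" using face_subset[OF assms] by auto
  have "cube_element (sym_diff T U) = racg_class X (face_word T @ face_word U)"
    by (rule cube_element_eq_class)
      (simp_all add: odd_letters_append odd_letters_face_word face_word assms TU)
  then show ?thesis
    unfolding cube_element_def using mult_racg_class[OF face_word_lists[OF TU(1)] face_word_lists[OF TU(2)]]
    by simp
qed

lemma cube_element_square:
  "T \<in> faces \<Longrightarrow> cube_element T \<otimes>\<^bsub>racg X\<^esub> cube_element T = \<one>\<^bsub>racg X\<^esub>"
  using cube_element_mult[of T T] by (simp add: cube_element_empty)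

lemma inv_cube_element: "T \<in> faces \<Longrightarrow> inv\<^bsub>racg X\<^esub> (cube_element T) = cube_element T"
  using cube_element_square by (intro inv_equality) simp_all

text \<open>The abelianization determines the product, which forces \<open>T \<union> U\<close> to span a simplex.\<close>

lemma cube_element_mult_face:
  assumes T: "T \<in> faces" and U: "U \<in> faces" and V: "V \<in> faces"
    and eq: "cube_element T \<otimes>\<^bsub>racg X\<^esub> cube_element U = cube_element V"
  shows "T \<union> U \<in> faces"
proof -
  have "(face_word T @ face_word U, face_word V) \<in> racg_eq X"
    using eq mult_racg_class[OF face_word_lists[OF T] face_word_lists[OF U]]
    unfolding cube_element_def racg_class_eq_iff[symmetric] by simp
  from odd_letters_racg_eq[OF this] have VTU: "V = sym_diff T U"
    by (simp add: odd_letters_append odd_letters_face_word T U V)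
  show ?thesis
  proof (rule faceI)
    show "T \<union> U \<subseteq> \<Union>X" using face_vertices T U by (simp add: Un_least)
    fix s t assume "s \<in> T \<union> U" "t \<in> T \<union> U"
    \<comment> \<open>Two vertices that lie together neither in \<open>T\<close> nor in
      \<open>U\<close> are one in each difference, hence both in the symmetric difference
      \<open>V\<close>.\<close>
    then consider "s \<in> T" "t \<in> T" | "s \<in> U" "t \<in> U" | "s \<in> V" "t \<in> V"
      unfolding VTU by blast
    then show "{s, t} \<in> X"
      by cases (use face_edge T U V in blast)+
  qed
qed

section \<open>Adjacency in the thickening\<close>

definition adjacent :: "'v list set \<Rightarrow> 'v list set \<Rightarrow> bool" where
  "adjacent x y \<longleftrightarrow> x \<in> carrier (racg X) \<and> (\<exists>T\<in>faces. y = x \<otimes>\<^bsub>racg X\<^esub> cube_element T)"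

lemma adjacent_closed: "adjacent x y \<Longrightarrow> x \<in> carrier (racg X) \<and> y \<in> carrier (racg X)"
  unfolding adjacent_def by auto

lemma empty_face [simp]: "{} \<in> faces"
  by (simp add: faces_def)

lemma adjacent_refl: "x \<in> carrier (racg X) \<Longrightarrow> adjacent x x"
  unfolding adjacent_def by (intro conjI bexI[of _ "{}"]) (simp_all add: cube_element_empty)

lemma adjacent_sym:
  assumes "adjacent x y"
  shows "adjacent y x"
proof -
  obtain T where T: "T \<in> faces" "y = x \<otimes>\<^bsub>racg X\<^esub> cube_element T" and x: "x \<in> carrier (racg X)"
    using assms unfolding adjacent_def by blast
  have "x = y \<otimes>\<^bsub>racg X\<^esub> cube_element T"
    using T x by (simp add: m_assoc cube_element_square)
  then show ?thesis using T x unfolding adjacent_def by auto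
qed

lemma adjacent_mult_left:
  assumes "g \<in> carrier (racg X)" "adjacent x y"
  shows "adjacent (g \<otimes>\<^bsub>racg X\<^esub> x) (g \<otimes>\<^bsub>racg X\<^esub> y)"
  using assms unfolding adjacent_def by (auto simp: m_assoc)

text \<open>Describes the closed neighbourhood of \<open>x\<close> by simplices of the nerve. The
  quotient of two neighbours is the product of their cube elements, and this is a cube element
  exactly when the two simplices span a common one.\<close>

lemma adjacent_cube_elements:
  assumes x: "x \<in> carrier (racg X)" and T: "T \<in> faces" and U: "U \<in> faces"
  shows "adjacent (x \<otimes>\<^bsub>racg X\<^esub> cube_element T) (x \<otimes>\<^bsub>racg X\<^esub> cube_element U) \<longleftrightarrow> T \<union> U \<in> faces"
proof
  assume "adjacent (x \<otimes>\<^bsub>racg X\<^esub> cube_element T) (x \<otimes>\<^bsub>racg X\<^esub> cube_element U)"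
  then obtain V where V: "V \<in> faces"
    "x \<otimes>\<^bsub>racg X\<^esub> cube_element U = x \<otimes>\<^bsub>racg X\<^esub> cube_element T \<otimes>\<^bsub>racg X\<^esub> cube_element V"
    unfolding adjacent_def by blast
  then have "cube_element U = cube_element T \<otimes>\<^bsub>racg X\<^esub> cube_element V"
    using x T U by (simp add: m_assoc)
  then have "cube_element T \<otimes>\<^bsub>racg X\<^esub> cube_element U = cube_element V"
    using T V by (simp add: m_assoc[symmetric] cube_element_square)
  then show "T \<union> U \<in> faces" by (rule cube_element_mult_face[OF T U V(1)])
next
  assume TU: "T \<union> U \<in> faces"
  then have d: "sym_diff T U \<in> faces" by (rule face_subset) auto
  have "cube_element T \<otimes>\<^bsub>racg X\<^esub> cube_element (sym_diff T U) = cube_element U"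
  proof -
    have "T \<union> sym_diff T U \<in> faces" using TU by (rule face_subset) auto
    moreover have "sym_diff T (sym_diff T U) = U" by auto
    ultimately show ?thesis by (simp add: cube_element_mult)
  qed
  then have "x \<otimes>\<^bsub>racg X\<^esub> cube_element U = x \<otimes>\<^bsub>racg X\<^esub> cube_element T \<otimes>\<^bsub>racg X\<^esub> cube_element (sym_diff T U)"
    using x T U d by (simp add: m_assoc)
  then show "adjacent (x \<otimes>\<^bsub>racg X\<^esub> cube_element T) (x \<otimes>\<^bsub>racg X\<^esub> cube_element U)"
    unfolding adjacent_def using x T by (intro conjI bexI[OF _ d]) simp_all
qed

lemma finite_adjacent: "finite {y. adjacent x y}"
proof (rule finite_subset)
  show "{y. adjacent x y} \<subseteq> (\<lambda>T. x \<otimes>\<^bsub>racg X\<^esub> cube_element T) ` faces"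
    unfolding adjacent_def by blast
  show "finite ((\<lambda>T. x \<otimes>\<^bsub>racg X\<^esub> cube_element T) ` faces)"
    using finite_nerve by (simp add: faces_def)
qed

subsection \<open>Spherical subsets\<close>

lemma special_subgroup_face:
  assumes T: "T \<in> faces"
  shows "special_subgroup X T = cube_element ` Pow T"
proof (rule subset_antisym; rule subsetI)
  fix x assume "x \<in> special_subgroup X T"
  then have "x \<in> generate (racg X) (racg_gen X ` T)" by (simp add: special_subgroup_def)
  then show "x \<in> cube_element ` Pow T"
  proof (induction rule: generate.induct)
    case one
    then show ?case using cube_element_empty by (metis Pow_bottom image_eqI)
  next
    case (incl h)
    then obtain s where "s \<in> T" "h = cube_element {s}"
      using face_vertices[OF T] cube_element_gen by blast
    then show ?case by blast
  next
    case (inv h)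
    then obtain s where "s \<in> T" "h = cube_element {s}"
      using face_vertices[OF T] cube_element_gen by blast
    moreover have "{s} \<in> faces" using face_subset[OF T] \<open>s \<in> T\<close> by simp
    ultimately show ?case using inv_cube_element by simp
  next
    case (eng h1 h2)
    then obtain A B where AB: "A \<subseteq> T" "B \<subseteq> T" "h1 = cube_element A" "h2 = cube_element B" by blast
    then have "h1 \<otimes>\<^bsub>racg X\<^esub> h2 = cube_element (sym_diff A B)"
      using cube_element_mult face_subset[OF T, of "A \<union> B"] by simp
    moreover have "sym_diff A B \<subseteq> T" using AB by blast
    ultimately show ?case by blast
  qed
next
  have gen: "racg_class X u \<in> generate (racg X) (racg_gen X ` T)" if "set u \<subseteq> T" for u
    using that
  proof (induction u)
    case Nil
    then show ?case using generate.one[of "racg X"] by (simp add: one_racg)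
  next
    case (Cons s u)
    have "s \<in> \<Union>X" "u \<in> lists (\<Union>X)"
      using Cons.prems face_vertices[OF T] unfolding lists_eq_set by auto
    then have "racg_class X (s # u) = racg_gen X s \<otimes>\<^bsub>racg X\<^esub> racg_class X u"
      unfolding racg_gen_eq_class by (subst mult_racg_class) (simp_all del: Union_iff)
    then show ?case
      using Cons by (simp add: generate.eng generate.incl)
  qed
  fix x assume "x \<in> cube_element ` Pow T"
  then obtain A where "A \<subseteq> T" "x = cube_element A" by blast
  then show "x \<in> special_subgroup X T"
    unfolding special_subgroup_def cube_element_def
    using gen[of "face_word A"] face_word(2)[OF face_subset[OF T]] by simp
qed

text \<open>Two generators that do not commute act on the integers as the infinite dihedral group.\<close>

lemma infinite_special_subgroup:
  assumes T: "T \<subseteq> \<Union>X" and st: "s \<in> T" "t \<in> T" "s \<noteq> t" "{s, t} \<notin> X"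
  shows "infinite (special_subgroup X T)"
proof
  assume fin: "finite (special_subgroup X T)"
  \<comment> \<open>\<open>s\<close> acts as the reflection at 0 and \<open>t\<close> as the
    reflection at 1/2, so \<open>ts\<close> is the translation by 1. All other letters act
    trivially.\<close>
  define refl :: "'v \<Rightarrow> int \<Rightarrow> int" where
    "refl r x = (if r = s then - x else if r = t then 1 - x else x)" for r x
  have inv: "refl r (refl r x) = x" for r x by (simp add: refl_def)
  have rel: "foldr refl r x = x" if "r \<in> racg_relators X" for r x
  proof -
    consider a where "r = [a, a]" | a b where "a \<noteq> b" "{a, b} \<in> X" "r = [a, b, a, b]"
      using \<open>r \<in> racg_relators X\<close> unfolding racg_relators_def by blast
    then show ?thesis
    proof cases
      case 1
      then show ?thesis by (simp add: inv)
    next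
      case 2
      \<comment> \<open>Since \<open>a\<close> and \<open>b\<close> are distinct, at least one of
        them acts as the identity.\<close>
      then have "{a, b} \<noteq> {s, t}" using st(4) by auto
      then have "refl a (refl b x) = refl b (refl a x)" for x
        using 2(1) by (auto simp: refl_def)
      then show ?thesis using 2(3) by (simp add: inv)
    qed
  qed
  have fold: "foldr refl u = foldr refl v" if "(u, v) \<in> racg_eq X" for u v
    by (rule racg_eq_invariant[OF that]) (simp add: fun_eq_iff rel)
  define w where "w n = concat (replicate n [t, s])" for n
  have val: "foldr refl (w n) 0 = int n" for n
    by (induction n) (use st(3) in \<open>auto simp: w_def refl_def\<close>)
  have "inj (\<lambda>n. racg_class X (w n))"
  proof (rule injI)
    fix m n assume "racg_class X (w m) = racg_class X (w n)"
    then have "foldr refl (w m) = foldr refl (w n)"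
      unfolding racg_class_eq_iff by (rule fold)
    then show "m = n" using val by (metis of_nat_eq_iff)
  qed
  moreover have "racg_class X (w n) \<in> special_subgroup X T" for n
  proof (induction n)
    case 0
    then show ?case
      unfolding special_subgroup_def w_def using generate.one[of "racg X"] by (simp add: one_racg)
  next
    case (Suc n)
    have l: "w n \<in> lists (\<Union>X)" and stX: "s \<in> \<Union>X" "t \<in> \<Union>X"
      using st(1,2) T unfolding w_def lists_eq_set by auto
    have "racg_class X (w (Suc n)) = racg_gen X t \<otimes>\<^bsub>racg X\<^esub> (racg_gen X s \<otimes>\<^bsub>racg X\<^esub> racg_class X (w n))"
      unfolding racg_gen_eq_class using l stX by (simp add: mult_racg_class w_def del: Union_iff)
    then show ?case
      using Suc.IH st(1,2) unfolding special_subgroup_def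
      by (simp add: generate.eng generate.incl)
  qed
  ultimately have "finite (UNIV :: nat set)"
    using fin by (metis finite_imageD finite_subset image_subsetI)
  then show False by simp
qed

lemma spherical_iff_face: "spherical X T \<longleftrightarrow> T \<in> faces"
proof
  assume T: "spherical X T"
  show "T \<in> faces"
  proof (rule faceI)
    show TX: "T \<subseteq> \<Union>X" using T by (simp add: spherical_def)
    fix s t assume "s \<in> T" "t \<in> T" "s \<noteq> t"
    then show "{s, t} \<in> X"
      using infinite_special_subgroup[OF TX, of s t] T by (auto simp: spherical_def)
  qed
next
  assume "T \<in> faces"
  then show "spherical X T"
    using special_subgroup_face face_vertices finite_face by (simp add: spherical_def)
qed

lemma davis_cubes_eq:
  "davis_cubes X = {(\<lambda>U. w \<otimes>\<^bsub>racg X\<^esub> cube_element U) ` Pow T | w T. w \<in> carrier (racg X) \<and> T \<in> faces}"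
proof -
  have "w <#\<^bsub>racg X\<^esub> special_subgroup X T = (\<lambda>U. w \<otimes>\<^bsub>racg X\<^esub> cube_element U) ` Pow T"
    if "T \<in> faces" for w T
    unfolding l_coset_def special_subgroup_face[OF that] by auto
  then show ?thesis unfolding davis_cubes_def spherical_iff_face by blast
qed

text \<open>Seen from one member \<open>x\<close>, the clique is a family of simplices with pairwise
  unions in \<open>faces\<close>. By flagness the union of the whole family is a simplex, and it
  spans a cube at \<open>x\<close>.\<close>

lemma adjacent_clique_in_cube:
  assumes \<sigma>: "finite \<sigma>" "\<sigma> \<noteq> {}" "\<And>x y. x \<in> \<sigma> \<Longrightarrow> y \<in> \<sigma> \<Longrightarrow> adjacent x y"
  shows "\<exists>C\<in>davis_cubes X. \<sigma> \<subseteq> C"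
proof -
  obtain x where x: "x \<in> \<sigma>" using \<sigma>(2) by blast
  have xW: "x \<in> carrier (racg X)" using adjacent_closed \<sigma>(3) x by blast
  have "\<forall>y\<in>\<sigma>. \<exists>T\<in>faces. y = x \<otimes>\<^bsub>racg X\<^esub> cube_element T"
    using \<sigma>(3)[OF x] unfolding adjacent_def by blast
  then obtain f where f: "\<And>y. y \<in> \<sigma> \<Longrightarrow> f y \<in> faces"
      "\<And>y. y \<in> \<sigma> \<Longrightarrow> y = x \<otimes>\<^bsub>racg X\<^esub> cube_element (f y)"
    by metis
  have un: "f y \<union> f z \<in> faces" if "y \<in> \<sigma>" "z \<in> \<sigma>" for y z
  proof -
    have "adjacent (x \<otimes>\<^bsub>racg X\<^esub> cube_element (f y)) (x \<otimes>\<^bsub>racg X\<^esub> cube_element (f z))"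
      using \<sigma>(3)[OF that] f(2) that by metis
    then show ?thesis using adjacent_cube_elements[OF xW f(1) f(1)] that by simp
  qed
  have U: "\<Union>(f ` \<sigma>) \<in> faces"
  proof (rule faceI)
    show "\<Union>(f ` \<sigma>) \<subseteq> \<Union>X" using f(1) face_vertices by (simp add: UN_least)
    fix s t assume "s \<in> \<Union>(f ` \<sigma>)" "t \<in> \<Union>(f ` \<sigma>)"
    then obtain y z where "y \<in> \<sigma>" "z \<in> \<sigma>" "s \<in> f y" "t \<in> f z" by blast
    then show "{s, t} \<in> X" using face_edge[OF un, of y z s t] by simp
  qed
  have "\<sigma> \<subseteq> (\<lambda>V. x \<otimes>\<^bsub>racg X\<^esub> cube_element V) ` Pow (\<Union>(f ` \<sigma>))"
    using f(2) by blast
  then show ?thesis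
    unfolding davis_cubes_eq using xW U by blast
qed

lemma davis_cube_adjacent:
  assumes "C \<in> davis_cubes X" "x \<in> C" "y \<in> C"
  shows "adjacent x y"
proof -
  obtain w T where w: "w \<in> carrier (racg X)" "T \<in> faces" "C = (\<lambda>U. w \<otimes>\<^bsub>racg X\<^esub> cube_element U) ` Pow T"
    using assms(1) unfolding davis_cubes_eq by blast
  obtain A B where AB: "A \<subseteq> T" "B \<subseteq> T" "x = w \<otimes>\<^bsub>racg X\<^esub> cube_element A" "y = w \<otimes>\<^bsub>racg X\<^esub> cube_element B"
    using assms(2,3) w(3) by blast
  then show ?thesis
    using adjacent_cube_elements[OF w(1)] face_subset[OF w(2)] by simp
qed

lemma thickening_davis:
  "thickening (davis_cubes X) = clique_complex (carrier (racg X)) adjacent"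
proof (rule subset_antisym; rule subsetI)
  fix \<sigma> assume "\<sigma> \<in> thickening (davis_cubes X)"
  then obtain C where C: "finite \<sigma>" "\<sigma> \<noteq> {}" "C \<in> davis_cubes X" "\<sigma> \<subseteq> C"
    unfolding thickening_def by blast
  have "adjacent x y" if "x \<in> \<sigma>" "y \<in> \<sigma>" for x y
    using davis_cube_adjacent[OF C(3)] C(4) that by blast
  then show "\<sigma> \<in> clique_complex (carrier (racg X)) adjacent"
    unfolding clique_complex_def using C(1,2) adjacent_closed by blast
next
  fix \<sigma> assume "\<sigma> \<in> clique_complex (carrier (racg X)) adjacent"
  then show "\<sigma> \<in> thickening (davis_cubes X)"
    unfolding clique_complex_def thickening_def using adjacent_clique_in_cube[of \<sigma>] by blast
qed

subsection \<open>Height and domination\<close>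

definition heap_of :: "'v list set \<Rightarrow> ('v \<times> nat) set" where
  "heap_of x = word_heap X (SOME u. u \<in> lists (\<Union>X) \<and> x = racg_class X u)"

definition height :: "'v list set \<Rightarrow> nat" where
  "height x = Max (insert 0 (snd ` heap_of x))"

definition last_layer :: "'v list set \<Rightarrow> 'v set" where
  "last_layer x = {s. (s, height x) \<in> heap_of x}"

text \<open>The letters of the last layer commute and are involutions, so multiplication by their
  product deletes the layer.\<close>

definition descend :: "'v list set \<Rightarrow> 'v list set" where
  "descend x = x \<otimes>\<^bsub>racg X\<^esub> cube_element (last_layer x)"

lemma heap_of_class:
  assumes "u \<in> lists (\<Union>X)"
  shows "heap_of (racg_class X u) = word_heap X u"
proof -
  let ?v = "SOME v. v \<in> lists (\<Union>X) \<and> racg_class X u = racg_class X v"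
  have "?v \<in> lists (\<Union>X) \<and> racg_class X u = racg_class X ?v"
    by (rule someI[of _ u]) (use assms in simp)
  then have "word_heap X u = word_heap X ?v"
    unfolding racg_class_eq_iff using word_heap_racg_eq by blast
  then show ?thesis unfolding heap_of_def by simp
qed

lemma is_heap_heap_of:
  assumes "x \<in> carrier (racg X)"
  shows "is_heap X (heap_of x)"
  using assms by (elim racg_carrierE) (simp add: heap_of_class is_heap_word_heap)

lemma heap_of_mult:
  assumes x: "x \<in> carrier (racg X)" and u: "u \<in> lists (\<Union>X)"
  shows "heap_of (x \<otimes>\<^bsub>racg X\<^esub> racg_class X u) = foldl (heap_push X) (heap_of x) u"
proof -
  obtain v where "v \<in> lists (\<Union>X)" "x = racg_class X v" using x by (rule racg_carrierE)
  then show ?thesis using u by (simp add: mult_racg_class heap_of_class word_heap_def)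
qed

lemma height_ge:
  assumes "x \<in> carrier (racg X)" "(s, i) \<in> heap_of x"
  shows "i \<le> height x"
  unfolding height_def using assms is_heapD(1)[OF is_heap_heap_of] by (intro Max_ge) force+

lemma last_layer_face:
  assumes x: "x \<in> carrier (racg X)"
  shows "last_layer x \<in> faces"
proof (rule faceI)
  note heap = is_heap_heap_of[OF x]
  show "last_layer x \<subseteq> \<Union>X"
    unfolding last_layer_def using is_heapD(2)[OF heap] by (simp add: subset_iff del: Union_iff)
  fix s t assume "s \<in> last_layer x" "t \<in> last_layer x" "s \<noteq> t"
  then show "{s, t} \<in> X"
    using is_heapD(4)[OF heap, of s "height x" t] unfolding last_layer_def blocks_def by blast
qed

lemma descend_closed: "x \<in> carrier (racg X) \<Longrightarrow> descend x \<in> carrier (racg X)"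
  unfolding descend_def using last_layer_face by simp

text \<open>A letter of the top layer meets its own piece first and cancels it, which leaves the
  other letters of that layer in the same position.\<close>

lemma foldl_push_top_layer:
  assumes "finite P" "\<And>s i. (s, i) \<in> P \<Longrightarrow> i \<le> n" "distinct u" "\<And>s. s \<in> set u \<Longrightarrow> (s, n) \<in> P"
  shows "foldl (heap_push X) P u = P - (\<lambda>s. (s, n)) ` set u"
  using assms
proof (induction u arbitrary: P)
  case (Cons s u)
  have "(s, n) \<in> P" using Cons.prems(4) by simp
  moreover have "heap_top X s P = n"
    by (rule heap_top_eqI[OF Cons.prems(1) \<open>(s, n) \<in> P\<close>]) (use Cons.prems(2) in \<open>auto simp: blocks_def\<close>)
  ultimately have "heap_push X P s = P - {(s, n)}" by (simp add: heap_push_def)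
  moreover have "foldl (heap_push X) (P - {(s, n)}) u = (P - {(s, n)}) - (\<lambda>s. (s, n)) ` set u"
    by (rule Cons.IH) (use Cons.prems in auto)
  ultimately show ?case by auto
qed simp

lemma heap_of_descend:
  assumes x: "x \<in> carrier (racg X)"
  shows "heap_of (descend x) = {(s, i) \<in> heap_of x. i \<noteq> height x}"
proof -
  let ?u = "face_word (last_layer x)"
  note L = last_layer_face[OF x]
  have "heap_of (descend x) = foldl (heap_push X) (heap_of x) ?u"
    unfolding descend_def cube_element_def by (rule heap_of_mult[OF x face_word_lists[OF L]])
  also have "\<dots> = heap_of x - (\<lambda>s. (s, height x)) ` set ?u"
  proof (rule foldl_push_top_layer)
    show "finite (heap_of x)" by (rule is_heapD(1)[OF is_heap_heap_of[OF x]])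
    show "i \<le> height x" if "(s, i) \<in> heap_of x" for s i by (rule height_ge[OF x that])
    show "(s, height x) \<in> heap_of x" if "s \<in> set ?u" for s
      using that face_word(2)[OF L] by (simp add: last_layer_def)
  qed (rule face_word(1)[OF L])
  also have "\<dots> = {(s, i) \<in> heap_of x. i \<noteq> height x}"
    unfolding face_word(2)[OF L] by (auto simp: last_layer_def)
  finally show ?thesis .
qed

lemma height_descend:
  assumes x: "x \<in> carrier (racg X)" and pos: "0 < height x"
  shows "height (descend x) < height x"
proof -
  have "finite (heap_of (descend x))"
    by (rule is_heapD(1)[OF is_heap_heap_of[OF descend_closed[OF x]]])
  moreover have "i < height x" if "(s, i) \<in> heap_of (descend x)" for s i
    using that height_ge[OF x, of s i] unfolding heap_of_descend[OF x] by auto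
  ultimately show ?thesis
    unfolding height_def[of "descend x"] using pos by (subst Max_less_iff) auto
qed

lemma height_zero:
  assumes x: "x \<in> carrier (racg X)" and zero: "height x = 0"
  shows "x = \<one>\<^bsub>racg X\<^esub>"
proof -
  obtain u where u: "u \<in> lists (\<Union>X)" "x = racg_class X u" using x by (rule racg_carrierE)
  have "heap_of x = {}"
  proof (rule ccontr)
    assume "heap_of x \<noteq> {}"
    then obtain s i where "(s, i) \<in> heap_of x" by auto
    then show False
      using is_heapD(3)[OF is_heap_heap_of[OF x]] height_ge[OF x, of s i] zero by force
  qed
  then have "word_heap X u = {}" using u heap_of_class by simp
  then show ?thesis
    using word_heap_empty[OF u(1)] u(2) by (simp add: one_racg racg_class_eq_iff)
qed

lemma foldl_push_keeps:
  "(r, i) \<in> P \<Longrightarrow> r \<notin> set u \<Longrightarrow> (r, i) \<in> foldl (heap_push X) P u"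
proof (induction u arbitrary: P)
  case (Cons s u)
  then show ?case using heap_push_other[of r s i X P] by simp
qed simp

text \<open>
  A letter of \<open>T\<close> that does not commute with some letter of the last layer of \<open>x\<close> would open a
  new layer.
\<close>

lemma descend_dominates:
  assumes x: "x \<in> carrier (racg X)" and pos: "0 < height x" and xy: "adjacent x y"
    and le: "height y \<le> height x"
  shows "adjacent (descend x) y"
proof -
  obtain T where T: "T \<in> faces" "y = x \<otimes>\<^bsub>racg X\<^esub> cube_element T"
    using xy unfolding adjacent_def by blast
  have yW: "y \<in> carrier (racg X)" using T x by simp
  note L = last_layer_face[OF x]
  have edge: "{s, r} \<in> X" if s: "s \<in> last_layer x" and r: "r \<in> T" and "s \<noteq> r" for s r
  proof (rule ccontr)
    assume "{s, r} \<notin> X"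
    then have b: "blocks X r s" "blocks X s r" by (simp_all add: blocks_def insert_commute)
    note heap = is_heap_heap_of[OF x]
    have sh: "(s, height x) \<in> heap_of x" using s by (simp add: last_layer_def)
    have "(r, height x) \<notin> heap_of x"
      using is_heapD(4)[OF heap sh _ b(2)] \<open>s \<noteq> r\<close> by blast
    moreover have "heap_top X r (heap_of x) = height x"
      by (rule heap_top_eqI[OF is_heapD(1)[OF heap] sh b(1)]) (rule height_ge[OF x])
    ultimately have push: "(r, Suc (height x)) \<in> heap_push X (heap_of x) r"
      by (simp add: heap_push_def)
    \<comment> \<open>Spelling the cube element with \<open>r\<close> first puts a piece into layer
      \<open>height x + 1\<close>; the remaining letters differ from \<open>r\<close> and cannot
      remove it.\<close>
    have Tr: "T - {r} \<in> faces" by (rule face_subset[OF T(1)]) auto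
    let ?u = "r # face_word (T - {r})"
    have set_u: "set ?u = T" using face_word(2)[OF Tr] r by auto
    have "distinct ?u" using face_word[OF Tr] by simp
    then have "cube_element T = racg_class X ?u"
      by (intro cube_element_eq_class) (simp_all only: set_u T(1) odd_letters_distinct)
    moreover have "?u \<in> lists (\<Union>X)"
      using set_u face_vertices[OF T(1)] unfolding lists_eq_set by blast
    ultimately have "heap_of y = foldl (heap_push X) (heap_of x) ?u"
      using heap_of_mult[OF x] T(2) by simp
    then have "(r, Suc (height x)) \<in> heap_of y"
      using foldl_push_keeps[OF push, of "face_word (T - {r})"] face_word(2)[OF Tr] by simp
    then have "Suc (height x) \<le> height y" by (rule height_ge[OF yW])
    then show False using le by simp
  qed
  have "last_layer x \<union> T \<in> faces"
  proof (rule faceI)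
    show "last_layer x \<union> T \<subseteq> \<Union>X" using face_vertices L T(1) by (simp add: Un_least)
    fix s t assume st: "s \<in> last_layer x \<union> T" "t \<in> last_layer x \<union> T" "s \<noteq> t"
    then consider "s \<in> last_layer x" "t \<in> last_layer x" | "s \<in> T" "t \<in> T"
      | "s \<in> last_layer x" "t \<in> T" | "t \<in> last_layer x" "s \<in> T"
      by blast
    then show "{s, t} \<in> X"
    proof cases
      case 4
      then show ?thesis using edge[of t s] st(3) by (simp add: insert_commute)
    qed (use face_edge[OF L] face_edge[OF T(1)] edge st(3) in simp_all)
  qed
  then show ?thesis
    using adjacent_cube_elements[OF x L T(1)] T(2) by (simp add: descend_def)
qed

text \<open>Domination is \<open>descend_dominates\<close>. For the local hypothesis, a neighbour
  \<open>y\<close> of \<open>x\<close> is recorded as a simplex \<open>T\<close> with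
  \<open>y\<close> equal to \<open>x\<close> times its cube element, which embeds the closed
  neighbourhood into the relation of \<open>no_short_cycle_simplices\<close>.\<close>

lemma k_large_davis:
  assumes "k_large k X"
  shows "no_short_cycle k (carrier (racg X)) adjacent"
proof (rule no_short_cycle_dominated[where d = height and \<rho> = descend])
  fix x assume x: "x \<in> carrier (racg X)"
  define f where "f y = (SOME T. T \<in> faces \<and> y = x \<otimes>\<^bsub>racg X\<^esub> cube_element T)" for y
  have f: "f y \<in> faces" "y = x \<otimes>\<^bsub>racg X\<^esub> cube_element (f y)" if "adjacent x y" for y
  proof -
    have "\<exists>T. T \<in> faces \<and> y = x \<otimes>\<^bsub>racg X\<^esub> cube_element T" using that unfolding adjacent_def by blast
    from someI_ex[OF this] show "f y \<in> faces" "y = x \<otimes>\<^bsub>racg X\<^esub> cube_element (f y)"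
      unfolding f_def by blast+
  qed
  have "no_short_cycle k (insert {} X) (\<lambda>T U. T \<union> U \<in> insert {} X)"
    using assms k_large_flag[OF flag_nerve] by (intro no_short_cycle_simplices flag_nerve) simp
  then have "no_short_cycle k faces (\<lambda>T U. T \<union> U \<in> faces)" unfolding faces_def .
  then show "no_short_cycle k {v \<in> carrier (racg X). adjacent x v} adjacent"
  proof (rule no_short_cycle_map[of _ _ _ f])
    show "inj_on f {v \<in> carrier (racg X). adjacent x v}"
      using f(2) unfolding inj_on_def by (metis (mono_tags, lifting) mem_Collect_eq)
    show "f ` {v \<in> carrier (racg X). adjacent x v} \<subseteq> faces" using f(1) by blast
    fix y z assume "y \<in> {v \<in> carrier (racg X). adjacent x v}" "z \<in> {v \<in> carrier (racg X). adjacent x v}"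
    then have y: "adjacent x y" and z: "adjacent x z" by auto
    show "(f y \<union> f z \<in> faces) = adjacent y z"
      using adjacent_cube_elements[OF x f(1)[OF y] f(1)[OF z]] f(2)[OF y] f(2)[OF z] by simp
  qed
next
  fix v w assume "v \<in> carrier (racg X)" "w \<in> carrier (racg X)" "height v = 0" "height w = 0"
  then show "v = w" using height_zero by metis
qed (use adjacent_refl adjacent_sym descend_closed height_descend descend_dominates in simp_all)

end

section \<open>Realizations of locally finite complexes\<close>

definition locally_finite_complex :: "'v set set \<Rightarrow> bool" where
  "locally_finite_complex Z \<longleftrightarrow> abs_complex Z \<and> (\<forall>v. finite {\<sigma> \<in> Z. v \<in> \<sigma>})"

lemma abs_complex_finite: "abs_complex Z \<Longrightarrow> \<sigma> \<in> Z \<Longrightarrow> finite \<sigma>"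
  unfolding abs_complex_def by blast

lemma realization_pointsD:
  assumes "abs_complex Z" "\<alpha> \<in> realization_points Z"
  shows "0 \<le> \<alpha> v" "{v. \<alpha> v \<noteq> 0} \<in> Z" "(\<Sum>v | \<alpha> v \<noteq> 0. \<alpha> v) = 1" "finite {v. \<alpha> v \<noteq> 0}"
proof -
  show "0 \<le> \<alpha> v" "{v. \<alpha> v \<noteq> 0} \<in> Z" "(\<Sum>v | \<alpha> v \<noteq> 0. \<alpha> v) = 1"
    using assms(2) by (auto simp: realization_points_def)
  then show "finite {v. \<alpha> v \<noteq> 0}" by (intro abs_complex_finite[OF assms(1)])
qed

lemma realization_points_positive:
  assumes "\<alpha> \<in> realization_points Z"
  obtains v where "0 < \<alpha> v"
proof -
  have \<alpha>: "0 \<le> \<alpha> v" "(\<Sum>v | \<alpha> v \<noteq> 0. \<alpha> v) = 1" for v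
    using assms by (auto simp: realization_points_def)
  have "{v. \<alpha> v \<noteq> 0} \<noteq> {}"
    using \<alpha>(2) by (metis sum.empty zero_neq_one)
  then obtain v where "\<alpha> v \<noteq> 0" by blast
  then have "0 < \<alpha> v" using \<alpha>(1)[of v] by simp
  then show ?thesis by (rule that)
qed

text \<open>Summing over the fixed finite set \<open>\<sigma>\<close> instead of the varying support
  makes closedness, compactness and convexity apparent.\<close>

lemma closed_simplex_eq:
  assumes Z: "abs_complex Z" and \<sigma>: "\<sigma> \<in> Z"
  shows "closed_simplex Z \<sigma> = {\<alpha>. (\<forall>v. 0 \<le> \<alpha> v) \<and> (\<forall>v. v \<notin> \<sigma> \<longrightarrow> \<alpha> v = 0) \<and> sum \<alpha> \<sigma> = 1}"
proof (rule subset_antisym; rule subsetI)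
  note fin = abs_complex_finite[OF Z \<sigma>]
  fix \<alpha> assume "\<alpha> \<in> closed_simplex Z \<sigma>"
  then have \<alpha>: "\<alpha> \<in> realization_points Z" "{v. \<alpha> v \<noteq> 0} \<subseteq> \<sigma>" by (auto simp: closed_simplex_def)
  have "sum \<alpha> \<sigma> = (\<Sum>v | \<alpha> v \<noteq> 0. \<alpha> v)"
    by (rule sum.mono_neutral_right[OF fin \<alpha>(2)]) simp
  then show "\<alpha> \<in> {\<alpha>. (\<forall>v. 0 \<le> \<alpha> v) \<and> (\<forall>v. v \<notin> \<sigma> \<longrightarrow> \<alpha> v = 0) \<and> sum \<alpha> \<sigma> = 1}"
    using realization_pointsD[OF Z \<alpha>(1)] \<alpha>(2) by auto
next
  note fin = abs_complex_finite[OF Z \<sigma>]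
  fix \<alpha> :: "'a \<Rightarrow> real"
  assume "\<alpha> \<in> {\<alpha>. (\<forall>v. 0 \<le> \<alpha> v) \<and> (\<forall>v. v \<notin> \<sigma> \<longrightarrow> \<alpha> v = 0) \<and> sum \<alpha> \<sigma> = 1}"
  then have \<alpha>: "\<And>v. 0 \<le> \<alpha> v" "\<And>v. v \<notin> \<sigma> \<Longrightarrow> \<alpha> v = 0" "sum \<alpha> \<sigma> = 1" by auto
  have sub: "{v. \<alpha> v \<noteq> 0} \<subseteq> \<sigma>" using \<alpha>(2) by blast
  have "sum \<alpha> \<sigma> = (\<Sum>v | \<alpha> v \<noteq> 0. \<alpha> v)"
    by (rule sum.mono_neutral_right[OF fin sub]) simp
  then have s: "(\<Sum>v | \<alpha> v \<noteq> 0. \<alpha> v) = 1" using \<alpha>(3) by simp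
  then have "{v. \<alpha> v \<noteq> 0} \<noteq> {}" by (metis sum.empty zero_neq_one)
  then have "{v. \<alpha> v \<noteq> 0} \<in> Z" by (rule abs_complex_face[OF Z \<sigma> sub])
  then show "\<alpha> \<in> closed_simplex Z \<sigma>"
    using \<alpha>(1) s sub by (auto simp: closed_simplex_def realization_points_def)
qed

lemma closed_closed_simplex:
  assumes "abs_complex Z" "\<sigma> \<in> Z"
  shows "closed (closed_simplex Z \<sigma>)"
proof -
  have c: "continuous_on UNIV (\<lambda>\<alpha>::'a \<Rightarrow> real. \<alpha> v)" for v by simp
  have "closed {\<alpha>::'a \<Rightarrow> real. 0 \<le> \<alpha> v}" for v
    by (rule closed_Collect_le[OF continuous_on_const c])
  moreover have "closed {\<alpha>::'a \<Rightarrow> real. v \<notin> \<sigma> \<longrightarrow> \<alpha> v = 0}" for v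
    by (cases "v \<in> \<sigma>") (simp_all add: closed_Collect_eq[OF c continuous_on_const])
  moreover have "closed {\<alpha>::'a \<Rightarrow> real. sum \<alpha> \<sigma> = 1}"
    by (rule closed_Collect_eq[OF continuous_on_sum[OF c] continuous_on_const])
  ultimately show ?thesis
    unfolding closed_simplex_eq[OF assms]
    by (intro closed_Collect_conj closed_Collect_all)
qed

lemma compact_closed_simplex:
  assumes "abs_complex Z" "\<sigma> \<in> Z"
  shows "compact (closed_simplex Z \<sigma>)"
proof -
  let ?B = "PiE UNIV (\<lambda>v::'a. {0..1::real})"
  have "compactin (product_topology (\<lambda>i. euclidean) UNIV) ?B"
    unfolding compactin_PiE by simp
  then have "compact ?B"
    by (simp add: euclidean_product_topology)
  moreover have "closed_simplex Z \<sigma> \<subseteq> ?B"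
  proof
    fix \<alpha> assume "\<alpha> \<in> closed_simplex Z \<sigma>"
    then have \<alpha>: "\<And>v. 0 \<le> \<alpha> v" "\<And>v. v \<notin> \<sigma> \<Longrightarrow> \<alpha> v = 0" "sum \<alpha> \<sigma> = 1"
      unfolding closed_simplex_eq[OF assms] by auto
    have "\<alpha> v \<le> 1" for v
    proof (cases "v \<in> \<sigma>")
      case True
      then show ?thesis
        using member_le_sum[of v \<sigma> \<alpha>] \<alpha> abs_complex_finite[OF assms] by simp
    qed (use \<alpha> in simp)
    then show "\<alpha> \<in> ?B" using \<alpha>(1) by auto
  qed
  ultimately show ?thesis
    using compact_Int_closed[of ?B "closed_simplex Z \<sigma>"] closed_closed_simplex[OF assms]
    by (simp add: Int_absorb1)
qed

lemma openin_realization: "openin (realization Z) U \<longleftrightarrow> weak_open Z U"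
  unfolding realization_def by (simp add: istopology_weak_open topology_inverse')

lemma open_star: "open {\<alpha>::'v \<Rightarrow> real. 0 < \<alpha> v}"
  by (rule open_Collect_less) simp_all

text \<open>In a locally finite complex, an open star meets only finitely many closed simplices.\<close>

lemma realization_eq_top_of_set:
  assumes Z: "locally_finite_complex Z"
  shows "realization Z = top_of_set (realization_points Z)"
proof (rule topology_eq[THEN iffD2], intro allI iffI)
  have abs: "abs_complex Z" and lf: "\<And>v. finite {\<sigma> \<in> Z. v \<in> \<sigma>}"
    using Z by (auto simp: locally_finite_complex_def)
  let ?R = "realization_points Z"
  fix U assume "openin (realization Z) U"
  then have U: "U \<subseteq> ?R" "\<And>\<sigma>. \<sigma> \<in> Z \<Longrightarrow> openin (top_of_set (closed_simplex Z \<sigma>)) (U \<inter> closed_simplex Z \<sigma>)"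
    unfolding openin_realization weak_open_def by auto
  have cl: "closed (closed_simplex Z \<sigma> - U)" if "\<sigma> \<in> Z" for \<sigma>
  proof -
    have "closedin (top_of_set (closed_simplex Z \<sigma>)) (closed_simplex Z \<sigma> - U \<inter> closed_simplex Z \<sigma>)"
      by (rule closedin_diff[OF _ U(2)[OF that]]) simp
    then have "closed (closed_simplex Z \<sigma> - U \<inter> closed_simplex Z \<sigma>)"
      by (rule closedin_closed_trans[OF _ closed_closed_simplex[OF abs that]])
    moreover have "closed_simplex Z \<sigma> - U \<inter> closed_simplex Z \<sigma> = closed_simplex Z \<sigma> - U" by blast
    ultimately show ?thesis by simp
  qed
  \<comment> \<open>The open star of \<open>v\<close> without the finitely many closed sets
    \<open>closed_simplex Z \<sigma> - U\<close> with \<open>v\<close> in \<open>\<sigma>\<close>.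
    Within the realization it is the part of \<open>U\<close> in that star, since the support of a
    point of the star is one of these \<open>\<sigma>\<close>.\<close>
  define O' where "O' v = {\<alpha>. 0 < \<alpha> v} - (\<Union>\<sigma>\<in>{\<sigma> \<in> Z. v \<in> \<sigma>}. closed_simplex Z \<sigma> - U)" for v
  have op: "open (O' v)" for v
    unfolding O'_def using lf cl by (intro open_Diff open_star closed_UN) auto
  have "\<alpha> \<in> (\<Union>v. O' v)" if "\<alpha> \<in> U" for \<alpha>
  proof -
    have "\<alpha> \<in> ?R" using that U by blast
    then obtain v where "0 < \<alpha> v" by (rule realization_points_positive)
    then show ?thesis using that by (auto simp: O'_def)
  qed
  moreover have "\<alpha> \<in> U" if "\<alpha> \<in> ?R" "\<alpha> \<in> O' v" for \<alpha> v
  proof -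
    note \<alpha> = realization_pointsD[OF abs that(1)]
    have "v \<in> {v. \<alpha> v \<noteq> 0}" using that(2) by (simp add: O'_def)
    moreover have "\<alpha> \<in> closed_simplex Z {v. \<alpha> v \<noteq> 0}" using that(1) by (simp add: closed_simplex_def)
    ultimately show ?thesis using that(2) \<alpha>(2) unfolding O'_def by blast
  qed
  ultimately have "U = ?R \<inter> (\<Union>v. O' v)" using U(1) by blast
  then show "openin (top_of_set ?R) U"
    using open_UN[of UNIV O'] op unfolding openin_open by (intro exI[of _ "\<Union>v. O' v"] conjI) simp_all
next
  fix U assume "openin (top_of_set (realization_points Z)) U"
  then obtain O' where O': "open O'" "U = realization_points Z \<inter> O'"
    unfolding openin_open by blast
  have "U \<inter> closed_simplex Z \<sigma> = closed_simplex Z \<sigma> \<inter> O'" for \<sigma>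
    using O'(2) by (auto simp: closed_simplex_def)
  then show "openin (realization Z) U"
    unfolding openin_realization weak_open_def using O' by (auto simp: openin_open)
qed

text \<open>Open stars of vertices cover the realization. Together with
  \<open>finite_neighbours\<close> this confines the supports of the points of a compact set to a
  finite set of vertices.\<close>

lemma compact_meets_finitely_many_stars:
  assumes Z: "abs_complex Z" and C: "compact C" "C \<subseteq> realization_points Z"
  obtains V where "finite V" "\<And>\<alpha>. \<alpha> \<in> C \<Longrightarrow> \<exists>v\<in>V. \<alpha> v \<noteq> 0"
proof -
  have "C \<subseteq> \<Union>(range (\<lambda>v. {\<alpha>. 0 < \<alpha> v}))"
  proof
    fix \<alpha> assume "\<alpha> \<in> C"
    then have "\<alpha> \<in> realization_points Z" using C by blast
    then obtain v where "0 < \<alpha> v" by (rule realization_points_positive)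
    then show "\<alpha> \<in> \<Union>(range (\<lambda>v. {\<alpha>. 0 < \<alpha> v}))" by blast
  qed
  then obtain V where V: "finite V" "C \<subseteq> (\<Union>v\<in>V. {\<alpha>. 0 < \<alpha> v})"
    by (rule compactE_image[OF C(1) open_star])
  have "\<exists>v\<in>V. \<alpha> v \<noteq> 0" if "\<alpha> \<in> C" for \<alpha>
    using subsetD[OF V(2) that] by force
  with V(1) show ?thesis by (rule that)
qed

lemma finite_neighbours:
  assumes "locally_finite_complex Z" "finite V"
  shows "finite (\<Union>{\<sigma> \<in> Z. \<sigma> \<inter> V \<noteq> {}})"
proof -
  have "{\<sigma> \<in> Z. \<sigma> \<inter> V \<noteq> {}} = (\<Union>v\<in>V. {\<sigma> \<in> Z. v \<in> \<sigma>})" by blast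
  then have "finite {\<sigma> \<in> Z. \<sigma> \<inter> V \<noteq> {}}"
    using assms by (simp add: locally_finite_complex_def)
  moreover have "finite \<sigma>" if "\<sigma> \<in> {\<sigma> \<in> Z. \<sigma> \<inter> V \<noteq> {}}" for \<sigma>
    using that assms(1) abs_complex_finite unfolding locally_finite_complex_def by blast
  ultimately show ?thesis by (rule finite_Union)
qed

subsection \<open>Simplicial maps\<close>

text \<open>Coordinates are nonnegative, so the sums over the fibres of \<open>f\<close> cannot
  cancel.\<close>

lemma support_realization_map:
  assumes "\<And>v. 0 \<le> \<alpha> v" "finite {v. \<alpha> v \<noteq> 0}"
  shows "{w. realization_map f \<alpha> w \<noteq> 0} = f ` {v. \<alpha> v \<noteq> 0}"
proof -
  have "realization_map f \<alpha> w \<noteq> 0 \<longleftrightarrow> (\<exists>v. \<alpha> v \<noteq> 0 \<and> f v = w)" for w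
  proof -
    have "finite {v. \<alpha> v \<noteq> 0 \<and> f v = w}" by (rule finite_subset[OF _ assms(2)]) auto
    then show ?thesis
      unfolding realization_map_def using assms(1) by (subst sum_nonneg_eq_0_iff) auto
  qed
  then show ?thesis by auto
qed

lemma realization_map_point:
  assumes Z: "abs_complex Z" and \<alpha>: "\<alpha> \<in> realization_points Z"
    and f: "f ` {v. \<alpha> v \<noteq> 0} \<in> Z'"
  shows "realization_map f \<alpha> \<in> realization_points Z'"
proof -
  note \<alpha>D = realization_pointsD[OF Z \<alpha>]
  note supp = support_realization_map[of \<alpha> f, OF \<alpha>D(1,4)]
  have "(\<Sum>w\<in>f ` {v. \<alpha> v \<noteq> 0}. realization_map f \<alpha> w) = (\<Sum>v | \<alpha> v \<noteq> 0. \<alpha> v)"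
    using sum.image_gen[OF \<alpha>D(4), of \<alpha> f] by (simp add: realization_map_def)
  moreover have "0 \<le> realization_map f \<alpha> w" for w
    unfolding realization_map_def by (rule sum_nonneg) (rule \<alpha>D(1))
  ultimately show ?thesis
    unfolding realization_points_def using supp f \<alpha>D(3) by simp
qed

lemma realization_points_convex:
  assumes Z: "abs_complex Z" and \<tau>: "\<tau> \<in> Z"
    and \<alpha>: "\<alpha> \<in> closed_simplex Z \<tau>" and \<beta>: "\<beta> \<in> closed_simplex Z \<tau>" and t: "0 \<le> t" "t \<le> 1"
  shows "(\<lambda>v. (1 - t) * \<alpha> v + t * \<beta> v) \<in> realization_points Z"
proof -
  have "(\<lambda>v. (1 - t) * \<alpha> v + t * \<beta> v) \<in> closed_simplex Z \<tau>"
    using \<alpha> \<beta> t unfolding closed_simplex_eq[OF Z \<tau>]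
    by (auto simp: sum.distrib sum_distrib_left[symmetric])
  then show ?thesis by (simp add: closed_simplex_def)
qed

text \<open>The straight-line homotopy stays in the realization, since a point with support
  \<open>\<sigma>\<close> and its image lie in the simplex spanned by \<open>\<sigma>\<close> and
  its image under \<open>r\<close>. As \<open>V\<close> contains all supports along
  \<open>p\<close>, each coordinate of the image is a fixed finite sum of coordinates of
  \<open>p\<close>, hence continuous. The homotopy is free because \<open>r\<close> may move the
  base point.\<close>

lemma contiguous_homotopic_loops:
  fixes Z :: "'v set set" and p :: "real \<Rightarrow> 'v \<Rightarrow> real"
  assumes Z: "abs_complex Z" and p: "path p" "path_image p \<subseteq> realization_points Z" "pathfinish p = pathstart p"
    and V: "finite V" "\<And>x v. x \<in> {0..1} \<Longrightarrow> p x v \<noteq> 0 \<Longrightarrow> v \<in> V"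
    and r: "\<And>\<sigma>. \<sigma> \<in> Z \<Longrightarrow> \<sigma> \<subseteq> V \<Longrightarrow> \<sigma> \<union> r ` \<sigma> \<in> Z"
  shows "homotopic_loops (realization_points Z) p (realization_map r \<circ> p)"
  unfolding homotopic_loops
proof (intro exI conjI ballI)
  let ?I = "{0..1::real}"
  let ?h = "\<lambda>y v. (1 - fst y) * p (snd y) v + fst y * realization_map r (p (snd y)) v"
  have map_eq: "realization_map r (p x) w = (\<Sum>v | v \<in> V \<and> r v = w. p x v)" if "x \<in> ?I" for x w
    unfolding realization_map_def using V that
    by (intro sum.mono_neutral_left) auto
  have contp: "continuous_on (?I \<times> ?I) (\<lambda>y. p (snd y) v)" for v
  proof -
    have "continuous_on ?I (\<lambda>x. p x v)"
      using p(1) unfolding path_def by (rule continuous_on_product_then_coordinatewise)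
    then show ?thesis
      by (rule continuous_on_compose2[OF _ continuous_on_snd[OF continuous_on_id]]) auto
  qed
  have "continuous_on (?I \<times> ?I) (\<lambda>y. realization_map r (p (snd y)) w)" for w
    using continuous_on_sum[of "{v. v \<in> V \<and> r v = w}" "?I \<times> ?I" "\<lambda>v y. p (snd y) v", OF contp]
    by (rule continuous_on_eq) (auto simp: map_eq)
  then show "continuous_on (?I \<times> ?I) ?h"
    by (intro continuous_on_coordinatewise_then_product continuous_intros contp)
  show "?h \<in> ?I \<times> ?I \<rightarrow> realization_points Z"
  proof
    fix y assume y: "y \<in> ?I \<times> ?I"
    let ?\<alpha> = "p (snd y)"
    have \<alpha>: "?\<alpha> \<in> realization_points Z"
      using p(2) y by (auto simp: path_image_def)
    note D = realization_pointsD[OF Z \<alpha>]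
    let ?\<sigma> = "{v. ?\<alpha> v \<noteq> 0}"
    have \<tau>: "?\<sigma> \<union> r ` ?\<sigma> \<in> Z"
      using V(2) y by (intro r D(2)) auto
    have "r ` ?\<sigma> \<in> Z"
      by (rule abs_complex_face[OF Z \<tau>]) (use realization_points_positive[OF \<alpha>] in force)+
    then have "realization_map r ?\<alpha> \<in> closed_simplex Z (?\<sigma> \<union> r ` ?\<sigma>)"
      using realization_map_point[OF Z \<alpha>] support_realization_map[of ?\<alpha> r, OF D(1,4)]
      by (simp add: closed_simplex_def)
    moreover have "?\<alpha> \<in> closed_simplex Z (?\<sigma> \<union> r ` ?\<sigma>)"
      using \<alpha> by (simp add: closed_simplex_def)
    ultimately show "?h y \<in> realization_points Z"
      using y by (intro realization_points_convex[OF Z \<tau>]) auto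
  qed
  show "?h (0, x) = p x" for x by simp
  show "?h (1, x) = (realization_map r \<circ> p) x" for x by simp
  show "pathfinish (?h \<circ> Pair t) = pathstart (?h \<circ> Pair t)" for t
    using p(3) by (simp add: pathfinish_def pathstart_def)
qed

text \<open>Simple connectedness asks for a homotopy fixing the base point, the pushing argument
  yields a free one. In the square of the free homotopy, \<open>p\<close> on one side is deformed
  across to the other three sides. The far side is constant and the two lateral ones agree, so what
  remains is the track of the base point followed by its reverse.\<close>

lemma homotopic_loops_imp_homotopic_paths_const:
  fixes S :: "'a::topological_space set"
  assumes "homotopic_loops S p (\<lambda>_. a)"
  shows "homotopic_paths S p (\<lambda>_. p 0)"
proof -
  let ?I = "{0..1::real}"
  obtain h where conth: "continuous_on (?I \<times> ?I) h" and hS: "h \<in> ?I \<times> ?I \<rightarrow> S"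
    and h0: "\<And>x. x \<in> ?I \<Longrightarrow> h (0, x) = p x" and h1: "\<And>x. x \<in> ?I \<Longrightarrow> h (1, x) = a"
    and loop: "\<And>t. t \<in> ?I \<Longrightarrow> h (t, 1) = h (t, 0)"
    using assms unfolding homotopic_loops by (auto simp: pathfinish_def pathstart_def)
  \<comment> \<open>The point (\<open>\<tau> x\<close>, \<open>\<kappa> x\<close>) runs through the
    other three sides of the square, one in each third of the interval. The homotopy below joins it
    to (0, \<open>x\<close>) by a segment inside the convex square.\<close>
  define \<tau> :: "real \<Rightarrow> real" where "\<tau> x = min 1 (min (3 * x) (3 - 3 * x))" for x
  define \<kappa> :: "real \<Rightarrow> real" where "\<kappa> x = max 0 (min 1 (3 * x - 1))" for x
  have \<tau>: "\<tau> x \<in> ?I" and \<kappa>: "\<kappa> x \<in> ?I" if "x \<in> ?I" for x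
    using that by (auto simp: \<tau>_def \<kappa>_def)
  have ends: "\<tau> 0 = 0" "\<tau> 1 = 0" "\<kappa> 0 = 0" "\<kappa> 1 = 1" by (auto simp: \<tau>_def \<kappa>_def)
  have cont: "continuous_on A (\<lambda>y. \<tau> (snd y))" "continuous_on A (\<lambda>y. \<kappa> (snd y))" for A :: "(real \<times> real) set"
    unfolding \<tau>_def \<kappa>_def by (intro continuous_intros)+
  have conv: "(1 - s) * x + s * y \<in> ?I" if "s \<in> ?I" "x \<in> ?I" "y \<in> ?I" for s x y :: real
  proof -
    have "(1 - s) * x + s * y \<le> (1 - s) * 1 + s * 1"
      using that by (intro add_mono mult_left_mono) auto
    then show ?thesis using that by auto
  qed
  have mul: "s * x \<in> ?I" if "s \<in> ?I" "x \<in> ?I" for s x :: real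
    using that by (auto intro: mult_le_one)
  have p01: "p 1 = p 0" using loop[of 0] h0[of 0] h0[of 1] by simp
  have q: "h (\<tau> x, \<kappa> x) = h (\<tau> x, 0)" if x: "x \<in> ?I" for x
  proof -
    consider "x \<le> 1/3" | "2/3 \<le> x" | "1/3 < x" "x < 2/3" by linarith
    then show ?thesis
    proof cases
      case 1
      then have "\<kappa> x = 0" by (simp add: \<kappa>_def)
      then show ?thesis by simp
    next
      case 2
      then have "\<kappa> x = 1" by (simp add: \<kappa>_def)
      then show ?thesis using loop[OF \<tau>[OF x]] by simp
    next
      case 3
      then have "\<tau> x = 1" by (simp add: \<tau>_def)
      then show ?thesis using h1[OF \<kappa>[OF x]] h1[of 0] by simp
    qed
  qed
  have "homotopic_paths S p (\<lambda>x. h (\<tau> x, 0))"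
    unfolding homotopic_paths
  proof (intro exI conjI ballI)
    let ?H = "\<lambda>y. h (fst y * \<tau> (snd y), (1 - fst y) * snd y + fst y * \<kappa> (snd y))"
    have dom: "(fst y * \<tau> (snd y), (1 - fst y) * snd y + fst y * \<kappa> (snd y)) \<in> ?I \<times> ?I"
      if "y \<in> ?I \<times> ?I" for y
      using that mul conv \<tau> \<kappa> by (auto simp del: atLeastAtMost_iff)
    show "continuous_on (?I \<times> ?I) ?H"
      by (rule continuous_on_compose2[OF conth]) (intro continuous_intros cont, use dom in blast)
    show "?H \<in> ?I \<times> ?I \<rightarrow> S" using dom hS by blast
    show "?H (0, x) = p x" if "x \<in> ?I" for x using h0[OF that] by simp
    show "?H (1, x) = h (\<tau> x, 0)" if "x \<in> ?I" for x using q[OF that] by simp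
    show "pathstart (?H \<circ> Pair t) = pathstart p" if "t \<in> ?I" for t
      using h0[of 0] by (simp add: pathstart_def ends)
    show "pathfinish (?H \<circ> Pair t) = pathfinish p" if "t \<in> ?I" for t
      using h0[of 1] by (simp add: pathfinish_def ends)
  qed
  moreover have "homotopic_paths S (\<lambda>x. h (\<tau> x, 0)) (\<lambda>_. p 0)"
    unfolding homotopic_paths
  proof (intro exI conjI ballI)
    \<comment> \<open>Shrinking the first coordinate to 0 pulls the track of the base point back
      along itself to \<open>h (0, 0) = p 0\<close>.\<close>
    let ?H = "\<lambda>y. h ((1 - fst y) * \<tau> (snd y), 0)"
    have dom: "((1 - fst y) * \<tau> (snd y), 0) \<in> ?I \<times> ?I" if "y \<in> ?I \<times> ?I" for y
      using that mul[of "1 - fst y" "\<tau> (snd y)"] \<tau>[of "snd y"] by auto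
    show "continuous_on (?I \<times> ?I) ?H"
      by (rule continuous_on_compose2[OF conth]) (intro continuous_intros cont, use dom in blast)
    show "?H \<in> ?I \<times> ?I \<rightarrow> S" using dom hS by blast
    show "?H (0, x) = h (\<tau> x, 0)" for x by simp
    show "?H (1, x) = p 0" for x using h0[of 0] by simp
    show "pathstart (?H \<circ> Pair t) = pathstart (\<lambda>x. h (\<tau> x, 0))" for t
      by (simp add: pathstart_def ends)
    show "pathfinish (?H \<circ> Pair t) = pathfinish (\<lambda>x. h (\<tau> x, 0))" for t
      by (simp add: pathfinish_def ends)
  qed
  ultimately show ?thesis by (rule homotopic_paths_trans)
qed

text \<open>
  The vertices of maximal height are pushed down simultaneously; the resulting simplicial map is
  contiguous to the identity.
\<close>

lemma simply_connected_realization: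
  fixes Z :: "'v set set" and d :: "'v \<Rightarrow> nat"
  assumes Z: "locally_finite_complex Z"
    and base: "base \<in> \<Union>Z" "\<And>v. v \<in> \<Union>Z \<Longrightarrow> d v = 0 \<Longrightarrow> v = base"
    and \<rho>: "\<And>v. v \<in> \<Union>Z \<Longrightarrow> 0 < d v \<Longrightarrow> d (\<rho> v) < d v"
    and push: "\<And>\<sigma> n. \<sigma> \<in> Z \<Longrightarrow> 0 < n \<Longrightarrow> (\<And>v. v \<in> \<sigma> \<Longrightarrow> d v \<le> n) \<Longrightarrow>
      \<sigma> \<union> (\<lambda>v. if d v = n then \<rho> v else v) ` \<sigma> \<in> Z"
  shows "simply_connected_space (realization Z)"
proof -
  let ?R = "realization_points Z"
  have abs: "abs_complex Z" using Z by (simp add: locally_finite_complex_def)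
  have UZ: "v \<in> \<Union>Z" if "\<alpha> \<in> ?R" "\<alpha> v \<noteq> 0" for \<alpha> v
    using realization_pointsD(2)[OF abs that(1)] that(2) by blast
  define \<delta> where "\<delta> v = (if v = base then 1 else 0 :: real)" for v
  \<comment> \<open>Induction on a bound \<open>n\<close> for \<open>d\<close> on all supports along
    the loop. The finite set \<open>V\<close> is carried along for the contiguity lemma and is
    replaced by its image under \<open>r\<close> at each push.\<close>
  have null_n: "homotopic_loops ?R p (\<lambda>_. \<delta>)"
    if "path p" "path_image p \<subseteq> ?R" "pathfinish p = pathstart p"
      "finite V" "\<And>x v. x \<in> {0..1} \<Longrightarrow> p x v \<noteq> 0 \<Longrightarrow> v \<in> V \<and> d v \<le> n" for n p V
    using that
  proof (induction n arbitrary: p V)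
    case 0
    have "p x = \<delta>" if x: "x \<in> {0..1}" for x
    proof -
      have px: "p x \<in> ?R" using "0.prems"(2) x by (auto simp: path_image_def)
      note D = realization_pointsD[OF abs px]
      have "v = base" if "p x v \<noteq> 0" for v
        using base(2)[OF UZ[OF px that]] "0.prems"(5)[OF x that] by simp
      then have "{v. p x v \<noteq> 0} \<subseteq> {base}" by auto
      moreover have "{v. p x v \<noteq> 0} \<noteq> {}" using realization_points_positive[OF px] by force
      ultimately have s: "{v. p x v \<noteq> 0} = {base}" by blast
      then have "p x base = 1" using D(3) by simp
      then show ?thesis using s by (auto simp: \<delta>_def fun_eq_iff)
    qed
    then show ?case
      by (intro homotopic_loops_eq "0.prems") auto
  next
    case (Suc n)
    define r where "r v = (if d v = Suc n then \<rho> v else v)" for v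
    have step: "homotopic_loops ?R p (realization_map r \<circ> p)"
    proof (rule contiguous_homotopic_loops[OF abs Suc.prems(1-3), of "{v \<in> V. d v \<le> Suc n}"])
      show "\<sigma> \<union> r ` \<sigma> \<in> Z" if "\<sigma> \<in> Z" "\<sigma> \<subseteq> {v \<in> V. d v \<le> Suc n}" for \<sigma>
        using push[OF that(1), of "Suc n"] that(2) unfolding r_def by blast
    qed (use Suc.prems in auto)
    have "homotopic_loops ?R (realization_map r \<circ> p) (\<lambda>_. \<delta>)"
    proof (rule Suc.IH[of _ "r ` V"])
      show "path (realization_map r \<circ> p)" using homotopic_loops_imp_path[OF step] by simp
      show "path_image (realization_map r \<circ> p) \<subseteq> ?R" using homotopic_loops_imp_subset[OF step] by simp
      show "pathfinish (realization_map r \<circ> p) = pathstart (realization_map r \<circ> p)"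
        using homotopic_loops_imp_loop[OF step] by simp
      show "finite (r ` V)" using Suc.prems(4) by simp
      fix x w assume x: "x \<in> {0..1::real}" and w: "(realization_map r \<circ> p) x w \<noteq> 0"
      have px: "p x \<in> ?R" using Suc.prems(2) x by (auto simp: path_image_def)
      note D = realization_pointsD[OF abs px]
      have "w \<in> {w. realization_map r (p x) w \<noteq> 0}" using w by simp
      then have "w \<in> r ` {v. p x v \<noteq> 0}"
        by (simp only: support_realization_map[of "p x" r, OF D(1,4)])
      then obtain v where v: "p x v \<noteq> 0" "w = r v" by blast
      then have "v \<in> V" "d v \<le> Suc n" using Suc.prems(5)[OF x] by auto
      moreover have "d (\<rho> v) \<le> n" if "d v = Suc n" using \<rho>[OF UZ[OF px v(1)]] that by simp
      ultimately show "w \<in> r ` V \<and> d w \<le> n" using v(2) by (auto simp: r_def)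
    qed
    then show ?case by (rule homotopic_loops_trans[OF step])
  qed
  have null: "homotopic_loops ?R p (\<lambda>_. \<delta>)"
    if p: "path p" "path_image p \<subseteq> ?R" "pathfinish p = pathstart p" for p
  proof -
    obtain V where V: "finite V" "\<And>\<alpha>. \<alpha> \<in> path_image p \<Longrightarrow> \<exists>v\<in>V. \<alpha> v \<noteq> 0"
      using compact_meets_finitely_many_stars[OF abs compact_path_image[OF p(1)] p(2)] by blast
    \<comment> \<open>A simplex supporting a point of the loop meets \<open>V\<close>, so its
      vertices lie in the finite set \<open>N\<close>, on which \<open>d\<close> is bounded.\<close>
    define N where "N = \<Union>{\<sigma> \<in> Z. \<sigma> \<inter> V \<noteq> {}}"
    have N: "finite N" unfolding N_def by (rule finite_neighbours[OF Z V(1)])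
    have "v \<in> N \<and> d v \<le> Max (d ` N)" if x: "x \<in> {0..1}" and v: "p x v \<noteq> 0" for x v
    proof -
      have px: "p x \<in> path_image p" using x by (simp add: path_image_def)
      then have "p x \<in> ?R" using p(2) by blast
      then have "{v. p x v \<noteq> 0} \<in> Z" by (rule realization_pointsD(2)[OF abs])
      moreover have "{v. p x v \<noteq> 0} \<inter> V \<noteq> {}" using V(2)[OF px] by blast
      ultimately have "v \<in> N" unfolding N_def using v by blast
      then show ?thesis using N by simp
    qed
    then show ?thesis by (rule null_n[OF p N])
  qed
  have real: "realization Z = top_of_set ?R" by (rule realization_eq_top_of_set[OF Z])
  have "{base} \<in> Z"
  proof -
    obtain \<sigma> where "\<sigma> \<in> Z" "base \<in> \<sigma>" using base(1) by blast
    then show ?thesis by (intro abs_complex_face[OF abs \<open>\<sigma> \<in> Z\<close>]) auto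
  qed
  moreover have "{v. \<delta> v \<noteq> 0} = {base}" by (auto simp: \<delta>_def)
  ultimately have \<delta>R: "\<delta> \<in> ?R" by (auto simp: realization_points_def \<delta>_def)
  \<comment> \<open>Connectedness comes from the same statement: a free homotopy between constant
    loops traces a path between their values.\<close>
  have "path_component ?R \<alpha> \<delta>" if "\<alpha> \<in> ?R" for \<alpha>
  proof -
    have "homotopic_loops ?R (\<lambda>_. \<alpha>) (\<lambda>_. \<delta>)"
      by (rule null) (use that in \<open>auto simp: path_def path_image_def pathfinish_def pathstart_def\<close>)
    then show ?thesis using homotopic_loops_imp_path_component_value[of ?R _ _ 0] by simp
  qed
  then have "path_connected ?R"
    unfolding path_connected_component using path_component_sym path_component_trans by meson
  moreover have "homotopic_with (\<lambda>r. r 0 = p 0 \<and> r 1 = p 0) (top_of_set {0..1}) (top_of_set ?R) p (\<lambda>_. p 0)"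
    if p: "pathin (top_of_set ?R) p" "p 1 = p 0" for p
  proof -
    have "path p" "path_image p \<subseteq> ?R" "pathfinish p = pathstart p"
      using p by (auto simp: pathin_canon_iff path_image_def pathfinish_def pathstart_def)
    from homotopic_loops_imp_homotopic_paths_const[OF null[OF this]]
    show ?thesis
      unfolding homotopic_paths_def pathfinish_def pathstart_def using p(2) by simp
  qed
  ultimately show ?thesis
    unfolding simply_connected_space_def real using \<delta>R
    by (auto simp: path_connected_space_def path_connected_def pathin_canon_iff path_image_def
        pathstart_def pathfinish_def image_subset_iff_funcset)
qed

section \<open>The quotient complex\<close>

text \<open>\<open>R\<close> is reflexive, so a walk may stand still, whereas consecutive vertices
  of an \<open>edge_path\<close> differ. Omitting the stationary steps only shortens the
  walk.\<close>

lemma skeleton_dist_relpow: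
  assumes refl: "\<And>x. x \<in> V \<Longrightarrow> R x x" and sym: "\<And>x y. R x y \<Longrightarrow> R y x"
    and R: "\<And>x y. R x y \<Longrightarrow> y \<in> V"
    and xy: "(x, y) \<in> {(x, y). R x y} ^^ m" and x: "x \<in> V"
  shows "skeleton_dist (clique_complex V R) x y \<le> enat m"
proof -
  let ?X = "clique_complex V R"
  note pair = pair_in_clique_complex[of V R, OF refl sym]
  have "\<exists>p. edge_path ?X p \<and> hd p = x \<and> last p = y \<and> length p \<le> Suc m"
    using xy
  proof (induction m arbitrary: y)
    case 0
    then show ?case
      using x by (intro exI[of _ "[x]"]) (simp add: edge_path_def Union_clique_complex refl)
  next
    case (Suc m)
    then obtain z where z: "(x, z) \<in> {(x, y). R x y} ^^ m" "R z y" by auto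
    obtain p where p: "edge_path ?X p" "hd p = x" "last p = z" "length p \<le> Suc m"
      using Suc.IH[OF z(1)] by blast
    show ?case
    proof (cases "z = y")
      case True
      then show ?thesis using p by (intro exI[of _ p]) simp
    next
      case False
      have ne: "p \<noteq> []" and pV: "set p \<subseteq> \<Union>?X"
        and pe: "\<And>i. Suc i < length p \<Longrightarrow> p ! i \<noteq> p ! Suc i \<and> {p ! i, p ! Suc i} \<in> ?X"
        using p(1) unfolding edge_path_def by blast+
      have zV: "z \<in> V" using R[OF sym[OF z(2)]] .
      have "edge_path ?X (p @ [y])"
        unfolding edge_path_def
      proof (intro conjI allI impI)
        show "p @ [y] \<noteq> []" by simp
        show "set (p @ [y]) \<subseteq> \<Union>?X"
          using pV R[OF z(2)] by (simp add: Union_clique_complex refl)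
        fix i assume "Suc i < length (p @ [y])"
        then consider "Suc i < length p" | "Suc i = length p" by fastforce
        then have "(p @ [y]) ! i \<noteq> (p @ [y]) ! Suc i \<and> {(p @ [y]) ! i, (p @ [y]) ! Suc i} \<in> ?X"
        proof cases
          case 1
          then show ?thesis using pe[OF 1] by (simp add: nth_append)
        next
          case 2
          then have "(p @ [y]) ! i = z" "(p @ [y]) ! Suc i = y"
            using p(3) ne by (auto simp: nth_append last_conv_nth simp flip: 2)
          then show ?thesis using False pair[of z y] zV R[OF z(2)] z(2) by simp
        qed
        then show "(p @ [y]) ! i \<noteq> (p @ [y]) ! Suc i" "{(p @ [y]) ! i, (p @ [y]) ! Suc i} \<in> ?X"
          by simp_all
      qed
      then show ?thesis using p ne by (intro exI[of _ "p @ [y]"]) simp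
    qed
  qed
  then obtain p where p: "edge_path ?X p \<and> hd p = x \<and> last p = y" "length p \<le> Suc m" by blast
  have "skeleton_dist ?X x y \<le> enat (length p - 1)"
    unfolding skeleton_dist_def by (rule INF_lower) (use p(1) in simp)
  also have "\<dots> \<le> enat m" using p(2) by simp
  finally show ?thesis .
qed

context nerve begin

interpretation group "racg X" by (rule group_racg)

abbreviation adj_rel :: "('v list set \<times> 'v list set) set" where
  "adj_rel \<equiv> {(x, y). adjacent x y}"

lemma Union_thickening_davis: "\<Union>(thickening (davis_cubes X)) = carrier (racg X)"
  unfolding thickening_davis by (rule Union_clique_complex) (rule adjacent_refl)

lemma displacement_trivial:
  assumes disp: "min_displacement_ge k X H" and h: "h \<in> H" and x: "x \<in> carrier (racg X)"
    and path: "(x, h \<otimes>\<^bsub>racg X\<^esub> x) \<in> adj_rel ^^ m" and m: "m < k"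
  shows "h = \<one>\<^bsub>racg X\<^esub>"
proof (rule ccontr)
  assume "h \<noteq> \<one>\<^bsub>racg X\<^esub>"
  then have "enat k \<le> skeleton_dist (thickening (davis_cubes X)) x (h \<otimes>\<^bsub>racg X\<^esub> x)"
    using disp h x unfolding min_displacement_ge_def Union_thickening_davis by blast
  also have "\<dots> \<le> enat m"
    unfolding thickening_davis
    by (rule skeleton_dist_relpow[OF adjacent_refl adjacent_sym _ path x])
      (use adjacent_closed in blast)+
  finally show False using m by simp
qed

section \<open>Cosets and the lifting of adjacency\<close>

lemma r_coset_eq_iff:
  assumes H: "subgroup H (racg X)" and x: "x \<in> carrier (racg X)" and y: "y \<in> carrier (racg X)"
  shows "H #>\<^bsub>racg X\<^esub> x = H #>\<^bsub>racg X\<^esub> y \<longleftrightarrow> (\<exists>h\<in>H. y = h \<otimes>\<^bsub>racg X\<^esub> x)"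
proof
  assume "H #>\<^bsub>racg X\<^esub> x = H #>\<^bsub>racg X\<^esub> y"
  then have "y \<in> H #>\<^bsub>racg X\<^esub> x" using rcos_self[OF y H] by simp
  then show "\<exists>h\<in>H. y = h \<otimes>\<^bsub>racg X\<^esub> x" unfolding r_coset_def by blast
next
  assume "\<exists>h\<in>H. y = h \<otimes>\<^bsub>racg X\<^esub> x"
  then have "y \<in> H #>\<^bsub>racg X\<^esub> x" unfolding r_coset_def by blast
  then show "H #>\<^bsub>racg X\<^esub> x = H #>\<^bsub>racg X\<^esub> y" by (rule repr_independence[OF _ x H])
qed

definition quotient_adjacent ::
  "'v list set set \<Rightarrow> 'v list set set \<Rightarrow> 'v list set set \<Rightarrow> bool" where
  "quotient_adjacent H a b \<longleftrightarrow>
     (\<exists>x y. adjacent x y \<and> a = H #>\<^bsub>racg X\<^esub> x \<and> b = H #>\<^bsub>racg X\<^esub> y)"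

lemma quotient_adjacent_sym: "quotient_adjacent H a b \<Longrightarrow> quotient_adjacent H b a"
  unfolding quotient_adjacent_def using adjacent_sym by blast

lemma quotient_adjacent_refl:
  "a \<in> rcosets\<^bsub>racg X\<^esub> H \<Longrightarrow> quotient_adjacent H a a"
  unfolding quotient_adjacent_def RCOSETS_def using adjacent_refl by blast

text \<open>Left multiplication by elements of \<open>H\<close> preserves adjacency, so an edge of
  the quotient can be lifted from any prescribed representative of its first end.\<close>

lemma quotient_adjacent_lift:
  assumes H: "subgroup H (racg X)" and x: "x \<in> carrier (racg X)" and y: "y \<in> carrier (racg X)"
    and adj: "quotient_adjacent H (H #>\<^bsub>racg X\<^esub> x) (H #>\<^bsub>racg X\<^esub> y)"
  obtains h where "h \<in> H" "adjacent x (h \<otimes>\<^bsub>racg X\<^esub> y)"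
proof -
  obtain x' y' where xy': "adjacent x' y'" "H #>\<^bsub>racg X\<^esub> x = H #>\<^bsub>racg X\<^esub> x'" "H #>\<^bsub>racg X\<^esub> y = H #>\<^bsub>racg X\<^esub> y'"
    using adj unfolding quotient_adjacent_def by blast
  have W: "x' \<in> carrier (racg X)" "y' \<in> carrier (racg X)" using adjacent_closed[OF xy'(1)] by auto
  obtain g where g: "g \<in> H" "x' = g \<otimes>\<^bsub>racg X\<^esub> x" using xy'(2) r_coset_eq_iff[OF H x W(1)] by blast
  obtain h where h: "h \<in> H" "y' = h \<otimes>\<^bsub>racg X\<^esub> y" using xy'(3) r_coset_eq_iff[OF H y W(2)] by blast
  have gh: "g \<in> carrier (racg X)" "h \<in> carrier (racg X)"
    using g(1) h(1) subgroup.mem_carrier[OF H] by auto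
  have "adjacent (inv\<^bsub>racg X\<^esub> g \<otimes>\<^bsub>racg X\<^esub> x') (inv\<^bsub>racg X\<^esub> g \<otimes>\<^bsub>racg X\<^esub> y')"
    using adjacent_mult_left[OF _ xy'(1)] gh by simp
  moreover have "inv\<^bsub>racg X\<^esub> g \<otimes>\<^bsub>racg X\<^esub> x' = x"
    unfolding g(2) using gh x by (simp add: m_assoc[symmetric])
  moreover have "inv\<^bsub>racg X\<^esub> g \<otimes>\<^bsub>racg X\<^esub> y' = (inv\<^bsub>racg X\<^esub> g \<otimes>\<^bsub>racg X\<^esub> h) \<otimes>\<^bsub>racg X\<^esub> y"
    unfolding h(2) using gh y by (simp add: m_assoc)
  moreover have "inv\<^bsub>racg X\<^esub> g \<otimes>\<^bsub>racg X\<^esub> h \<in> H"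
    using g(1) h(1) H by (simp add: subgroup.m_closed subgroup.m_inv_closed)
  ultimately show ?thesis using that by metis
qed

text \<open>A clique of the quotient is lifted around one vertex \<open>x0\<close>. Two of the lifts
  are adjacent after translating one of them by some \<open>h\<close>, and the detour through
  \<open>x0\<close> shows that \<open>h\<close> moves a vertex by at most 3. Hence \<open>h\<close>
  is 1, and the lifts form a clique, which lies in a cube.\<close>

lemma thickening_quotient:
  assumes H: "subgroup H (racg X)" and disp: "min_displacement_ge k X H" and k: "4 \<le> k"
  shows "thickening (quotient_cubes X H) = clique_complex (rcosets\<^bsub>racg X\<^esub> H) (quotient_adjacent H)"
proof (rule subset_antisym; rule subsetI)
  let ?q = "\<lambda>x. H #>\<^bsub>racg X\<^esub> x"
  fix \<sigma> assume "\<sigma> \<in> thickening (quotient_cubes X H)"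
  then obtain C where C: "finite \<sigma>" "\<sigma> \<noteq> {}" "C \<in> davis_cubes X" "\<sigma> \<subseteq> ?q ` C"
    unfolding thickening_def quotient_cubes_def quotient_cell_def by blast
  have "quotient_adjacent H a b" if ab: "a \<in> \<sigma>" "b \<in> \<sigma>" for a b
  proof -
    obtain x y where "x \<in> C" "y \<in> C" "a = ?q x" "b = ?q y" using ab C(4) by blast
    then show ?thesis
      unfolding quotient_adjacent_def using davis_cube_adjacent[OF C(3)] by blast
  qed
  moreover have "\<sigma> \<subseteq> rcosets\<^bsub>racg X\<^esub> H"
  proof
    fix a assume "a \<in> \<sigma>"
    then obtain x where "x \<in> C" "a = ?q x" using C(4) by blast
    then show "a \<in> rcosets\<^bsub>racg X\<^esub> H"
      unfolding RCOSETS_def using adjacent_closed[OF davis_cube_adjacent[OF C(3)]] by blast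
  qed
  ultimately show "\<sigma> \<in> clique_complex (rcosets\<^bsub>racg X\<^esub> H) (quotient_adjacent H)"
    using C(1,2) unfolding clique_complex_def by blast
next
  let ?q = "\<lambda>x. H #>\<^bsub>racg X\<^esub> x"
  fix \<sigma> assume "\<sigma> \<in> clique_complex (rcosets\<^bsub>racg X\<^esub> H) (quotient_adjacent H)"
  then have \<sigma>: "finite \<sigma>" "\<sigma> \<noteq> {}" "\<sigma> \<subseteq> rcosets\<^bsub>racg X\<^esub> H"
    and adj: "\<And>a b. a \<in> \<sigma> \<Longrightarrow> b \<in> \<sigma> \<Longrightarrow> quotient_adjacent H a b"
    unfolding clique_complex_def by blast+
  have rep: "\<exists>x\<in>carrier (racg X). a = ?q x" if "a \<in> \<sigma>" for a
    using \<sigma>(3) that unfolding RCOSETS_def by blast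
  obtain a0 x0 where a0: "a0 \<in> \<sigma>" "x0 \<in> carrier (racg X)" "a0 = ?q x0" using \<sigma>(2) rep by blast
  have "\<exists>y. adjacent x0 y \<and> a = ?q y" if a: "a \<in> \<sigma>" for a
  proof -
    obtain y where y: "y \<in> carrier (racg X)" "a = ?q y" using rep[OF a] by blast
    have "quotient_adjacent H (?q x0) (?q y)" using adj[OF a0(1) a] a0(3) y(2) by simp
    then obtain h where h: "h \<in> H" "adjacent x0 (h \<otimes>\<^bsub>racg X\<^esub> y)"
      by (rule quotient_adjacent_lift[OF H a0(2) y(1)])
    have "h \<otimes>\<^bsub>racg X\<^esub> y \<in> carrier (racg X)" using adjacent_closed[OF h(2)] by simp
    then have "?q (h \<otimes>\<^bsub>racg X\<^esub> y) = a"
      using r_coset_eq_iff[OF H y(1)] h(1) y(2) by blast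
    then show ?thesis using h(2) by blast
  qed
  then obtain f where f: "\<And>a. a \<in> \<sigma> \<Longrightarrow> adjacent x0 (f a)" "\<And>a. a \<in> \<sigma> \<Longrightarrow> a = ?q (f a)"
    by metis
  have "adjacent (f a) (f b)" if ab: "a \<in> \<sigma>" "b \<in> \<sigma>" for a b
  proof -
    have W: "f a \<in> carrier (racg X)" "f b \<in> carrier (racg X)"
      using adjacent_closed f(1) ab by blast+
    have "quotient_adjacent H (?q (f a)) (?q (f b))" using adj[OF ab] f(2) ab by metis
    then obtain h where h: "h \<in> H" "adjacent (f a) (h \<otimes>\<^bsub>racg X\<^esub> f b)"
      by (rule quotient_adjacent_lift[OF H W])
    \<comment> \<open>The walk passes through \<open>f b\<close>, \<open>x0\<close>,
      \<open>f a\<close> and \<open>h\<close> times \<open>f b\<close>; its length 3 accounts for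
      the assumption \<open>4 \<le> k\<close>.\<close>
    have "(f b, h \<otimes>\<^bsub>racg X\<^esub> f b) \<in> adj_rel ^^ Suc (Suc (Suc 0))"
      using relpow_Suc_I[OF relpow_Suc_I[OF relpow_Suc_I[OF relpow_0_I]], of "f b" x0 adj_rel "f a" "h \<otimes>\<^bsub>racg X\<^esub> f b"]
        adjacent_sym[OF f(1)[OF ab(2)]] f(1)[OF ab(1)] h(2) by simp
    then have "h = \<one>\<^bsub>racg X\<^esub>"
      by (rule displacement_trivial[OF disp h(1) W(2)]) (use k in simp)
    then show ?thesis using h(2) W(2) by simp
  qed
  then have "\<exists>C\<in>davis_cubes X. f ` \<sigma> \<subseteq> C"
    using \<sigma>(1,2) by (intro adjacent_clique_in_cube) auto
  then obtain C where C: "C \<in> davis_cubes X" "f ` \<sigma> \<subseteq> C" by blast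
  have "\<sigma> \<subseteq> ?q ` C" using f(2) C(2) by blast
  then show "\<sigma> \<in> thickening (quotient_cubes X H)"
    unfolding thickening_def quotient_cubes_def quotient_cell_def using \<sigma>(1,2) C(1) by blast
qed

text \<open>The cycle is lifted edge by edge, and its closing edge leads to a translate of the first
  vertex by some \<open>h\<close>. This walk has length \<open>j < k\<close>, so \<open>h\<close> is
  1 and the lift closes up. The lift is induced because both equality and adjacency of lifts descend
  to the quotient.\<close>

lemma no_short_cycle_quotient:
  assumes H: "subgroup H (racg X)" and disp: "min_displacement_ge k X H"
    and short: "no_short_cycle k (carrier (racg X)) adjacent"
  shows "no_short_cycle k (rcosets\<^bsub>racg X\<^esub> H) (quotient_adjacent H)"
  unfolding no_short_cycle_def
proof (intro allI impI notI)
  let ?q = "\<lambda>x. H #>\<^bsub>racg X\<^esub> x"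
  fix j c assume j: "4 \<le> j \<and> j < k" and c: "induced_cycle (rcosets\<^bsub>racg X\<^esub> H) (quotient_adjacent H) j c"
  have cV: "c i \<in> rcosets\<^bsub>racg X\<^esub> H" if "i < j" for i
    using c that unfolding induced_cycle_def by blast
  have inj: "inj_on c {..<j}" using c unfolding induced_cycle_def by blast
  have adj: "quotient_adjacent H (c i) (c m) = (m = Suc i \<or> (i = 0 \<and> Suc m = j))"
    if "i < m" "m < j" for i m
    using c that unfolding induced_cycle_def by blast
  have rep: "\<exists>x\<in>carrier (racg X). c i = ?q x" if "i < j" for i
    using cV[OF that] unfolding RCOSETS_def by blast
  have "\<exists>w. (\<forall>i\<le>n. w i \<in> carrier (racg X) \<and> c i = ?q (w i)) \<and> (\<forall>i<n. adjacent (w i) (w (Suc i)))"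
    if "n < j" for n
    using that
  proof (induction n)
    case 0
    then obtain x where "x \<in> carrier (racg X)" "c 0 = ?q x" using rep by blast
    then show ?case by (intro exI[of _ "\<lambda>_. x"]) simp
  next
    case (Suc n)
    then obtain w where w: "\<And>i. i \<le> n \<Longrightarrow> w i \<in> carrier (racg X) \<and> c i = ?q (w i)"
      "\<And>i. i < n \<Longrightarrow> adjacent (w i) (w (Suc i))" by auto
    obtain y where y: "y \<in> carrier (racg X)" "c (Suc n) = ?q y" using rep[OF Suc.prems] by blast
    have wn: "w n \<in> carrier (racg X)" "c n = ?q (w n)" using w(1)[of n] by auto
    have "quotient_adjacent H (?q (w n)) (?q y)"
      using adj[of n "Suc n"] Suc.prems wn(2) y(2) by simp
    then obtain h where h: "h \<in> H" "adjacent (w n) (h \<otimes>\<^bsub>racg X\<^esub> y)"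
      by (rule quotient_adjacent_lift[OF H wn(1) y(1)])
    have hy: "h \<otimes>\<^bsub>racg X\<^esub> y \<in> carrier (racg X)" using adjacent_closed[OF h(2)] by simp
    then have "?q (h \<otimes>\<^bsub>racg X\<^esub> y) = c (Suc n)"
      using r_coset_eq_iff[OF H y(1)] h(1) y(2) by blast
    then show ?case
      using w h(2) hy by (intro exI[of _ "w(Suc n := h \<otimes>\<^bsub>racg X\<^esub> y)"]) (auto simp: le_Suc_eq less_Suc_eq)
  qed
  from this[of "j - 1"] j obtain w where
    w: "\<And>i. i \<le> j - 1 \<Longrightarrow> w i \<in> carrier (racg X) \<and> c i = ?q (w i)"
    and wadj: "\<And>i. i < j - 1 \<Longrightarrow> adjacent (w i) (w (Suc i))" by auto
  have wW: "w i \<in> carrier (racg X)" and wc: "c i = ?q (w i)" if "i < j" for i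
    using w[of i] that by auto
  have path: "(w 0, w n) \<in> adj_rel ^^ n" if "n < j" for n
    using that
  proof (induction n)
    case (Suc n)
    then show ?case using wadj[of n] by (intro relpow_Suc_I[of _ "w n"]) auto
  qed simp
  have last: "j - 1 < j" "0 < j" using j by auto
  have "quotient_adjacent H (c (j - 1)) (c 0)"
    by (rule quotient_adjacent_sym) (use adj[of 0 "j - 1"] j in auto)
  then have "quotient_adjacent H (?q (w (j - 1))) (?q (w 0))"
    using wc[OF last(1)] wc[OF last(2)] by simp
  then obtain h where h: "h \<in> H" "adjacent (w (j - 1)) (h \<otimes>\<^bsub>racg X\<^esub> w 0)"
    by (rule quotient_adjacent_lift[OF H wW[OF last(1)] wW[OF last(2)]])
  have "(w 0, h \<otimes>\<^bsub>racg X\<^esub> w 0) \<in> adj_rel ^^ Suc (j - 1)"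
    using path[OF last(1)] h(2) by (intro relpow_Suc_I) auto
  then have "h = \<one>\<^bsub>racg X\<^esub>"
    by (rule displacement_trivial[OF disp h(1) wW[OF last(2)]]) (use j in simp)
  then have close: "adjacent (w (j - 1)) (w 0)" using h(2) wW[OF last(2)] by simp
  have "induced_cycle (carrier (racg X)) adjacent j w"
    unfolding induced_cycle_def
  proof (intro conjI allI impI)
    show "w ` {..<j} \<subseteq> carrier (racg X)" using wW by auto
    show "inj_on w {..<j}"
      by (rule inj_onI) (use inj_onD[OF inj] wc in auto)
    fix i m assume im: "i < m \<and> m < j"
    show "adjacent (w i) (w m) = (m = Suc i \<or> i = 0 \<and> Suc m = j)"
    proof
      assume "adjacent (w i) (w m)"
      then have "quotient_adjacent H (c i) (c m)"
        unfolding quotient_adjacent_def using wc im by (metis order_less_trans)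
      then show "m = Suc i \<or> i = 0 \<and> Suc m = j" using adj im by simp
    next
      assume "m = Suc i \<or> i = 0 \<and> Suc m = j"
      then show "adjacent (w i) (w m)"
      proof
        assume "m = Suc i"
        then show ?thesis using wadj[of i] im by auto
      next
        assume "i = 0 \<and> Suc m = j"
        then show ?thesis using adjacent_sym[OF close] by auto
      qed
    qed
  qed
  then show False using short j by (auto simp: no_short_cycle_def)
qed

end

lemma k_large_basic_step:
  assumes k: "4 \<le> k" and step: "basic_step X H X'" and X: "k_large k X" and disp: "min_displacement_ge k X H"
  shows "k_large k X'"
proof -
  interpret nerve X
    using step X by unfold_locales (auto simp: basic_step_def k_large_def)
  have H: "subgroup H (racg X)" using step by (simp add: basic_step_def)
  have "no_short_cycle k (rcosets\<^bsub>racg X\<^esub> H) (quotient_adjacent H)"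
    by (rule no_short_cycle_quotient[OF H disp k_large_davis[OF X]])
  then have "k_large k (thickening (quotient_cubes X H))"
    unfolding thickening_quotient[OF H disp k]
    by (subst k_large_clique_complex[OF quotient_adjacent_refl quotient_adjacent_sym])
  then show ?thesis
    using k_large_complex_iso step unfolding basic_step_def by blast
qed

section \<open>The action on the thickening\<close>

text \<open>With \<open>realization_map_id\<close> it lets translations be undone on points of the
  realization, as the proof of cocompactness requires.\<close>

lemma realization_map_comp:
  assumes "\<And>v. 0 \<le> \<alpha> v" "finite {v. \<alpha> v \<noteq> 0}"
  shows "realization_map f (realization_map g \<alpha>) = realization_map (f \<circ> g) \<alpha>"
proof
  fix w
  let ?S = "{v. \<alpha> v \<noteq> 0}"
  let ?T = "{v. \<alpha> v \<noteq> 0 \<and> f (g v) = w}"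
  have fin: "finite ?T" by (rule finite_subset[OF _ assms(2)]) auto
  have "{u. realization_map g \<alpha> u \<noteq> 0 \<and> f u = w} = g ` ?T"
    using support_realization_map[of \<alpha> g, OF assms] by (auto simp: set_eq_iff)
  then have "realization_map f (realization_map g \<alpha>) w = (\<Sum>u\<in>g ` ?T. realization_map g \<alpha> u)"
    by (simp add: realization_map_def)
  also have "\<dots> = (\<Sum>u\<in>g ` ?T. \<Sum>v | v \<in> ?T \<and> g v = u. \<alpha> v)"
  proof (rule sum.cong[OF refl])
    fix u assume "u \<in> g ` ?T"
    then have "f u = w" by auto
    then have "{v. \<alpha> v \<noteq> 0 \<and> g v = u} = {v. v \<in> ?T \<and> g v = u}" by auto
    then show "realization_map g \<alpha> u = (\<Sum>v | v \<in> ?T \<and> g v = u. \<alpha> v)"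
      by (simp add: realization_map_def)
  qed
  also have "\<dots> = sum \<alpha> ?T"
    by (rule sum.image_gen[OF fin, symmetric])
  finally show "realization_map f (realization_map g \<alpha>) w = realization_map (f \<circ> g) \<alpha> w"
    by (simp add: realization_map_def)
qed

lemma realization_map_id:
  assumes "\<And>v. \<alpha> v \<noteq> 0 \<Longrightarrow> f v = v"
  shows "realization_map f \<alpha> = \<alpha>"
proof
  fix w
  have "{v. \<alpha> v \<noteq> 0 \<and> f v = w} = (if \<alpha> w = 0 then {} else {w})"
    using assms by auto
  then show "realization_map f \<alpha> w = \<alpha> w"
    by (simp add: realization_map_def)
qed

context nerve begin

interpretation group "racg X" by (rule group_racg)

section \<open>A copy of the thickening on the natural numbers\<close>

lemma countable_racg: "countable (carrier (racg X))"
  unfolding carrier_racg using countable_finite[OF finite_vertices] by (intro countable_image countable_lists)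

definition code :: "'v list set \<Rightarrow> nat" where
  "code = to_nat_on (carrier (racg X))"

definition decode :: "nat \<Rightarrow> 'v list set" where
  "decode = inv_into (carrier (racg X)) code"

definition coded_thickening :: "nat set set" where
  "coded_thickening = (\<lambda>\<sigma>. code ` \<sigma>) ` clique_complex (carrier (racg X)) adjacent"

text \<open>Restricted to the vertices because a \<open>group_action\<close> takes values in
  \<open>Bij\<close>, whose elements are extensional functions.\<close>

definition coded_action :: "'v list set \<Rightarrow> nat \<Rightarrow> nat" where
  "coded_action g = (\<lambda>v\<in>code ` carrier (racg X). code (g \<otimes>\<^bsub>racg X\<^esub> decode v))"

lemma inj_code: "inj_on code (carrier (racg X))"
  unfolding code_def by (rule inj_on_to_nat_on[OF countable_racg])

lemma decode_code [simp]: "x \<in> carrier (racg X) \<Longrightarrow> decode (code x) = x"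
  unfolding decode_def by (rule inv_into_f_f[OF inj_code])

lemma Union_coded_thickening: "\<Union>coded_thickening = code ` carrier (racg X)"
proof -
  have "\<Union>coded_thickening = code ` \<Union>(clique_complex (carrier (racg X)) adjacent)"
    unfolding coded_thickening_def by (rule image_Union[symmetric])
  then show ?thesis by (simp add: Union_clique_complex adjacent_refl)
qed

lemma coded_thickening_iso: "complex_iso (clique_complex (carrier (racg X)) adjacent) coded_thickening"
  unfolding complex_iso_def
proof (intro exI conjI)
  show "bij_betw code (\<Union>(clique_complex (carrier (racg X)) adjacent)) (\<Union>coded_thickening)"
    unfolding Union_coded_thickening
    using inj_code by (simp add: Union_clique_complex adjacent_refl bij_betw_def)
qed (simp add: coded_thickening_def)

lemma coded_thickeningE:
  assumes "\<sigma> \<in> coded_thickening"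
  obtains \<tau> where "\<sigma> = code ` \<tau>" "finite \<tau>" "\<tau> \<noteq> {}" "\<tau> \<subseteq> carrier (racg X)"
    "\<forall>x\<in>\<tau>. \<forall>y\<in>\<tau>. adjacent x y"
  using assms unfolding coded_thickening_def clique_complex_def by blast

lemma coded_thickeningI:
  assumes "finite \<tau>" "\<tau> \<noteq> {}" "\<And>x y. x \<in> \<tau> \<Longrightarrow> y \<in> \<tau> \<Longrightarrow> adjacent x y"
  shows "code ` \<tau> \<in> coded_thickening"
proof -
  have "\<tau> \<subseteq> carrier (racg X)" using assms(3) adjacent_closed by blast
  then show ?thesis unfolding coded_thickening_def clique_complex_def using assms by blast
qed

lemma k_large_coded_thickening:
  assumes "k_large k X"
  shows "k_large k coded_thickening"
proof -
  have "k_large k (clique_complex (carrier (racg X)) adjacent)"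
    using k_large_davis[OF assms] by (subst k_large_clique_complex[OF adjacent_refl adjacent_sym])
  then show ?thesis by (rule k_large_complex_iso[OF coded_thickening_iso])
qed

lemma abs_complex_coded_thickening: "abs_complex coded_thickening"
proof -
  obtain f where f: "bij_betw f (\<Union>(clique_complex (carrier (racg X)) adjacent)) (\<Union>coded_thickening)"
    "(\<lambda>\<sigma>. f ` \<sigma>) ` clique_complex (carrier (racg X)) adjacent = coded_thickening"
    using coded_thickening_iso unfolding complex_iso_def by blast
  show ?thesis by (rule complex_iso_abs_complex[OF f abs_complex_clique_complex])
qed

lemma locally_finite_coded_thickening: "locally_finite_complex coded_thickening"
  unfolding locally_finite_complex_def
proof (intro conjI allI)
  show "abs_complex coded_thickening" by (rule abs_complex_coded_thickening)
  fix v
  have "{\<sigma> \<in> coded_thickening. v \<in> \<sigma>} \<subseteq> Pow (code ` {y. adjacent (decode v) y})"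
  proof
    fix \<sigma> assume "\<sigma> \<in> {\<sigma> \<in> coded_thickening. v \<in> \<sigma>}"
    then have \<sigma>: "\<sigma> \<in> coded_thickening" "v \<in> \<sigma>" by auto
    obtain \<tau> where \<tau>: "\<sigma> = code ` \<tau>" "finite \<tau>" "\<tau> \<noteq> {}" "\<tau> \<subseteq> carrier (racg X)"
      "\<forall>x\<in>\<tau>. \<forall>y\<in>\<tau>. adjacent x y"
      using \<sigma>(1) by (rule coded_thickeningE)
    obtain x where "x \<in> \<tau>" "v = code x" using \<sigma>(2) \<tau>(1) by blast
    then have "decode v \<in> \<tau>" using \<tau>(4) by auto
    then show "\<sigma> \<in> Pow (code ` {y. adjacent (decode v) y})" using \<tau>(1,5) by auto
  qed
  then show "finite {\<sigma> \<in> coded_thickening. v \<in> \<sigma>}"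
    by (rule finite_subset) (simp add: finite_adjacent)
qed

text \<open>To see that a simplex and its pushed image span a simplex, domination is used twice:
  first for a top vertex \<open>x\<close> and another vertex \<open>y\<close> of the simplex, then
  for \<open>x\<close> and the already pushed \<open>r y\<close>. The first use makes
  \<open>r y\<close> adjacent to \<open>x\<close>, and its height is still at most
  \<open>n\<close>.\<close>

lemma simply_connected_coded_thickening: "simply_connected_space (realization coded_thickening)"
proof (rule simply_connected_realization[OF locally_finite_coded_thickening,
      where d = "\<lambda>v. height (decode v)" and \<rho> = "\<lambda>v. code (descend (decode v))" and base = "code \<one>\<^bsub>racg X\<^esub>"])
  show "code \<one>\<^bsub>racg X\<^esub> \<in> \<Union>coded_thickening" by (simp add: Union_coded_thickening)
next
  fix v assume "v \<in> \<Union>coded_thickening" "height (decode v) = 0"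
  then show "v = code \<one>\<^bsub>racg X\<^esub>"
    using height_zero unfolding Union_coded_thickening by auto
next
  fix v assume "v \<in> \<Union>coded_thickening" "0 < height (decode v)"
  then show "height (decode (code (descend (decode v)))) < height (decode v)"
    unfolding Union_coded_thickening using height_descend descend_closed by auto
next
  fix \<sigma> n assume \<sigma>: "\<sigma> \<in> coded_thickening" and n: "0 < n" and le: "\<And>v. v \<in> \<sigma> \<Longrightarrow> height (decode v) \<le> n"
  obtain \<tau> where \<tau>: "\<sigma> = code ` \<tau>" "finite \<tau>" "\<tau> \<noteq> {}" "\<tau> \<subseteq> carrier (racg X)"
    "\<forall>x\<in>\<tau>. \<forall>y\<in>\<tau>. adjacent x y"
    using \<sigma> by (rule coded_thickeningE)
  define r where "r x = (if height x = n then descend x else x)" for x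
  have W: "x \<in> carrier (racg X)" if "x \<in> \<tau>" for x using \<tau>(4) that by blast
  have h: "height x \<le> n" if "x \<in> \<tau>" for x
    using le[of "code x"] \<tau>(1) that W[OF that] by auto
  have a1: "adjacent (r x) y" if "x \<in> \<tau>" "y \<in> carrier (racg X)" "adjacent x y" "height y \<le> n" for x y
    unfolding r_def using descend_dominates[OF W[OF that(1)] _ that(3)] that n by simp
  have hr: "height (r x) \<le> n" and rW: "r x \<in> carrier (racg X)" if "x \<in> \<tau>" for x
    unfolding r_def using height_descend[OF W[OF that]] descend_closed[OF W[OF that]] h[OF that] W[OF that] n
    by auto
  have a2: "adjacent (r x) y" if "x \<in> \<tau>" "y \<in> \<tau>" for x y
    by (rule a1[OF that(1) W[OF that(2)] \<tau>(5)[rule_format, OF that] h[OF that(2)]])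
  have a3: "adjacent (r x) (r y)" if "x \<in> \<tau>" "y \<in> \<tau>" for x y
    by (rule a1[OF that(1) rW[OF that(2)] adjacent_sym[OF a2[OF that(2,1)]] hr[OF that(2)]])
  have "code ` (\<tau> \<union> r ` \<tau>) \<in> coded_thickening"
  proof (rule coded_thickeningI)
    fix x y assume "x \<in> \<tau> \<union> r ` \<tau>" "y \<in> \<tau> \<union> r ` \<tau>"
    then show "adjacent x y" using \<tau>(5) a2 a3 adjacent_sym by blast
  qed (use \<tau>(2,3) in simp_all)
  moreover have "\<sigma> \<union> (\<lambda>v. if height (decode v) = n then code (descend (decode v)) else v) ` \<sigma> = code ` (\<tau> \<union> r ` \<tau>)"
  proof -
    have "(\<lambda>v. if height (decode v) = n then code (descend (decode v)) else v) ` code ` \<tau> = code ` r ` \<tau>"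
      unfolding image_image by (rule image_cong[OF refl]) (simp add: r_def W)
    then show ?thesis unfolding \<tau>(1) by (simp add: image_Un)
  qed
  ultimately show "\<sigma> \<union> (\<lambda>v. if height (decode v) = n then code (descend (decode v)) else v) ` \<sigma> \<in> coded_thickening"
    by simp
qed

lemma k_systolic_coded_thickening:
  assumes "k_large k X"
  shows "k_systolic k coded_thickening"
  unfolding k_systolic_def locally_k_large_def
  using simply_connected_coded_thickening abs_complex_coded_thickening
    k_large_coded_thickening[OF assms] k_large_link[OF k_large_coded_thickening[OF assms]]
  by (simp add: k_large_def)

section \<open>The geometric action of the group\<close>

lemma coded_action_code:
  "x \<in> carrier (racg X) \<Longrightarrow> coded_action g (code x) = code (g \<otimes>\<^bsub>racg X\<^esub> x)"
  by (simp add: coded_action_def)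

lemma coded_action_simplex:
  assumes g: "g \<in> carrier (racg X)" and \<sigma>: "\<sigma> \<in> coded_thickening"
  shows "coded_action g ` \<sigma> \<in> coded_thickening"
proof -
  obtain \<tau> where \<tau>: "\<sigma> = code ` \<tau>" "finite \<tau>" "\<tau> \<noteq> {}" "\<tau> \<subseteq> carrier (racg X)"
    "\<forall>x\<in>\<tau>. \<forall>y\<in>\<tau>. adjacent x y"
    using \<sigma> by (rule coded_thickeningE)
  have "coded_action g ` \<sigma> = code ` (\<lambda>x. g \<otimes>\<^bsub>racg X\<^esub> x) ` \<tau>"
    unfolding \<tau>(1) image_image using \<tau>(4) by (intro image_cong refl) (auto simp: coded_action_code)
  moreover have "code ` (\<lambda>x. g \<otimes>\<^bsub>racg X\<^esub> x) ` \<tau> \<in> coded_thickening"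
    by (rule coded_thickeningI) (use \<tau>(2,3) adjacent_mult_left[OF g \<tau>(5)[rule_format]] in auto)
  ultimately show ?thesis by simp
qed

lemma coded_action_inverse:
  assumes g: "g \<in> carrier (racg X)" and v: "v \<in> code ` carrier (racg X)"
  shows "coded_action g (coded_action (inv\<^bsub>racg X\<^esub> g) v) = v"
    "coded_action (inv\<^bsub>racg X\<^esub> g) (coded_action g v) = v"
  using g v by (auto simp: coded_action_code m_assoc[symmetric])

lemma group_action_coded: "group_action (racg X) (\<Union>coded_thickening) coded_action"
proof -
  let ?E = "code ` carrier (racg X)"
  have mem: "coded_action g v \<in> ?E" if "g \<in> carrier (racg X)" "v \<in> ?E" for g v
    using that by (auto simp: coded_action_code)
  have Bij: "coded_action g \<in> Bij ?E" if g: "g \<in> carrier (racg X)" for g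
  proof -
    have "bij_betw (coded_action g) ?E ?E"
      by (rule bij_betw_byWitness[where f' = "coded_action (inv\<^bsub>racg X\<^esub> g)"])
        (use coded_action_inverse[OF g] mem g in auto)
    then show ?thesis by (simp add: Bij_def coded_action_def)
  qed
  have comp: "coded_action (g \<otimes>\<^bsub>racg X\<^esub> h) = compose ?E (coded_action g) (coded_action h)"
    if "g \<in> carrier (racg X)" "h \<in> carrier (racg X)" for g h
  proof
    fix v
    show "coded_action (g \<otimes>\<^bsub>racg X\<^esub> h) v = compose ?E (coded_action g) (coded_action h) v"
    proof (cases "v \<in> ?E")
      case True
      then show ?thesis using that by (auto simp: compose_def coded_action_code m_assoc)
    next
      case False
      then show ?thesis by (simp add: compose_def coded_action_def)
    qed
  qed
  have "coded_action \<in> hom (racg X) (BijGroup ?E)"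
    by (rule homI) (simp_all add: BijGroup_def Bij comp)
  then have "group_hom (racg X) (BijGroup ?E) coded_action"
    by (intro group_hom.intro group_racg group_BijGroup group_hom_axioms.intro)
  then show ?thesis unfolding Union_coded_thickening by (rule group_action.intro)
qed

lemma realization_coded: "realization coded_thickening = top_of_set (realization_points coded_thickening)"
  by (rule realization_eq_top_of_set[OF locally_finite_coded_thickening])

lemma realization_map_coded_action:
  assumes "g \<in> carrier (racg X)" "\<alpha> \<in> realization_points coded_thickening"
  shows "realization_map (coded_action g) \<alpha> \<in> realization_points coded_thickening"
    "{w. realization_map (coded_action g) \<alpha> w \<noteq> 0} = coded_action g ` {v. \<alpha> v \<noteq> 0}"
proof -
  note D = realization_pointsD[OF abs_complex_coded_thickening assms(2)]
  show "realization_map (coded_action g) \<alpha> \<in> realization_points coded_thickening"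
    by (rule realization_map_point[OF abs_complex_coded_thickening assms(2) coded_action_simplex[OF assms(1) D(2)]])
  show "{w. realization_map (coded_action g) \<alpha> w \<noteq> 0} = coded_action g ` {v. \<alpha> v \<noteq> 0}"
    by (rule support_realization_map[OF D(1,4)])
qed

lemma support_coded_vertices:
  assumes "\<alpha> \<in> realization_points coded_thickening" "\<alpha> v \<noteq> 0"
  shows "v \<in> code ` carrier (racg X)"
  using realization_pointsD(2)[OF abs_complex_coded_thickening assms(1)] assms(2)
  unfolding Union_coded_thickening[symmetric] by blast

text \<open>Left multiplication is determined by one vertex \<open>w\<close> and its image
  \<open>u\<close>. If a point of \<open>C\<close> is moved into \<open>C\<close>, such a pair
  exists with \<open>u\<close> in the finite set \<open>V\<close> and \<open>w\<close> in the finite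
  set \<open>N\<close> of vertices near \<open>V\<close>.\<close>

lemma properly_discontinuous_coded: "properly_discontinuous (racg X) coded_thickening coded_action"
  unfolding properly_discontinuous_def
proof (intro allI impI)
  fix C assume "compactin (realization coded_thickening) C"
  then have C: "compact C" "C \<subseteq> realization_points coded_thickening"
    unfolding realization_coded by (auto simp: compactin_subtopology)
  obtain V where V: "finite V" "\<And>\<alpha>. \<alpha> \<in> C \<Longrightarrow> \<exists>v\<in>V. \<alpha> v \<noteq> 0"
    using compact_meets_finitely_many_stars[OF abs_complex_coded_thickening C] by blast
  define N where "N = \<Union>{\<sigma> \<in> coded_thickening. \<sigma> \<inter> V \<noteq> {}}"
  have N: "finite N" unfolding N_def by (rule finite_neighbours[OF locally_finite_coded_thickening V(1)])
  have "{g \<in> carrier (racg X). realization_map (coded_action g) ` C \<inter> C \<noteq> {}} \<subseteq>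
      (\<lambda>(w, u). decode u \<otimes>\<^bsub>racg X\<^esub> inv\<^bsub>racg X\<^esub> (decode w)) ` (N \<times> V)"
  proof
    fix g assume "g \<in> {g \<in> carrier (racg X). realization_map (coded_action g) ` C \<inter> C \<noteq> {}}"
    then obtain \<alpha> where g: "g \<in> carrier (racg X)" and \<alpha>: "\<alpha> \<in> C" "realization_map (coded_action g) \<alpha> \<in> C"
      by auto
    have \<alpha>R: "\<alpha> \<in> realization_points coded_thickening" using C(2) \<alpha>(1) by blast
    obtain u where u: "u \<in> V" "realization_map (coded_action g) \<alpha> u \<noteq> 0" using V(2)[OF \<alpha>(2)] by blast
    then have "u \<in> coded_action g ` {v. \<alpha> v \<noteq> 0}"
      using realization_map_coded_action(2)[OF g \<alpha>R] by (metis mem_Collect_eq)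
    then obtain w where w: "\<alpha> w \<noteq> 0" "u = coded_action g w" by blast
    obtain v where v: "v \<in> V" "\<alpha> v \<noteq> 0" using V(2)[OF \<alpha>(1)] by blast
    have "{v. \<alpha> v \<noteq> 0} \<in> coded_thickening"
      by (rule realization_pointsD(2)[OF abs_complex_coded_thickening \<alpha>R])
    then have wN: "w \<in> N" unfolding N_def using v w(1) by blast
    obtain x where x: "x \<in> carrier (racg X)" "w = code x"
      using support_coded_vertices[OF \<alpha>R w(1)] by blast
    have "decode u \<otimes>\<^bsub>racg X\<^esub> inv\<^bsub>racg X\<^esub> (decode w) = g"
      using w(2) x g by (simp add: coded_action_code m_assoc)
    then show "g \<in> (\<lambda>(w, u). decode u \<otimes>\<^bsub>racg X\<^esub> inv\<^bsub>racg X\<^esub> (decode w)) ` (N \<times> V)"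
      using wN u(1) by force
  qed
  then show "finite {g \<in> carrier (racg X). realization_map (coded_action g) ` C \<inter> C \<noteq> {}}"
    by (rule finite_subset) (use N V(1) in simp)
qed

text \<open>The group is transitive on vertices, so the translates of the closed star of the vertex
  1 cover the realization. By local finiteness this star is a finite union of compact
  simplices.\<close>

lemma cocompact_coded: "cocompact (racg X) coded_thickening coded_action"
proof -
  let ?R = "realization_points coded_thickening"
  note abs = abs_complex_coded_thickening
  let ?o = "code \<one>\<^bsub>racg X\<^esub>"
  define C where "C = (\<Union>\<sigma>\<in>{\<sigma> \<in> coded_thickening. ?o \<in> \<sigma>}. closed_simplex coded_thickening \<sigma>)"
  have "finite {\<sigma> \<in> coded_thickening. ?o \<in> \<sigma>}"
    using locally_finite_coded_thickening by (simp add: locally_finite_complex_def)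
  then have "compact C"
    unfolding C_def by (rule compact_UN) (use compact_closed_simplex[OF abs] in blast)
  moreover have CR: "C \<subseteq> ?R" unfolding C_def closed_simplex_def by blast
  ultimately have comp: "compactin (realization coded_thickening) C"
    unfolding realization_coded by (simp add: compactin_subtopology)
  have "(\<Union>g\<in>carrier (racg X). realization_map (coded_action g) ` C) = ?R"
  proof (rule subset_antisym; rule subsetI)
    fix \<beta> assume "\<beta> \<in> (\<Union>g\<in>carrier (racg X). realization_map (coded_action g) ` C)"
    then show "\<beta> \<in> ?R" using realization_map_coded_action(1) CR by blast
  next
    fix \<alpha> assume \<alpha>: "\<alpha> \<in> ?R"
    note D = realization_pointsD[OF abs \<alpha>]
    obtain v where "0 < \<alpha> v" using \<alpha> by (rule realization_points_positive)
    then have v: "\<alpha> v \<noteq> 0" by simp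
    obtain x where x: "x \<in> carrier (racg X)" "v = code x"
      using support_coded_vertices[OF \<alpha> v] by blast
    let ?y = "inv\<^bsub>racg X\<^esub> x"
    define \<beta> where "\<beta> = realization_map (coded_action ?y) \<alpha>"
    have y: "?y \<in> carrier (racg X)" using x(1) by simp
    have \<beta>: "\<beta> \<in> ?R" "{w. \<beta> w \<noteq> 0} = coded_action ?y ` {v. \<alpha> v \<noteq> 0}"
      unfolding \<beta>_def by (rule realization_map_coded_action[OF y \<alpha>])+
    have "?o = coded_action ?y v" using x by (simp add: coded_action_code)
    then have "?o \<in> {w. \<beta> w \<noteq> 0}" unfolding \<beta>(2) by (rule image_eqI) (use v in simp)
    moreover have "{w. \<beta> w \<noteq> 0} \<in> coded_thickening" by (rule realization_pointsD(2)[OF abs \<beta>(1)])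
    moreover have "\<beta> \<in> closed_simplex coded_thickening {w. \<beta> w \<noteq> 0}"
      using \<beta>(1) by (simp add: closed_simplex_def)
    ultimately have "\<beta> \<in> C" unfolding C_def by blast
    moreover have "realization_map (coded_action x) \<beta> = \<alpha>"
    proof -
      have "realization_map (coded_action x) \<beta> = realization_map (coded_action x \<circ> coded_action ?y) \<alpha>"
        unfolding \<beta>_def by (rule realization_map_comp[OF D(1,4)])
      also have "\<dots> = \<alpha>"
        by (rule realization_map_id) (simp add: coded_action_inverse(1)[OF x(1) support_coded_vertices[OF \<alpha>]])
      finally show ?thesis .
    qed
    ultimately show "\<alpha> \<in> (\<Union>g\<in>carrier (racg X). realization_map (coded_action g) ` C)"
      using x(1) by blast
  qed
  then show ?thesis
    unfolding cocompact_def using comp by (intro exI[of _ C]) (simp add: realization_coded)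
qed

lemma k_systolic_group_racg:
  assumes "k_large k X"
  shows "k_systolic_group k (racg X)"
  unfolding k_systolic_group_def geometric_action_def simplicial_action_def
  using k_systolic_coded_thickening[OF assms] group_action_coded coded_action_simplex
    properly_discontinuous_coded cocompact_coded
  by blast

end

theorem proposition6p1:
  fixes k n :: nat
    and Xs :: "nat \<Rightarrow> 'v set set"
    and H :: "nat \<Rightarrow> 'v list set set"
    and X0 X :: "'v set set"
  assumes "6 \<le> k"
    and "finite X0" "k_large 5 X0"
    and "finite X" "k_large 5 X"
    and "Xs 0 = X0" "Xs n = X"
    and "\<And>i. i < n \<Longrightarrow> basic_step (Xs i) (H i) (Xs (Suc i))"
    and "k_large k X0"
    and "\<And>i. i < n \<Longrightarrow> min_displacement_ge k (Xs i) (H i)"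
  shows "k_large k X \<and> k_systolic_group k (racg X)"
proof
  have "k_large k (Xs i)" if "i \<le> n" for i
    using that
  proof (induction i)
    case 0
    then show ?case using assms(6,9) by simp
  next
    case (Suc i)
    then have "i < n" "k_large k (Xs i)" by simp_all
    then show ?case
      using assms(1) by (intro k_large_basic_step[OF _ assms(8) _ assms(10)]) simp_all
  qed
  from this[of n] show X: "k_large k X" using assms(7) by simp
  interpret nerve X
    using X assms(4) by unfold_locales (simp_all add: k_large_def)
  show "k_systolic_group k (racg X)" by (rule k_systolic_group_racg[OF X])
qed

end
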